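(* Suppose $P: \mathbb{C}^d \rightarrow \mathbb{R}$ is a non-negative, non-degenerate, convex, homogeneous polynomial with $P(0)=0$. If $$\Omega = \{ (z_0, z_1, \dots, z_d) \in \mathbb{C}^{d+1} : \operatorname{Im}(z_0) > P(z_1, \dots, z_d) \},$$ then $(\Omega, K_{\Omega})$ is Gromov hyperbolic, where $K_\Omega$ is the Kobayashi distance on $\Omega$.
   Context: Here $P$ is a real-valued polynomial on $\mathbb{C}^d\cong\mathbb{R}^{2d}$ (i.e. a polynomial in the real and imaginary parts of the coordinates). A non-negative convex polynomial $P:\mathbb{C}^d \rightarrow \mathbb{R}_{\geq 0}$ is non-degenerate if $P^{-1}(0)$ does not contain any complex affine lines. Kobayashi metric and distance: let $\Delta=\{z\in\mathbb{C}:|z|<1\}$. For a domain $\Omega\subset\mathbb{C}^{n}$, $x \in \Omega$ and $v \in \mathbb{C}^n$ put $k_{\Omega}(x;v) = \inf \{ |\xi| : f:\Delta\to\Omega \text{ holomorphic},\ f(0) = x,\ d(f)_0(\xi) = v \}$. For an absolutely continuous curve $\sigma:[a,b]\to\Omega$ put $\ell_\Omega(\sigma)= \int_a^b k_\Omega(\sigma(t); \sigma'(t))\, dt$. The Kobayashi (pseudo-)distance $K_\Omega(x,y)$ is the infimum of $\ell_\Omega(\sigma)$ over all absolutely continuous curves $\sigma:[a,b]\to\Omega$ with $\sigma(a)=x$ and $\sigma(b)=y$. Gromov hyperbolicity: in a metric space $(X,d)$, a geodesic is a curve $\sigma : I \to X$ ($I\subset\mathbb{R}$ an interval) with $d(\sigma(t_1),\sigma(t_2))=|t_1-t_2|$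 for all $t_1,t_2\in I$. A geodesic triangle is a choice of three points and geodesic segments connecting them; it is $\delta$-thin if any point on any side is within distance $\delta$ of the union of the other two sides. A proper geodesic metric space is $\delta$-hyperbolic if every geodesic triangle is $\delta$-thin, and Gromov hyperbolic if it is $\delta$-hyperbolic for some $\delta \ge 0$. *)

theory Defs
  imports "HOL-Complex_Analysis.Complex_Analysis"
begin

section \<open>Polynomials on complex space\<close>

text \<open>
  A real-valued polynomial on \<open>\<complex>\<^sup>d\<close> is a real polynomial in the real and imaginary parts of the
  coordinates. The exponent pairs \<open>(a, b)\<close> below are multi-indices for the monomials
  \<open>\<Prod>i. (Re z\<^sub>i)^(a i) * (Im z\<^sub>i)^(b i)\<close>; homogeneity of degree \<open>m\<close> says that every monomial has
  total degree \<open>m\<close> in these \<open>2d\<close> real variables.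
\<close>

definition real_monomial :: "('d::finite \<Rightarrow> nat) \<Rightarrow> ('d \<Rightarrow> nat) \<Rightarrow> complex^'d \<Rightarrow> real" where
  "real_monomial a b z = (\<Prod>i\<in>UNIV. Re (z $ i) ^ a i * Im (z $ i) ^ b i)"

definition homogeneous_polynomial :: "nat \<Rightarrow> (complex^'d::finite \<Rightarrow> real) \<Rightarrow> bool" where
  "homogeneous_polynomial m P \<longleftrightarrow>
     (\<exists>A c. finite A \<and>
        (\<forall>(a, b)\<in>A. (\<Sum>i\<in>UNIV. a i) + (\<Sum>i\<in>UNIV. b i) = m) \<and>
        (\<forall>z. P z = (\<Sum>(a, b)\<in>A. c a b * real_monomial a b z)))"

definition complex_affine_line :: "(complex^'d::finite) set \<Rightarrow> bool" where
  "complex_affine_line L \<longleftrightarrow> (\<exists>p v. v \<noteq> 0 \<and> L = {p + \<zeta> *s v |\<zeta>. True})"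

definition nondegenerate :: "(complex^'d::finite \<Rightarrow> real) \<Rightarrow> bool" where
  "nondegenerate P \<longleftrightarrow> \<not> (\<exists>L. complex_affine_line L \<and> L \<subseteq> P -` {0})"


section \<open>The Kobayashi metric and distance\<close>

definition holomorphic_map :: "(complex \<Rightarrow> complex^'n::finite) \<Rightarrow> complex set \<Rightarrow> bool" where
  "holomorphic_map f S \<longleftrightarrow> (\<forall>i. (\<lambda>z. f z $ i) holomorphic_on S)"

definition kobayashi_metric :: "(complex^'n::finite) set \<Rightarrow> complex^'n \<Rightarrow> complex^'n \<Rightarrow> real" where
  "kobayashi_metric \<Omega> x v =
     Inf {cmod \<xi> |\<xi> f. holomorphic_map f (ball 0 1) \<and> f ` ball 0 1 \<subseteq> \<Omega> \<and> f 0 = x \<and>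
                       \<xi> *s (\<chi> i. deriv (\<lambda>z. f z $ i) 0) = v}"

definition absolutely_continuous_curve :: "real \<Rightarrow> real \<Rightarrow> (real \<Rightarrow> 'a::metric_space) \<Rightarrow> bool" where
  "absolutely_continuous_curve a b \<sigma> \<longleftrightarrow>
     (\<forall>\<epsilon>>0. \<exists>\<delta>>0. \<forall>D. finite D \<longrightarrow>
        (\<forall>(s, t)\<in>D. a \<le> s \<and> s \<le> t \<and> t \<le> b) \<longrightarrow>
        pairwise (\<lambda>(s, t) (s', t'). {s<..<t} \<inter> {s'<..<t'} = {}) D \<longrightarrow>
        (\<Sum>(s, t)\<in>D. t - s) < \<delta> \<longrightarrow>
        (\<Sum>(s, t)\<in>D. dist (\<sigma> s) (\<sigma> t)) < \<epsilon>)"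

text \<open>
  The derivative of an absolutely continuous curve exists almost everywhere, so the unspecified
  value of \<^const>\<open>vector_derivative\<close> on the exceptional null set does not affect the length.
\<close>

definition kobayashi_length ::
    "(complex^'n::finite) set \<Rightarrow> real \<Rightarrow> real \<Rightarrow> (real \<Rightarrow> complex^'n) \<Rightarrow> ennreal" where
  "kobayashi_length \<Omega> a b \<sigma> =
     (\<integral>\<^sup>+t\<in>{a..b}. ennreal (kobayashi_metric \<Omega> (\<sigma> t) (vector_derivative \<sigma> (at t within {a..b})))
       \<partial>lebesgue)"

text \<open>
  If \<open>\<Omega>\<close> is a domain, any two of its points are joined by an absolutely continuous curve of finite
  length, so the infimum is finite. When there is no such curve the value is \<open>0\<close> by the
  convention for \<^const>\<open>enn2real\<close>.
\<close>

definition kobayashi_dist :: "(complex^'n::finite) set \<Rightarrow> complex^'n \<Rightarrow> complex^'n \<Rightarrow> real" where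
  "kobayashi_dist \<Omega> x y =
     enn2real (Inf {kobayashi_length \<Omega> a b \<sigma> |a b \<sigma>.
       a \<le> b \<and> absolutely_continuous_curve a b \<sigma> \<and> \<sigma> ` {a..b} \<subseteq> \<Omega> \<and> \<sigma> a = x \<and> \<sigma> b = y})"


section \<open>Gromov hyperbolicity\<close>

definition geodesic :: "'a set \<Rightarrow> ('a \<Rightarrow> 'a \<Rightarrow> real) \<Rightarrow> real set \<Rightarrow> (real \<Rightarrow> 'a) \<Rightarrow> bool" where
  "geodesic M d I \<sigma> \<longleftrightarrow>
     is_interval I \<and> \<sigma> ` I \<subseteq> M \<and> (\<forall>s\<in>I. \<forall>t\<in>I. d (\<sigma> s) (\<sigma> t) = \<bar>s - t\<bar>)"

definition geodesic_segment ::
    "'a set \<Rightarrow> ('a \<Rightarrow> 'a \<Rightarrow> real) \<Rightarrow> 'a \<Rightarrow> 'a \<Rightarrow> 'a set \<Rightarrow> bool" where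
  "geodesic_segment M d x y S \<longleftrightarrow>
     (\<exists>a b \<sigma>. a \<le> b \<and> geodesic M d {a..b} \<sigma> \<and> \<sigma> a = x \<and> \<sigma> b = y \<and> S = \<sigma> ` {a..b})"

definition geodesic_metric_space :: "'a set \<Rightarrow> ('a \<Rightarrow> 'a \<Rightarrow> real) \<Rightarrow> bool" where
  "geodesic_metric_space M d \<longleftrightarrow>
     Metric_space M d \<and> (\<forall>x\<in>M. \<forall>y\<in>M. \<exists>S. geodesic_segment M d x y S)"

definition proper_metric_space :: "'a set \<Rightarrow> ('a \<Rightarrow> 'a \<Rightarrow> real) \<Rightarrow> bool" where
  "proper_metric_space M d \<longleftrightarrow>
     Metric_space M d \<and>
     (\<forall>x\<in>M. \<forall>r. compactin (Metric_space.mtopology M d) (Metric_space.mcball M d x r))"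

definition geodesic_triangle ::
    "'a set \<Rightarrow> ('a \<Rightarrow> 'a \<Rightarrow> real) \<Rightarrow> 'a set \<Rightarrow> 'a set \<Rightarrow> 'a set \<Rightarrow> bool" where
  "geodesic_triangle M d S1 S2 S3 \<longleftrightarrow>
     (\<exists>x\<in>M. \<exists>y\<in>M. \<exists>z\<in>M.
        geodesic_segment M d x y S1 \<and> geodesic_segment M d y z S2 \<and> geodesic_segment M d z x S3)"

definition thin_triangle ::
    "('a \<Rightarrow> 'a \<Rightarrow> real) \<Rightarrow> real \<Rightarrow> 'a set \<Rightarrow> 'a set \<Rightarrow> 'a set \<Rightarrow> bool" where
  "thin_triangle d \<delta> S1 S2 S3 \<longleftrightarrow>
     (\<forall>p\<in>S1. \<exists>q\<in>S2 \<union> S3. d p q \<le> \<delta>) \<and>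
     (\<forall>p\<in>S2. \<exists>q\<in>S3 \<union> S1. d p q \<le> \<delta>) \<and>
     (\<forall>p\<in>S3. \<exists>q\<in>S1 \<union> S2. d p q \<le> \<delta>)"

definition delta_hyperbolic :: "real \<Rightarrow> 'a set \<Rightarrow> ('a \<Rightarrow> 'a \<Rightarrow> real) \<Rightarrow> bool" where
  "delta_hyperbolic \<delta> M d \<longleftrightarrow>
     proper_metric_space M d \<and> geodesic_metric_space M d \<and>
     (\<forall>S1 S2 S3. geodesic_triangle M d S1 S2 S3 \<longrightarrow> thin_triangle d \<delta> S1 S2 S3)"

definition gromov_hyperbolic :: "'a set \<Rightarrow> ('a \<Rightarrow> 'a \<Rightarrow> real) \<Rightarrow> bool" where
  "gromov_hyperbolic M d \<longleftrightarrow> (\<exists>\<delta>\<ge>0. delta_hyperbolic \<delta> M d)"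

end

(* For every p the complex affine function "support p" whose imaginary part is the supporting
   functional of the domain at the boundary point over p maps the domain into the upper half plane.
   The Schwarz lemma then gives all lower bounds for the Kobayashi metric, and affine discs give the
   upper bounds.

   Vertical lines are geodesics: raising a point from height h to height R costs log(R/h)/2. Let
   reach(x, y) be the height to which x and y must be raised to be at bounded distance. Since the
   polynomial has degree at most m on lines, a step of Kobayashi length t at height h changes
   log(reach) by at most a constant times t (h / reach)^(1/m); this gain is what finite type
   provides, and it makes a suitable potential 1-Lipschitz. Up to additive constants this yields
     K(x, y) = log(reach(x, y)) - log(height(x)) / 2 - log(height(y)) / 2,
   so K(x, y) + log(height(x)) / 2 + log(height(y)) / 2 is an ultrametric up to an additive
   constant, which is Gromov's four point inequality.

   The distance is defined through absolutely continuous curves, hence the lower bounds need the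
   almost everywhere differentiability of such curves (Vitali's covering theorem). *)
theory Submission
  imports Defs
begin

no_notation fps_nth (infixl "$" 75)

section \<open>Absolutely continuous curves\<close>

text \<open>Only additive errors are allowed, but the naive potential
  \<open>ln reach - ln height / 2\<close> has a multiplicative one. Along a step of Kobayashi length
  t, \<open>ln height / 2\<close> changes by at most t and \<open>ln reach\<close> grows by at most
  \<epsilon> t, where \<epsilon> is a constant times (height / reach)^(1/m); so the naive potential
  is only (1 + \<epsilon>)-Lipschitz. \<open>Phi\<close> instead adds
  \<open>ln reach - ln height\<close> to \<open>ln height / 2\<close> with weight 1 - \<epsilon>.
  The coefficient of \<open>ln height\<close> becomes \<epsilon> - 1/2, and the slack gained there
  pays for the growth of \<open>ln reach\<close>, because (1 - \<epsilon>) \<epsilon> + |2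
  \<epsilon> - 1| \<le> 1. As \<epsilon> decays exponentially in
  \<open>ln reach - ln height\<close>, the missing weight costs an additive constant in total.
  Nondegeneracy makes directions of bounded scale bounded; this turns the estimates for
  \<open>reach\<close> into properness. Since \<open>reach\<close> is not visibly symmetric, the
  ultrametric inequality is stated for \<open>log_reach\<close>, which is built from the
  distance.\<close>

lemma Vitali_covering_intervals:
  fixes K :: "(real \<times> real) set"
  assumes K: "\<And>s t. (s, t) \<in> K \<Longrightarrow> s < t"
    and fine: "\<And>x d. x \<in> S \<Longrightarrow> 0 < d \<Longrightarrow> \<exists>s t. (s, t) \<in> K \<and> s \<le> x \<and> x \<le> t \<and> t - s < d"
  obtains C where "countable C" "C \<subseteq> K"
    "pairwise (\<lambda>i j. disjnt {fst i..snd i} {fst j..snd j}) C"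
    "negligible (S - (\<Union>i\<in>C. {fst i..snd i}))"
proof -
  have cb: "cball ((fst i + snd i) / 2) ((snd i - fst i) / 2) = {fst i..snd i}" for i :: "real \<times> real"
    by (auto simp: cball_eq_atLeastAtMost field_simps)
  have 1: "0 < (snd i - fst i) / 2" if "i \<in> K" for i
    using K[of "fst i" "snd i"] that by simp
  have 2: "\<exists>i. i \<in> K \<and> x \<in> cball ((fst i + snd i) / 2) ((snd i - fst i) / 2) \<and> (snd i - fst i) / 2 < d"
    if xS: "x \<in> S" and d: "0 < d" for x d
  proof -
    obtain s t where st: "(s, t) \<in> K" "s \<le> x" "x \<le> t" "t - s < d" using fine[OF xS d] by blast
    have "(t - s) / 2 < d" using st d K[OF st(1)] by auto
    then show ?thesis unfolding cb using st by (intro exI[of _ "(s, t)"]) auto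
  qed
  obtain C where "countable C" "C \<subseteq> K"
    "pairwise (\<lambda>i j. disjnt (cball ((fst i + snd i) / 2) ((snd i - fst i) / 2)) (cball ((fst j + snd j) / 2) ((snd j - fst j) / 2))) C"
    "negligible (S - (\<Union>i\<in>C. cball ((fst i + snd i) / 2) ((snd i - fst i) / 2)))"
    by (rule Vitali_covering_theorem_cballs[of K "\<lambda>i. (snd i - fst i) / 2" S "\<lambda>i. (fst i + snd i) / 2", OF 1 2])
  then show thesis unfolding cb by (rule that)
qed

section \<open>Lebesgue's theorem: monotone functions are differentiable almost everywhere\<close>

lemma mono_sum_disjoint_intervals:
  fixes f :: "real \<Rightarrow> real"
  assumes "finite F" "mono f" "s \<le> t"
    "\<And>p q. (p, q) \<in> F \<Longrightarrow> s \<le> p \<and> p < q \<and> q \<le> t"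
    "pairwise (\<lambda>i j. disjnt {fst i..snd i} {fst j..snd j}) F"
  shows "(\<Sum>i\<in>F. f (snd i) - f (fst i)) \<le> f t - f s"
  using assms
proof (induction "card F" arbitrary: F t)
  case 0
  then show ?case by (auto dest: monoD)
next
  case (Suc n)
  then have ne: "F \<noteq> {}" by auto
  \<comment> \<open>The interval with the largest left end point is removed; by disjointness the
    others end before \<open>fst i\<close>, which replaces \<open>t\<close> in the induction
    hypothesis.\<close>
  obtain i where i: "i \<in> F" "\<And>j. j \<in> F \<Longrightarrow> fst j \<le> fst i"
    using Max_in[of "fst ` F"] Max_ge[of "fst ` F"] ne \<open>finite F\<close> by fastforce
  have ib: "s \<le> fst i" "fst i < snd i" "snd i \<le> t" using Suc.prems(4)[of "fst i" "snd i"] i by auto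
  have sub: "s \<le> p \<and> p < q \<and> q \<le> fst i" if "(p, q) \<in> F - {i}" for p q
  proof -
    have b: "s \<le> p" "p < q" "q \<le> t" using Suc.prems(4) that by auto
    have "disjnt {p..q} {fst i..snd i}"
      using Suc.prems(5) that i(1) by (fastforce simp: pairwise_def)
    moreover have "p \<le> fst i" using i(2)[of "(p, q)"] that by auto
    ultimately have "q < fst i" using b ib by (force simp: disjnt_def)
    then show ?thesis using b by auto
  qed
  have "(\<Sum>i\<in>F - {i}. f (snd i) - f (fst i)) \<le> f (fst i) - f s"
    using Suc.hyps(1)[of "F - {i}" "fst i"] Suc.hyps(2) Suc.prems(1,2) i ib(1) sub
      pairwise_subset[OF Suc.prems(5), of "F - {i}"] by auto
  moreover have "(\<Sum>i\<in>F. f (snd i) - f (fst i)) = f (snd i) - f (fst i) + (\<Sum>i\<in>F - {i}. f (snd i) - f (fst i))"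
    by (rule sum.remove) (use Suc.prems(1) i in auto)
  moreover have "f (snd i) \<le> f t" using monoD[OF \<open>mono f\<close> ib(3)] .
  ultimately show ?case by linarith
qed

lemma measure_disjoint_intervals:
  assumes "finite F" "pairwise (\<lambda>i j. disjnt {fst i..snd i} {fst j..snd j}) F"
    "\<And>p q. (p, q) \<in> F \<Longrightarrow> p < (q::real)"
  shows "measure lebesgue (\<Union>i\<in>F. {fst i..snd i}) = (\<Sum>i\<in>F. snd i - fst i)"
proof -
  have le: "fst i < snd i" if "i \<in> F" for i using assms(3)[of "fst i" "snd i"] that by auto
  have "measure lebesgue (\<Union>i\<in>F. {fst i..snd i}) = (\<Sum>i\<in>F. measure lebesgue {fst i..snd i})"
  proof (rule measure_finite_Union[OF assms(1)])
    show "disjoint_family_on (\<lambda>i. {fst i..snd i}) F"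
      using assms(2) by (simp add: disjoint_family_on_def pairwise_def disjnt_def)
    show "emeasure lebesgue {fst i..snd i} \<noteq> \<infinity>" for i :: "real \<times> real"
      by (cases "fst i \<le> snd i") auto
  qed auto
  also have "\<dots> = (\<Sum>i\<in>F. snd i - fst i)"
    by (rule sum.cong) (use le in \<open>auto simp: less_imp_le\<close>)
  finally show ?thesis .
qed

lemma lmeasurable_outer_open:
  fixes W :: "'a::euclidean_space set"
  assumes "W \<in> lmeasurable" "e > 0"
  obtains U where "open U" "W \<subseteq> U" "U \<in> lmeasurable" "measure lebesgue U < measure lebesgue W + e"
proof -
  obtain U where U: "open U" "W \<subseteq> U" "U - W \<in> lmeasurable" "emeasure lebesgue (U - W) < ennreal e"
    using sets_lebesgue_outer_open[of W e] assms by (auto simp: fmeasurableD)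
  have "measure lebesgue (U - W) < e"
    using U assms(2) by (simp add: emeasure_eq_measure2 ennreal_less_iff)
  moreover have eq: "U = W \<union> (U - W)" using U by auto
  ultimately have "measure lebesgue U < measure lebesgue W + e"
    using measure_Un_le[of W lebesgue "U - W"] assms(1) U fmeasurableD[OF assms(1)] fmeasurableD[OF U(3)]
      by auto
  moreover have "U \<in> lmeasurable" using eq U assms(1) by (metis fmeasurable.Un)
  ultimately show thesis using that U by blast
qed

lemma measure_Union_intervals_le:
  assumes "countable C" "pairwise (\<lambda>i j. disjnt {fst i..snd i} {fst j..snd j}) C"
    "\<And>p q. (p, q) \<in> C \<Longrightarrow> p < (q::real)"
    "\<And>F. finite F \<Longrightarrow> F \<subseteq> C \<Longrightarrow> (\<Sum>i\<in>F. snd i - fst i) \<le> B"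
  shows "(\<Union>i\<in>C. {fst i..snd i}) \<in> lmeasurable" "measure lebesgue (\<Union>i\<in>C. {fst i..snd i}) \<le> B"
proof -
  let ?D = "(\<lambda>i. {fst i..snd i}) ` C"
  have c: "countable ?D" using assms(1) by simp
  have m: "D \<in> lmeasurable" if "D \<in> ?D" for D using that by auto
  have b: "measure lebesgue (\<Union>\<E>) \<le> B" if E: "\<E> \<subseteq> ?D" "finite \<E>" for \<E>
  proof -
    obtain F where F: "finite F" "F \<subseteq> C" "\<E> = (\<lambda>i. {fst i..snd i}) ` F"
      using finite_subset_image[OF E(2,1)] by blast
    show ?thesis unfolding F(3)
      using measure_disjoint_intervals[OF F(1) pairwise_subset[OF assms(2) F(2)]] assms(3) assms(4)[OF F(1,2)] F(2)
      by (metis subset_iff)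
  qed
  show "(\<Union>i\<in>C. {fst i..snd i}) \<in> lmeasurable" "measure lebesgue (\<Union>i\<in>C. {fst i..snd i}) \<le> B"
    using fmeasurable_Union_bound[OF c m b] measure_Union_bound[OF c m b] by auto
qed

text \<open>The two Vitali coverings: intervals of small slope exhaust the set, and inside them intervals
  of large slope exhaust it again; monotonicity compares the total increments.\<close>

lemma mono_slope_gap_negligible:
  fixes f :: "real \<Rightarrow> real"
  assumes f: "mono f" and E: "E \<subseteq> {c<..<d}" and ab: "0 < \<alpha>" "\<alpha> < \<beta>"
    and lo: "\<And>x e. x \<in> E \<Longrightarrow> 0 < e \<Longrightarrow> \<exists>s t. s < t \<and> s \<le> x \<and> x \<le> t \<and> t - s < e \<and> f t - f s < \<alpha> * (t - s)"
    and hi: "\<And>x e. x \<in> E \<Longrightarrow> 0 < e \<Longrightarrow> \<exists>s t. s < t \<and> s \<le> x \<and> x \<le> t \<and> t - s < e \<and> \<beta> * (t - s) < f t - f s"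
  shows "negligible E"
proof -
  \<comment> \<open>\<open>E\<close> need not be measurable, so its outer measure \<open>m\<close>
    is used.\<close>
  define \<W> where "\<W> = {W. W \<in> lmeasurable \<and> E \<subseteq> W}"
  define m where "m = Inf (measure lebesgue ` \<W>)"
  have Wne: "{c<..<d} \<in> \<W>" using E by (auto simp: \<W>_def)
  have bdd: "bdd_below (measure lebesgue ` \<W>)" by (rule bdd_belowI[of _ 0]) auto
  have m_le: "m \<le> measure lebesgue W" if "W \<in> \<W>" for W
    unfolding m_def using bdd that by (auto intro: cInf_lower)
  have m_le': "m \<le> B" if W: "W \<in> lmeasurable" "measure lebesgue W \<le> B" "negligible (E - W)" for W B
  proof -
    have "W \<union> (E - W) \<in> \<W>"
      using fmeasurable.Un[OF W(1) negligible_imp_measurable[OF W(3)]] by (simp add: \<W>_def)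
    moreover have "measure lebesgue (W \<union> (E - W)) \<le> measure lebesgue W + measure lebesgue (E - W)"
      using W by (intro measure_Un_le) (auto simp: negligible_imp_measurable fmeasurableD)
    ultimately show ?thesis using m_le W(2,3) negligible_imp_measure0[OF W(3)] by fastforce
  qed
  have m0: "0 \<le> m" unfolding m_def by (rule cInf_greatest) (use Wne in auto)
  \<comment> \<open>The intervals of small slope lie in \<open>U\<close>, so \<open>f\<close> rises
    on them by at most \<open>\<alpha> * (m + e)\<close> in total. The steep intervals nested in
    them still cover almost all of \<open>E\<close>, so their total length is at least
    \<open>m\<close> and they account for a rise of at least \<open>\<beta> * m\<close>.\<close>
  have main: "m \<le> \<alpha> / \<beta> * (m + e)" if e0: "e > 0" for e
  proof -
    have "\<exists>x\<in>measure lebesgue ` \<W>. x < m + e / 2"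
      by (rule cInf_lessD) (use Wne that in \<open>auto simp: m_def\<close>)
    then obtain W where W: "W \<in> \<W>" "measure lebesgue W < m + e / 2" by auto
    have "W \<in> lmeasurable" "e / 2 > 0" using W e0 unfolding \<W>_def by auto
    then obtain U where U: "open U" "W \<subseteq> U" "U \<in> lmeasurable" "measure lebesgue U < measure lebesgue W + e/2"
      using lmeasurable_outer_open by blast
    have EU: "E \<subseteq> U" using U W unfolding \<W>_def by auto
    have mU: "measure lebesgue U \<le> m + e" using U W by auto
    define K1 where "K1 = {(s, t). s < t \<and> {s..t} \<subseteq> U \<and> f t - f s < \<alpha> * (t - s)}"
    have f1: "\<exists>s t. (s, t) \<in> K1 \<and> s \<le> x \<and> x \<le> t \<and> t - s < d" if xE: "x \<in> E" and d0: "0 < d" for x d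
    proof -
      obtain r where r: "r > 0" "ball x r \<subseteq> U"
        by (meson U(1) EU open_contains_ball subsetD xE)
      obtain s t where st: "s < t" "s \<le> x" "x \<le> t" "t - s < min d r" "f t - f s < \<alpha> * (t - s)"
        using lo[OF xE, of "min d r"] r d0 by auto
      have "{s..t} \<subseteq> ball x r" using st by (auto simp: dist_real_def)
      then show ?thesis using st r unfolding K1_def by (intro exI[of _ s] exI[of _ t]) auto
    qed
    obtain C1 where C1: "countable C1" "C1 \<subseteq> K1" "pairwise (\<lambda>i j. disjnt {fst i..snd i} {fst j..snd j}) C1"
       "negligible (E - (\<Union>i\<in>C1. {fst i..snd i}))"
      by (rule Vitali_covering_intervals[of K1 E]) (use f1 in \<open>auto simp: K1_def\<close>)
    \<comment> \<open>Passing to interiors loses only countably many end points and leaves room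
      around each point for the second, nested covering.\<close>
    define E' where "E' = E \<inter> (\<Union>i\<in>C1. {fst i<..<snd i})"
    have nE': "negligible (E - E')"
    proof (rule negligible_subset)
      show "negligible ((E - (\<Union>i\<in>C1. {fst i..snd i})) \<union> (fst ` C1 \<union> snd ` C1))"
        using C1 countable_imp_null_set_lborel[of "fst ` C1"] countable_imp_null_set_lborel[of "snd ` C1"]
        by (intro negligible_Un) (auto simp: negligible_iff_null_sets null_sets_completionI)
      show "E - E' \<subseteq> (E - (\<Union>i\<in>C1. {fst i..snd i})) \<union> (fst ` C1 \<union> snd ` C1)"
        unfolding E'_def by (force simp: image_iff)
    qed
    define K2 where "K2 = {(s, t). s < t \<and> (\<exists>i\<in>C1. {s..t} \<subseteq> {fst i<..<snd i}) \<and> \<beta> * (t - s) < f t - f s}"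
    have f2: "\<exists>s t. (s, t) \<in> K2 \<and> s \<le> x \<and> x \<le> t \<and> t - s < d" if xE: "x \<in> E'" and d0: "0 < d" for x d
    proof -
      obtain i where i: "i \<in> C1" "x \<in> {fst i<..<snd i}" using xE unfolding E'_def by auto
      obtain r where r: "r > 0" "ball x r \<subseteq> {fst i<..<snd i}"
        by (meson i(2) open_contains_ball open_greaterThanLessThan)
      obtain s t where st: "s < t" "s \<le> x" "x \<le> t" "t - s < min d r" "\<beta> * (t - s) < f t - f s"
        using hi[of x "min d r"] r d0 xE unfolding E'_def by auto
      have "{s..t} \<subseteq> ball x r" using st by (auto simp: dist_real_def)
      then have "{s..t} \<subseteq> {fst i<..<snd i}" using r by auto
      then have "(s, t) \<in> K2" unfolding K2_def using st i(1) by auto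
      then show ?thesis using st by auto
    qed
    obtain C2 where C2: "countable C2" "C2 \<subseteq> K2" "pairwise (\<lambda>i j. disjnt {fst i..snd i} {fst j..snd j}) C2"
       "negligible (E' - (\<Union>i\<in>C2. {fst i..snd i}))"
      by (rule Vitali_covering_intervals[of K2 E']) (use f2 in \<open>auto simp: K2_def\<close>)
    have bound: "(\<Sum>j\<in>F. snd j - fst j) \<le> \<alpha> / \<beta> * (m + e)" if F: "finite F" "F \<subseteq> C2" for F
    proof -
      have "\<forall>j\<in>F. \<exists>i\<in>C1. {fst j..snd j} \<subseteq> {fst i<..<snd i}"
        using F C2(2) unfolding K2_def by force
      then obtain g where g: "\<And>j. j \<in> F \<Longrightarrow> g j \<in> C1" "\<And>j. j \<in> F \<Longrightarrow> {fst j..snd j} \<subseteq> {fst (g j)<..<snd (g j)}"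
        by metis
      have c2: "fst j < snd j" "\<beta> * (snd j - fst j) < f (snd j) - f (fst j)" if "j \<in> F" for j
        using that F C2(2) unfolding K2_def by (auto 0 3)
      have c1: "fst i < snd i" "f (snd i) - f (fst i) < \<alpha> * (snd i - fst i)" "{fst i..snd i} \<subseteq> U" if "i \<in> C1" for i
        using that C1(2) unfolding K1_def by (auto 0 3)
      have "\<beta> * (\<Sum>j\<in>F. snd j - fst j) \<le> (\<Sum>j\<in>F. f (snd j) - f (fst j))"
        unfolding sum_distrib_left by (rule sum_mono) (use c2 less_imp_le in blast)
      also have "\<dots> = (\<Sum>i\<in>g ` F. \<Sum>j\<in>{j\<in>F. g j = i}. f (snd j) - f (fst j))"
        using sum.image_gen[OF F(1)] by blast
      also have "\<dots> \<le> (\<Sum>i\<in>g ` F. f (snd i) - f (fst i))"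
      proof (rule sum_mono)
        fix i assume i: "i \<in> g ` F"
        then have i1: "i \<in> C1" using g by auto
        show "(\<Sum>j\<in>{j\<in>F. g j = i}. f (snd j) - f (fst j)) \<le> f (snd i) - f (fst i)"
        proof (rule mono_sum_disjoint_intervals[OF _ f])
          show "finite {j \<in> F. g j = i}" using F by auto
          show "fst i \<le> snd i" using c1(1)[OF i1] by auto
          show "pairwise (\<lambda>i j. disjnt {fst i..snd i} {fst j..snd j}) {j \<in> F. g j = i}"
            using C2(3) F(2) by (auto intro: pairwise_subset)
          fix p q assume pq: "(p, q) \<in> {j \<in> F. g j = i}"
          then have pq: "p < q" "{p..q} \<subseteq> {fst i<..<snd i}"
            using c2(1)[of "(p, q)"] g(2)[of "(p, q)"] by auto
          then have "p \<in> {fst i<..<snd i}" "q \<in> {fst i<..<snd i}"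
            by (meson atLeastAtMost_iff less_imp_le order_refl subsetD)+
          then show "fst i \<le> p \<and> p < q \<and> q \<le> snd i" using pq by auto
        qed
      qed
      also have "\<dots> \<le> \<alpha> * (\<Sum>i\<in>g ` F. snd i - fst i)"
        unfolding sum_distrib_left by (rule sum_mono) (use c1(2) g(1) less_imp_le in blast)
      also have "(\<Sum>i\<in>g ` F. snd i - fst i) = measure lebesgue (\<Union>i\<in>g ` F. {fst i..snd i})"
      proof (rule measure_disjoint_intervals[symmetric])
        show "pairwise (\<lambda>i j. disjnt {fst i..snd i} {fst j..snd j}) (g ` F)"
          using C1(3) g(1) by (auto intro: pairwise_subset)
        fix p q assume "(p, q) \<in> g ` F"
        then have "(p, q) \<in> C1" using g(1) by auto
        then show "p < q" using c1(1)[of "(p, q)"] by simp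
      qed (use F in auto)
      also have "\<dots> \<le> measure lebesgue U"
      proof (rule measure_mono_fmeasurable[OF _ _ U(3)])
        show "(\<Union>i\<in>g ` F. {fst i..snd i}) \<subseteq> U"
        proof (rule UN_least)
          fix i assume "i \<in> g ` F"
          then have "i \<in> C1" using g(1) by auto
          then show "{fst i..snd i} \<subseteq> U" by (rule c1(3))
        qed
        show "(\<Union>i\<in>g ` F. {fst i..snd i}) \<in> sets lebesgue"
          using F by (intro sets.finite_UN) auto
      qed
      finally show ?thesis using mU ab mult_left_mono[OF mU, of \<alpha>] by (simp add: field_simps)
    qed
    have C2lt: "\<And>p q. (p, q) \<in> C2 \<Longrightarrow> p < q" using C2(2) unfolding K2_def by auto
    show ?thesis
    proof (rule m_le'[OF measure_Union_intervals_le[OF C2(1,3) C2lt bound]])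
      show "negligible (E - (\<Union>i\<in>C2. {fst i..snd i}))"
        by (rule negligible_subset[OF negligible_Un[OF nE' C2(4)]]) auto
    qed
  qed
  have "m \<le> \<alpha> / \<beta> * m"
  proof (rule field_le_epsilon)
    fix e :: real assume "0 < e"
    have "\<alpha> / \<beta> * (m + e * \<beta> / \<alpha>) = \<alpha> / \<beta> * m + e"
      using ab by (simp add: field_simps)
    moreover have "0 < e * \<beta> / \<alpha>" using ab \<open>0 < e\<close> by simp
    ultimately show "m \<le> \<alpha> / \<beta> * m + e" using main by metis
  qed
  then have "m * (1 - \<alpha> / \<beta>) \<le> 0" by (simp add: algebra_simps)
  moreover have "1 - \<alpha> / \<beta> > 0" using ab by auto
  ultimately have "m \<le> 0" by (simp add: mult_le_0_iff)
  show ?thesis unfolding negligible_outer_le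
  proof (intro allI impI)
    fix e :: real assume "0 < e"
    then have "\<exists>x\<in>measure lebesgue ` \<W>. x < e"
      using cInf_lessD[of "measure lebesgue ` \<W>" e] Wne \<open>m \<le> 0\<close> unfolding m_def by auto
    then show "\<exists>T. E \<subseteq> T \<and> T \<in> lmeasurable \<and> measure lebesgue T \<le> e"
      unfolding \<W>_def by (auto intro: less_imp_le)
  qed
qed

text \<open>Disjoint intervals of slope above \<beta> have total length at most
  \<open>(f d - f c) / \<beta>\<close>, which is small once \<beta> is large.\<close>

lemma mono_infinite_slope_negligible:
  fixes f :: "real \<Rightarrow> real"
  assumes f: "mono f" and E: "E \<subseteq> {c<..<d}"
    and hi: "\<And>\<beta> x e. x \<in> E \<Longrightarrow> 0 < e \<Longrightarrow> \<exists>s t. s < t \<and> s \<le> x \<and> x \<le> t \<and> t - s < e \<and> \<beta> * (t - s) < f t - f s"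
  shows "negligible E"
  unfolding negligible_outer_le
proof (intro allI impI)
  fix e :: real assume e: "0 < e"
  \<comment> \<open>This value makes the bound on the total length equal to at most
    \<open>e\<close>; the summand 1 keeps \<beta> positive when \<open>f\<close> is
    constant.\<close>
  define \<beta> where "\<beta> = (\<bar>f d - f c\<bar> + 1) / e"
  have b: "\<beta> > 0" unfolding \<beta>_def using e by (auto intro: divide_pos_pos)
  define K where "K = {(s, t). s < t \<and> {s..t} \<subseteq> {c<..<d} \<and> \<beta> * (t - s) < f t - f s}"
  have f1: "\<exists>s t. (s, t) \<in> K \<and> s \<le> x \<and> x \<le> t \<and> t - s < \<delta>" if xE: "x \<in> E" and d0: "0 < \<delta>" for x \<delta>
  proof -
    obtain r where r: "r > 0" "ball x r \<subseteq> {c<..<d}"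
      by (meson E open_contains_ball open_greaterThanLessThan subsetD xE)
    obtain s t where st: "s < t" "s \<le> x" "x \<le> t" "t - s < min \<delta> r" "\<beta> * (t - s) < f t - f s"
      using hi[OF xE, of "min \<delta> r" \<beta>] r d0 by auto
    have "{s..t} \<subseteq> ball x r" using st by (auto simp: dist_real_def)
    then show ?thesis using st r unfolding K_def by (intro exI[of _ s] exI[of _ t]) auto
  qed
  obtain C where C: "countable C" "C \<subseteq> K" "pairwise (\<lambda>i j. disjnt {fst i..snd i} {fst j..snd j}) C"
     "negligible (E - (\<Union>i\<in>C. {fst i..snd i}))"
    by (rule Vitali_covering_intervals[of K E]) (use f1 in \<open>auto simp: K_def\<close>)
  have lt: "\<And>p q. (p, q) \<in> C \<Longrightarrow> p < q" using C(2) unfolding K_def by auto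
  have bound: "(\<Sum>j\<in>F. snd j - fst j) \<le> e" if F: "finite F" "F \<subseteq> C" for F
  proof (cases "F = {}")
    case False
    have k: "fst j < snd j" "{fst j..snd j} \<subseteq> {c<..<d}" "\<beta> * (snd j - fst j) < f (snd j) - f (fst j)" if "j \<in> F" for j
      using that F(2) C(2) unfolding K_def by (auto 0 3)
    have cd: "c \<le> d" using False k(1,2) by fastforce
    have "\<beta> * (\<Sum>j\<in>F. snd j - fst j) \<le> (\<Sum>j\<in>F. f (snd j) - f (fst j))"
      unfolding sum_distrib_left by (rule sum_mono) (use k less_imp_le in blast)
    also have "\<dots> \<le> f d - f c"
    proof (rule mono_sum_disjoint_intervals[OF F(1) f cd _ pairwise_subset[OF C(3) F(2)]])
      fix p q assume "(p, q) \<in> F"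
      then have pq: "p < q" "{p..q} \<subseteq> {c<..<d}" using k[of "(p, q)"] by auto
      then have "p \<in> {c<..<d}" "q \<in> {c<..<d}"
        by (meson atLeastAtMost_iff less_imp_le order_refl subsetD)+
      then show "c \<le> p \<and> p < q \<and> q \<le> d" using pq by auto
    qed
    also have "\<dots> \<le> \<beta> * e" unfolding \<beta>_def using e by simp
    finally show ?thesis using b by simp
  qed (use e in simp)
  note M = measure_Union_intervals_le[OF C(1,3) lt bound]
  let ?W = "\<Union>i\<in>C. {fst i..snd i}"
  have "measure lebesgue (?W \<union> (E - ?W)) \<le> measure lebesgue ?W + measure lebesgue (E - ?W)"
    using M C(4) by (intro measure_Un_le) (auto simp: negligible_imp_measurable fmeasurableD)
  then have "measure lebesgue (?W \<union> (E - ?W)) \<le> e"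
    using M negligible_imp_measure0[OF C(4)] by linarith
  moreover have "?W \<union> (E - ?W) \<in> lmeasurable"
    using fmeasurable.Un[OF M(1) negligible_imp_measurable[OF C(4)]] .
  ultimately show "\<exists>T. E \<subseteq> T \<and> T \<in> lmeasurable \<and> measure lebesgue T \<le> e"
    by (intro exI[of _ "?W \<union> (E - ?W)"]) auto
qed

text \<open>Where differentiability fails, the difference quotients are either unbounded
  (\<open>I\<close>) or have a lower limit below a rational \<alpha> and an upper limit above a
  rational \<beta> (\<open>G\<close>). Monotonicity makes the quotients nonnegative, so \<alpha> can
  be taken positive and the two covering lemmas apply.\<close>

lemma mono_differentiable_AE:
  fixes f :: "real \<Rightarrow> real"
  assumes f: "mono f"
  shows "negligible {x\<in>{c<..<d}. \<not> f differentiable (at x)}"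
proof -
  define q where "q x y = (f y - f x) / (y - x)" for x y
  have q0: "0 \<le> q x y" for x y
    using monoD[OF f, of x y] monoD[OF f, of y x] unfolding q_def
    by (cases "x \<le> y") (auto simp: zero_le_divide_iff)
  define I where "I = {x\<in>{c<..<d}. \<forall>\<beta>. \<exists>\<^sub>F y in at x. \<beta> < q x y}"
  define G where "G \<alpha> \<beta> = {x\<in>{c<..<d}. (\<exists>\<^sub>F y in at x. q x y < \<alpha>) \<and> (\<exists>\<^sub>F y in at x. \<beta> < q x y)}" for \<alpha> \<beta>
  \<comment> \<open>A quotient based at \<open>x\<close> is the slope over an interval with
    \<open>x\<close> as one end point, whichever side \<open>y\<close> lies on. This is the form in
    which the Vitali coverings need it.\<close>
  have freq: "\<exists>s t. s < t \<and> s \<le> x \<and> x \<le> t \<and> t - s < e \<and> R ((f t - f s) / (t - s))"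
    if fr: "\<exists>\<^sub>F y in at x. R (q x y)" and e: "0 < e" for R x e
  proof -
    have "\<forall>\<^sub>F y in at x. y \<noteq> x \<and> dist y x < e"
      using e by (auto simp: eventually_at)
    then have "\<exists>\<^sub>F y in at x. R (q x y) \<and> y \<noteq> x \<and> dist y x < e"
      using fr by (rule frequently_eventually_frequently[rotated])
    then obtain y where y: "R (q x y)" "y \<noteq> x" "dist y x < e" by (auto dest: frequently_ex)
    show ?thesis
    proof (cases "x < y")
      case True
      then show ?thesis using y unfolding q_def by (intro exI[of _ x] exI[of _ y]) (auto simp: dist_real_def)
    next
      case False
      have "q x y = (f x - f y) / (x - y)" unfolding q_def
        by (metis minus_diff_eq minus_divide_divide)
      then show ?thesis using y False by (intro exI[of _ y] exI[of _ x]) (auto simp: dist_real_def)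
    qed
  qed
  have nI: "negligible I"
  proof (rule mono_infinite_slope_negligible[OF f, of _ c d])
    show "I \<subseteq> {c<..<d}" unfolding I_def by auto
    fix \<beta> x e :: real assume "x \<in> I" "0 < e"
    then have "\<exists>\<^sub>F y in at x. \<beta> < q x y" unfolding I_def by auto
    from freq[OF this \<open>0 < e\<close>] obtain s t where "s < t \<and> s \<le> x \<and> x \<le> t \<and> t - s < e \<and> \<beta> < (f t - f s) / (t - s)"
      by blast
    then show "\<exists>s t. s < t \<and> s \<le> x \<and> x \<le> t \<and> t - s < e \<and> \<beta> * (t - s) < f t - f s"
      by (intro exI[of _ s] exI[of _ t]) (auto simp: field_simps)
  qed
  have nG: "negligible (G \<alpha> \<beta>)" if "0 < \<alpha>" "\<alpha> < \<beta>" for \<alpha> \<beta>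
  proof (rule mono_slope_gap_negligible[OF f _ that, of _ c d])
    show "G \<alpha> \<beta> \<subseteq> {c<..<d}" unfolding G_def by auto
    fix x e :: real assume x: "x \<in> G \<alpha> \<beta>" and e: "0 < e"
    obtain s t where "s < t \<and> s \<le> x \<and> x \<le> t \<and> t - s < e \<and> (f t - f s) / (t - s) < \<alpha>"
      using freq[where x=x and R="\<lambda>y. y < \<alpha>", OF _ e] x unfolding G_def by auto
    then show "\<exists>s t. s < t \<and> s \<le> x \<and> x \<le> t \<and> t - s < e \<and> f t - f s < \<alpha> * (t - s)"
      by (intro exI[of _ s] exI[of _ t]) (auto simp: field_simps)
    obtain s t where "s < t \<and> s \<le> x \<and> x \<le> t \<and> t - s < e \<and> \<beta> < (f t - f s) / (t - s)"
      using freq[where x=x and R="\<lambda>y. \<beta> < y", OF _ e] x unfolding G_def by auto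
    then show "\<exists>s t. s < t \<and> s \<le> x \<and> x \<le> t \<and> t - s < e \<and> \<beta> * (t - s) < f t - f s"
      by (intro exI[of _ s] exI[of _ t]) (auto simp: field_simps)
  qed
  define H where "H = {(\<alpha>, \<beta>). \<alpha> \<in> \<rat> \<and> \<beta> \<in> \<rat> \<and> 0 < \<alpha> \<and> \<alpha> < (\<beta>::real)}"
  have cH: "countable H"
    by (rule countable_subset[of _ "\<rat> \<times> \<rat>"]) (auto simp: H_def countable_rat intro!: countable_SIGMA)
  have "{x\<in>{c<..<d}. \<not> f differentiable (at x)} \<subseteq> I \<union> (\<Union>(\<alpha>, \<beta>)\<in>H. G \<alpha> \<beta>)"
  proof
    fix x assume "x \<in> {x\<in>{c<..<d}. \<not> f differentiable (at x)}"
    then have x: "x \<in> {c<..<d}" and nd: "\<not> f differentiable (at x)" by auto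
    show "x \<in> I \<union> (\<Union>(\<alpha>, \<beta>)\<in>H. G \<alpha> \<beta>)"
    proof (rule ccontr)
      assume nin: "x \<notin> I \<union> (\<Union>(\<alpha>, \<beta>)\<in>H. G \<alpha> \<beta>)"
      then obtain B where B: "\<forall>\<^sub>F y in at x. q x y \<le> B"
        using x unfolding I_def by (auto simp: not_frequently not_less)
      define l where "l = Liminf (at x) (\<lambda>y. ereal (q x y))"
      define L where "L = Limsup (at x) (\<lambda>y. ereal (q x y))"
      have "l \<le> L" unfolding l_def L_def by (rule Liminf_le_Limsup) auto
      have "0 \<le> l" unfolding l_def by (rule Liminf_bounded) (use q0 in auto)
      have "L \<le> ereal B" unfolding L_def by (rule Limsup_bounded) (use B in auto)
      have "l = L"
      proof (rule ccontr)
        assume "l \<noteq> L"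
        then have "l < L" using \<open>l \<le> L\<close> by auto
        obtain r where r: "l < ereal r" "ereal r < L" using ereal_dense2[OF \<open>l < L\<close>] by blast
        obtain r' where r': "l < ereal r'" "ereal r' < ereal r" using ereal_dense2[OF r(1)] by blast
        obtain r'' where r'': "ereal r < ereal r''" "ereal r'' < L" using ereal_dense2[OF r(2)] by blast
        obtain \<alpha> where a: "\<alpha> \<in> \<rat>" "r' < \<alpha>" "\<alpha> < r"
          using Rats_dense_in_real[of r' r] r' by auto
        obtain \<beta> where b: "\<beta> \<in> \<rat>" "r < \<beta>" "\<beta> < r''"
          using Rats_dense_in_real[of r r''] r'' by auto
        have "0 < \<alpha>"
          using a r' \<open>0 \<le> l\<close> by (metis ereal_less_eq(3) less_ereal.simps(1) order_le_less_trans order_less_trans zero_ereal_def)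
        have "\<not> (\<forall>\<^sub>F y in at x. \<alpha> \<le> q x y)"
        proof
          assume "\<forall>\<^sub>F y in at x. \<alpha> \<le> q x y"
          then have "ereal \<alpha> \<le> l" unfolding l_def by (intro Liminf_bounded) auto
          then show False using a(2) r' by (metis ereal_less_eq(3) leD order_trans less_imp_le)
        qed
        moreover have "\<not> (\<forall>\<^sub>F y in at x. q x y \<le> \<beta>)"
        proof
          assume "\<forall>\<^sub>F y in at x. q x y \<le> \<beta>"
          then have "L \<le> ereal \<beta>" unfolding L_def by (intro Limsup_bounded) auto
          then show False using b(3) r'' by (metis ereal_less_eq(3) leD order_trans less_imp_le)
        qed
        ultimately have "x \<in> G \<alpha> \<beta>"
          unfolding G_def using x by (auto simp: frequently_def not_less)
        moreover have "(\<alpha>, \<beta>) \<in> H"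
          unfolding H_def using a b \<open>0 < \<alpha>\<close> by auto
        ultimately show False using nin by blast
      qed
      obtain D where D: "l = ereal D"
        using \<open>0 \<le> l\<close> \<open>L \<le> ereal B\<close> \<open>l = L\<close> by (cases l) auto
      have "((\<lambda>y. ereal (q x y)) \<longlongrightarrow> ereal D) (at x)"
        by (rule Liminf_eq_Limsup) (use D \<open>l = L\<close> in \<open>auto simp: l_def L_def\<close>)
      then have "((\<lambda>y. q x y) \<longlongrightarrow> D) (at x)" by simp
      then have "(f has_real_derivative D) (at x)"
        unfolding has_field_derivative_iff q_def by simp
      then show False using nd real_differentiable_def by blast
    qed
  qed
  moreover have "negligible (\<Union>(\<alpha>, \<beta>)\<in>H. G \<alpha> \<beta>)"
    by (rule negligible_countable_Union) (use cH nG in \<open>auto simp: H_def\<close>)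
  ultimately show ?thesis using nI by (metis (no_types, lifting) negligible_Un negligible_subset)
qed

section \<open>Operations on absolutely continuous curves, and their differentiability\<close>

definition variation_family :: "real \<Rightarrow> real \<Rightarrow> (real \<times> real) set \<Rightarrow> bool" where
  "variation_family a b D \<longleftrightarrow> finite D \<and> (\<forall>(s, t)\<in>D. a \<le> s \<and> s \<le> t \<and> t \<le> b) \<and>
     pairwise (\<lambda>(s, t) (s', t'). {s<..<t} \<inter> {s'<..<t'} = {}) D"

lemma absolutely_continuous_curve_altdef:
  "absolutely_continuous_curve a b \<sigma> \<longleftrightarrow>
     (\<forall>\<epsilon>>0. \<exists>\<delta>>0. \<forall>D. variation_family a b D \<longrightarrow> (\<Sum>(s, t)\<in>D. t - s) < \<delta> \<longrightarrow>
        (\<Sum>(s, t)\<in>D. dist (\<sigma> s) (\<sigma> t)) < \<epsilon>)"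
  unfolding absolutely_continuous_curve_def variation_family_def by (simp only: imp_conjL)

lemma variation_family_sum_le_measure:
  assumes "variation_family a b D" "\<And>s t. (s, t) \<in> D \<Longrightarrow> {s<..<t} \<subseteq> U" "U \<in> lmeasurable"
  shows "(\<Sum>(s, t)\<in>D. t - s) \<le> measure lebesgue U"
proof -
  have D: "finite D" "\<And>s t. (s, t) \<in> D \<Longrightarrow> a \<le> s \<and> s \<le> t \<and> t \<le> b"
    and pw: "pairwise (\<lambda>(s, t) (s', t'). {s<..<t} \<inter> {s'<..<t'} = {}) D"
    using assms unfolding variation_family_def by auto
  have "(\<Sum>(s, t)\<in>D. t - s) = (\<Sum>i\<in>D. measure lebesgue {fst i<..<snd i})"
    by (rule sum.cong) (use D in auto)
  also have "\<dots> = measure lebesgue (\<Union>i\<in>D. {fst i<..<snd i})"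
  proof (rule measure_finite_Union[symmetric, OF D(1)])
    show "disjoint_family_on (\<lambda>i. {fst i<..<snd i}) D"
      using pw by (force simp: disjoint_family_on_def pairwise_def)
    show "emeasure lebesgue {fst i<..<snd i} \<noteq> \<infinity>" for i :: "real \<times> real"
      by (cases "fst i \<le> snd i") auto
  qed auto
  also have "\<dots> \<le> measure lebesgue U"
  proof (rule measure_mono_fmeasurable[OF _ _ assms(3)])
    show "(\<Union>i\<in>D. {fst i<..<snd i}) \<subseteq> U" using assms(2) by fastforce
    show "(\<Union>i\<in>D. {fst i<..<snd i}) \<in> sets lebesgue" by (rule sets.finite_UN[OF D(1)]) auto
  qed
  finally show ?thesis .
qed

lemma variation_family_sum_le:
  assumes "variation_family a b D" "a \<le> b"
  shows "(\<Sum>(s, t)\<in>D. t - s) \<le> b - a"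
  using variation_family_sum_le_measure[OF assms(1), of "{a..b}"] assms
  by (fastforce simp: variation_family_def)

lemma absolutely_continuous_curve_subinterval:
  assumes "absolutely_continuous_curve a b \<sigma>" "a \<le> c" "d \<le> b"
  shows "absolutely_continuous_curve c d \<sigma>"
proof -
  have "variation_family a b D" if "variation_family c d D" for D
    using that assms(2,3) unfolding variation_family_def by fastforce
  then show ?thesis using assms(1) unfolding absolutely_continuous_curve_altdef by meson
qed

lemma absolutely_continuous_curve_compose_lipschitz:
  assumes "absolutely_continuous_curve a b \<sigma>"
    and "\<And>s t. s \<in> {a..b} \<Longrightarrow> t \<in> {a..b} \<Longrightarrow> dist (\<tau> s) (\<tau> t) \<le> L * dist (\<sigma> s) (\<sigma> t)"
  shows "absolutely_continuous_curve a b \<tau>"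
  unfolding absolutely_continuous_curve_altdef
proof (intro allI impI)
  fix \<epsilon> :: real assume e: "\<epsilon> > 0"
  define M where "M = \<bar>L\<bar> + 1"
  have M: "M > 0" "L \<le> M" unfolding M_def by auto
  obtain \<delta> where d: "\<delta> > 0" "\<And>D. variation_family a b D \<Longrightarrow> (\<Sum>(s, t)\<in>D. t - s) < \<delta> \<Longrightarrow>
        (\<Sum>(s, t)\<in>D. dist (\<sigma> s) (\<sigma> t)) < \<epsilon> / M"
    using assms(1) divide_pos_pos[OF e M(1)] unfolding absolutely_continuous_curve_altdef by blast
  have "(\<Sum>(s, t)\<in>D. dist (\<tau> s) (\<tau> t)) < \<epsilon>" if D: "variation_family a b D" "(\<Sum>(s, t)\<in>D. t - s) < \<delta>" for D
  proof -
    have "(\<Sum>(s, t)\<in>D. dist (\<tau> s) (\<tau> t)) \<le> (\<Sum>i\<in>D. M * (case i of (s, t) \<Rightarrow> dist (\<sigma> s) (\<sigma> t)))"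
    proof (rule sum_mono, clarify)
      fix s t assume "(s, t) \<in> D"
      then have "s \<in> {a..b}" "t \<in> {a..b}" using D(1) unfolding variation_family_def by fastforce+
      then show "dist (\<tau> s) (\<tau> t) \<le> M * dist (\<sigma> s) (\<sigma> t)"
        using assms(2) M(2) by (meson mult_right_mono order_trans zero_le_dist)
    qed
    also have "\<dots> < M * (\<epsilon> / M)"
      unfolding sum_distrib_left[symmetric] using d(2)[OF D] M by (intro mult_strict_left_mono)
    finally show ?thesis using M by simp
  qed
  then show "\<exists>\<delta>>0. \<forall>D. variation_family a b D \<longrightarrow> (\<Sum>(s, t)\<in>D. t - s) < \<delta> \<longrightarrow> (\<Sum>(s, t)\<in>D. dist (\<tau> s) (\<tau> t)) < \<epsilon>"
    using d(1) by blast
qed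

lemma lipschitz_imp_absolutely_continuous_curve:
  assumes "\<And>s t. s \<in> {a..b} \<Longrightarrow> t \<in> {a..b} \<Longrightarrow> dist (\<tau> s) (\<tau> t) \<le> L * \<bar>s - t\<bar>"
  shows "absolutely_continuous_curve a b \<tau>"
proof (rule absolutely_continuous_curve_compose_lipschitz)
  show "absolutely_continuous_curve a b (\<lambda>t::real. t)"
    unfolding absolutely_continuous_curve_altdef
  proof (intro allI impI)
    fix \<epsilon> :: real assume e: "\<epsilon> > 0"
    have "(\<Sum>(s, t)\<in>D. dist s t) = (\<Sum>(s, t)\<in>D. t - s)" if "variation_family a b D" for D
      by (rule sum.cong) (use that in \<open>auto simp: variation_family_def dist_real_def\<close>)
    then show "\<exists>\<delta>>0. \<forall>D. variation_family a b D \<longrightarrow> (\<Sum>(s, t)\<in>D. t - s) < \<delta> \<longrightarrow> (\<Sum>(s, t)\<in>D. dist s t) < \<epsilon>"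
      using e by auto
  qed
qed (use assms in \<open>auto simp: dist_real_def\<close>)

lemma absolutely_continuous_curve_continuous:
  assumes "absolutely_continuous_curve a b \<sigma>"
  shows "continuous_on {a..b} \<sigma>"
  unfolding continuous_on_iff
proof (intro ballI allI impI)
  fix x \<epsilon> :: real assume x: "x \<in> {a..b}" and e: "\<epsilon> > 0"
  obtain \<delta> where d: "\<delta> > 0" "\<And>D. variation_family a b D \<Longrightarrow> (\<Sum>(s, t)\<in>D. t - s) < \<delta> \<Longrightarrow>
        (\<Sum>(s, t)\<in>D. dist (\<sigma> s) (\<sigma> t)) < \<epsilon>"
    using assms e unfolding absolutely_continuous_curve_altdef by meson
  have "dist (\<sigma> s) (\<sigma> t) < \<epsilon>" if "s \<in> {a..b}" "t \<in> {a..b}" "s \<le> t" "t - s < \<delta>" for s t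
    using d(2)[of "{(s, t)}"] that by (auto simp: variation_family_def)
  note * = this
  have "dist (\<sigma> y) (\<sigma> x) < \<epsilon>" if y: "y \<in> {a..b}" "dist y x < \<delta>" for y
  proof (cases "y \<le> x")
    case True
    then show ?thesis using *[of y x] x y by (auto simp: dist_real_def)
  next
    case False
    then have "dist (\<sigma> x) (\<sigma> y) < \<epsilon>" using *[of x y] x y by (auto simp: dist_real_def)
    then show ?thesis by (simp only: dist_commute)
  qed
  then show "\<exists>d>0. \<forall>x'\<in>{a..b}. dist x' x < d \<longrightarrow> dist (\<sigma> x') (\<sigma> x) < \<epsilon>"
    using d(1) by blast
qed

text \<open>A family over \<open>{a..c}\<close> splits into the pairs left of \<open>b\<close>,
  those right of \<open>b\<close>, and those straddling \<open>b\<close>. Two straddling pairs would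
  both contain \<open>b\<close> in their interiors, so there is at most one, and it is cut at
  \<open>b\<close>. This makes four contributions of \<epsilon>/4.\<close>

lemma absolutely_continuous_curve_concat:
  assumes 1: "absolutely_continuous_curve a b \<sigma>" and 2: "absolutely_continuous_curve b c \<sigma>"
  shows "absolutely_continuous_curve a c \<sigma>"
  unfolding absolutely_continuous_curve_altdef
proof (intro allI impI)
  fix \<epsilon> :: real assume "\<epsilon> > 0"
  then have e4: "\<epsilon> / 4 > 0" by simp
  obtain \<delta>1 where d1: "\<delta>1 > 0" "\<And>D. variation_family a b D \<Longrightarrow> (\<Sum>(s, t)\<in>D. t - s) < \<delta>1 \<Longrightarrow>
        (\<Sum>(s, t)\<in>D. dist (\<sigma> s) (\<sigma> t)) < \<epsilon> / 4"
    using 1 e4 unfolding absolutely_continuous_curve_altdef by blast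
  obtain \<delta>2 where d2: "\<delta>2 > 0" "\<And>D. variation_family b c D \<Longrightarrow> (\<Sum>(s, t)\<in>D. t - s) < \<delta>2 \<Longrightarrow>
        (\<Sum>(s, t)\<in>D. dist (\<sigma> s) (\<sigma> t)) < \<epsilon> / 4"
    using 2 e4 unfolding absolutely_continuous_curve_altdef by blast
  have "(\<Sum>(s, t)\<in>D. dist (\<sigma> s) (\<sigma> t)) < \<epsilon>"
    if D: "variation_family a c D" and small: "(\<Sum>(s, t)\<in>D. t - s) < min \<delta>1 \<delta>2" for D
  proof -
    have fD: "finite D" and Db: "\<And>i. i \<in> D \<Longrightarrow> a \<le> fst i \<and> fst i \<le> snd i \<and> snd i \<le> c"
      and pw: "pairwise (\<lambda>(s, t) (s', t'). {s<..<t} \<inter> {s'<..<t'} = {}) D"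
      using D unfolding variation_family_def by auto
    have dsj: "{fst i<..<snd i} \<inter> {fst j<..<snd j} = {}" if "i \<in> D" "j \<in> D" "i \<noteq> j" for i j
      using pw that unfolding pairwise_def split_def by blast
    define D1 where "D1 = {i\<in>D. snd i \<le> b}"
    define D2 where "D2 = {i\<in>D. b < snd i \<and> b \<le> fst i}"
    define D3 where "D3 = {i\<in>D. b < snd i \<and> fst i < b}"
    have sub: "D1 \<subseteq> D" "D2 \<subseteq> D" "D3 \<subseteq> D" unfolding D1_def D2_def D3_def by auto
    have fin: "finite D1" "finite D2" "finite D3" using sub fD by (auto intro: finite_subset)
    have D_eq: "D = D1 \<union> (D2 \<union> D3)" unfolding D1_def D2_def D3_def by auto
    have split: "(\<Sum>i\<in>D. f i) = (\<Sum>i\<in>D1. f i) + ((\<Sum>i\<in>D2. f i) + (\<Sum>i\<in>D3. f i))" for f :: "real \<times> real \<Rightarrow> real"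
    proof -
      have "(\<Sum>i\<in>D1 \<union> (D2 \<union> D3). f i) = (\<Sum>i\<in>D1. f i) + (\<Sum>i\<in>D2 \<union> D3. f i)"
        using fin by (intro sum.union_disjoint) (auto simp: D1_def D2_def D3_def)
      moreover have "(\<Sum>i\<in>D2 \<union> D3. f i) = (\<Sum>i\<in>D2. f i) + (\<Sum>i\<in>D3. f i)"
        using fin by (intro sum.union_disjoint) (auto simp: D1_def D2_def D3_def)
      ultimately show ?thesis using D_eq by simp
    qed
    have subsum: "(\<Sum>(s, t)\<in>D'. t - s) < min \<delta>1 \<delta>2" if "D' \<subseteq> D" for D'
    proof -
      have "(\<Sum>(s, t)\<in>D'. t - s) \<le> (\<Sum>(s, t)\<in>D. t - s)"
        by (rule sum_mono2[OF fD that]) (use Db in \<open>auto simp: split_def\<close>)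
      then show ?thesis using small by linarith
    qed
    have "variation_family a b D1"
      unfolding variation_family_def
        using fin(1) Db sub(1) pairwise_subset[OF pw sub(1)] by (auto simp: D1_def)
    then have s1: "(\<Sum>(s, t)\<in>D1. dist (\<sigma> s) (\<sigma> t)) < \<epsilon> / 4"
      using d1(2) subsum[OF sub(1)] by simp
    have "variation_family b c D2"
      unfolding variation_family_def
        using fin(2) Db sub(2) pairwise_subset[OF pw sub(2)] by (auto simp: D2_def)
    then have s2: "(\<Sum>(s, t)\<in>D2. dist (\<sigma> s) (\<sigma> t)) < \<epsilon> / 4"
      using d2(2) subsum[OF sub(2)] by simp
    have s3: "(\<Sum>(s, t)\<in>D3. dist (\<sigma> s) (\<sigma> t)) < \<epsilon> / 2"
    proof (cases "D3 = {}")
      case False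
      then obtain i where i: "i \<in> D3" by blast
      have "j = i" if "j \<in> D3" for j
      proof (rule ccontr)
        assume "j \<noteq> i"
        then have "{fst i<..<snd i} \<inter> {fst j<..<snd j} = {}" using dsj[of i j] i that sub by auto
        moreover have "b \<in> {fst i<..<snd i} \<inter> {fst j<..<snd j}"
          using i that unfolding D3_def by auto
        ultimately show False by blast
      qed
      then have D3: "D3 = {i}" using i by blast
      obtain s t where st: "i = (s, t)" by (cases i)
      have b: "a \<le> s" "s < b" "b < t" "t \<le> c" using i Db[of i] sub(3) unfolding D3_def st by auto
      have len: "t - s < min \<delta>1 \<delta>2" using subsum[OF sub(3)] unfolding D3 st by simp
      have "dist (\<sigma> s) (\<sigma> b) < \<epsilon> / 4"
        using d1(2)[of "{(s, b)}"] b len by (auto simp: variation_family_def)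
      moreover have "dist (\<sigma> b) (\<sigma> t) < \<epsilon> / 4"
        using d2(2)[of "{(b, t)}"] b len by (auto simp: variation_family_def)
      ultimately show ?thesis
        unfolding D3 st using dist_triangle[of "\<sigma> s" "\<sigma> t" "\<sigma> b"] by simp
    qed (use \<open>\<epsilon> > 0\<close> in simp)
    show ?thesis unfolding split using s1 s2 s3 by linarith
  qed
  then show "\<exists>\<delta>>0. \<forall>D. variation_family a c D \<longrightarrow> (\<Sum>(s, t)\<in>D. t - s) < \<delta> \<longrightarrow> (\<Sum>(s, t)\<in>D. dist (\<sigma> s) (\<sigma> t)) < \<epsilon>"
    using d1(1) d2(1) by (intro exI[of _ "min \<delta>1 \<delta>2"]) auto
qed

lemma absolutely_continuous_curve_reverse:
  assumes "absolutely_continuous_curve a b \<sigma>"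
  shows "absolutely_continuous_curve (r - b) (r - a) (\<lambda>t. \<sigma> (r - t))"
  unfolding absolutely_continuous_curve_altdef
proof (intro allI impI)
  fix \<epsilon> :: real assume "\<epsilon> > 0"
  then obtain \<delta> where d: "\<delta> > 0" "\<And>D. variation_family a b D \<Longrightarrow> (\<Sum>(s, t)\<in>D. t - s) < \<delta> \<Longrightarrow>
        (\<Sum>(s, t)\<in>D. dist (\<sigma> s) (\<sigma> t)) < \<epsilon>"
    using assms unfolding absolutely_continuous_curve_altdef by blast
  have "(\<Sum>(s, t)\<in>D. dist (\<sigma> (r - s)) (\<sigma> (r - t))) < \<epsilon>"
    if D: "variation_family (r - b) (r - a) D" "(\<Sum>(s, t)\<in>D. t - s) < \<delta>" for D
  proof -
    define \<phi> where "\<phi> = (\<lambda>i::real \<times> real. (r - snd i, r - fst i))"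
    have inj: "inj_on \<phi> D" unfolding \<phi>_def by (auto simp: inj_on_def)
    have "variation_family a b (\<phi> ` D)"
      unfolding variation_family_def
    proof (intro conjI)
      show "finite (\<phi> ` D)" "\<forall>(s, t)\<in>\<phi> ` D. a \<le> s \<and> s \<le> t \<and> t \<le> b"
        using D(1) unfolding variation_family_def \<phi>_def by (auto simp: split_def)
      show "pairwise (\<lambda>(s, t) (s', t'). {s<..<t} \<inter> {s'<..<t'} = {}) (\<phi> ` D)"
        unfolding pairwise_def split_def
      proof (intro ballI impI)
        fix p q assume "p \<in> \<phi> ` D" "q \<in> \<phi> ` D" "p \<noteq> q"
        then obtain i j where ij: "i \<in> D" "j \<in> D" "i \<noteq> j" "p = \<phi> i" "q = \<phi> j"
          by blast
        have e: "{fst i<..<snd i} \<inter> {fst j<..<snd j} = {}"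
          using D(1) ij unfolding variation_family_def pairwise_def split_def by blast
        have "x \<notin> {r - snd i<..<r - fst i} \<inter> {r - snd j<..<r - fst j}" for x
        proof
          assume "x \<in> {r - snd i<..<r - fst i} \<inter> {r - snd j<..<r - fst j}"
          then have "r - x \<in> {fst i<..<snd i} \<inter> {fst j<..<snd j}" by auto
          then show False using e by blast
        qed
        then have "{r - snd i<..<r - fst i} \<inter> {r - snd j<..<r - fst j} = {}" by blast
        then show "{fst p<..<snd p} \<inter> {fst q<..<snd q} = {}" unfolding ij(4,5) \<phi>_def by simp
      qed
    qed
    moreover have "(\<Sum>(s, t)\<in>\<phi> ` D. t - s) = (\<Sum>(s, t)\<in>D. t - s)"
      unfolding sum.reindex[OF inj] by (simp add: \<phi>_def split_def)
    moreover have "(\<Sum>(s, t)\<in>\<phi> ` D. dist (\<sigma> s) (\<sigma> t)) = (\<Sum>(s, t)\<in>D. dist (\<sigma> (r - s)) (\<sigma> (r - t)))"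
      unfolding sum.reindex[OF inj] by (simp add: \<phi>_def split_def dist_commute)
    ultimately show ?thesis using d(2)[of "\<phi> ` D"] D(2) by simp
  qed
  then show "\<exists>\<delta>>0. \<forall>D. variation_family (r - b) (r - a) D \<longrightarrow> (\<Sum>(s, t)\<in>D. t - s) < \<delta> \<longrightarrow>
      (\<Sum>(s, t)\<in>D. dist (\<sigma> (r - s)) (\<sigma> (r - t))) < \<epsilon>"
    using d(1) by blast
qed

text \<open>Jordan decomposition: with \<open>V\<close> the variation on \<open>{c..t}\<close>, both
  \<open>V\<close> and \<open>V - u\<close> are monotone.\<close>

lemma bounded_variation_differentiable_AE:
  fixes u :: "real \<Rightarrow> real"
  assumes cd: "c < d" and bv: "\<And>D. variation_family c d D \<Longrightarrow> (\<Sum>(s, t)\<in>D. dist (u s) (u t)) \<le> B"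
  shows "negligible {x\<in>{c<..<d}. \<not> u differentiable (at x)}"
proof -
  define W where "W t = (\<lambda>D. \<Sum>(s, t)\<in>D. dist (u s) (u t)) ` {D. variation_family c t D}" for t
  define V where "V t = Sup (W t)" for t
  have mono_fam: "variation_family c t' D" if "variation_family c t D" "t \<le> t'" for t t' D
    using that unfolding variation_family_def by fastforce
  have bdd: "bdd_above (W t)" if "t \<le> d" for t
    by (rule bdd_aboveI[of _ B]) (use bv mono_fam[OF _ that] in \<open>auto simp: W_def\<close>)
  have ne: "W t \<noteq> {}" for t unfolding W_def by (auto simp: variation_family_def intro!: exI[of _ "{}"])
  have V: "V s + \<bar>u t - u s\<bar> \<le> V t" if st: "c \<le> s" "s \<le> t" "t \<le> d" for s t
  proof -
    have "x \<le> V t - \<bar>u t - u s\<bar>" if x: "x \<in> W s" for x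
    proof -
      obtain D where D: "variation_family c s D" "x = (\<Sum>(s, t)\<in>D. dist (u s) (u t))"
        using x unfolding W_def by auto
      show ?thesis
      proof (cases "s = t")
        case True
        then show ?thesis using cSup_upper[OF x bdd] st unfolding V_def by simp
      next
        case False
        then have "s < t" using st by auto
        have nin: "(s, t) \<notin> D" using D(1) \<open>s < t\<close> unfolding variation_family_def by auto
        have "variation_family c t (insert (s, t) D)"
          using D(1) \<open>s < t\<close> st
            unfolding variation_family_def by (fastforce simp: pairwise_insert)
        then have "(\<Sum>(s, t)\<in>insert (s, t) D. dist (u s) (u t)) \<in> W t" unfolding W_def by blast
        then have "(\<Sum>(s, t)\<in>insert (s, t) D. dist (u s) (u t)) \<le> V t"
          unfolding V_def by (rule cSup_upper[OF _ bdd]) (use st in auto)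
        moreover have "(\<Sum>(s, t)\<in>insert (s, t) D. dist (u s) (u t)) = dist (u s) (u t) + x"
          using D nin by (simp add: variation_family_def)
        ultimately show ?thesis by (simp add: dist_real_def abs_minus_commute)
      qed
    qed
    then have "V s \<le> V t - \<bar>u t - u s\<bar>" unfolding V_def[of s] by (intro cSup_least ne)
    then show ?thesis by simp
  qed
  \<comment> \<open>Clamping extends the two functions to monotone functions on the whole line
    without changing them on \<open>{c..d}\<close>.\<close>
  define clamp where "clamp t = max c (min d t)" for t
  have cl: "c \<le> clamp t" "clamp t \<le> d" for t using cd unfolding clamp_def by auto
  have clm: "clamp s \<le> clamp t" if "s \<le> t" for s t using that unfolding clamp_def by auto
  define v where "v t = V (clamp t)" for t
  define w where "w t = V (clamp t) - u (clamp t)" for t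
  have "mono v" "mono w"
    unfolding v_def w_def by (rule monoI, use V[OF cl(1) clm cl(2)] in fastforce)+
  then have "negligible ({x\<in>{c<..<d}. \<not> v differentiable (at x)} \<union> {x\<in>{c<..<d}. \<not> w differentiable (at x)})"
    by (intro negligible_Un mono_differentiable_AE)
  moreover have "u differentiable (at x)" if x: "x \<in> {c<..<d}" "v differentiable (at x)" "w differentiable (at x)" for x
  proof -
    have "(\<lambda>t. v t - w t) differentiable (at x)" using x by (intro differentiable_diff)
    then obtain u' where u': "((\<lambda>t. v t - w t) has_derivative u') (at x)"
      unfolding differentiable_def by blast
    have "(u has_derivative u') (at x)"
    proof (rule has_derivative_transform_within_open[OF u', of "{c<..<d}"])
      show "v t - w t = u t" if "t \<in> {c<..<d}" for t using that unfolding v_def w_def clamp_def by simp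
    qed (use x in auto)
    then show ?thesis unfolding differentiable_def by blast
  qed
  ultimately show ?thesis by (elim negligible_subset) auto
qed

text \<open>On an interval short enough for the variation to be at most one, an absolutely continuous
  function is a difference of monotone functions.\<close>

lemma absolutely_continuous_real_differentiable_AE:
  fixes u :: "real \<Rightarrow> real"
  assumes "absolutely_continuous_curve a b u"
  shows "negligible {x\<in>{a..b}. \<not> u differentiable (at x)}"
proof (cases "a < b")
  case ab: True
  obtain \<delta> where d: "\<delta> > 0" "\<And>D. variation_family a b D \<Longrightarrow> (\<Sum>(s, t)\<in>D. t - s) < \<delta> \<Longrightarrow>
        (\<Sum>(s, t)\<in>D. dist (u s) (u t)) < 1"
    using assms unfolding absolutely_continuous_curve_altdef by (meson zero_less_one)
  define N where "N c d = {x\<in>{c<..<d}. \<not> u differentiable (at x)}" for c d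
  have nN: "negligible (N c d)" if "a \<le> c" "c < d" "d \<le> b" "d - c < \<delta>" for c d
    unfolding N_def
  proof (rule bounded_variation_differentiable_AE[OF that(2), of _ 1])
    fix D assume D: "variation_family c d D"
    have "variation_family a b D" using D that unfolding variation_family_def by fastforce
    then show "(\<Sum>(s, t)\<in>D. dist (u s) (u t)) \<le> 1"
      using d(2) variation_family_sum_le[OF D] that by force
  qed
  define H where "H = {(c, d). c \<in> \<rat> \<and> d \<in> \<rat> \<and> a \<le> c \<and> c < d \<and> d \<le> b \<and> d - c < \<delta>}"
  have cH: "countable H"
    by (rule countable_subset[of _ "\<rat> \<times> \<rat>"]) (auto simp: H_def countable_rat intro!: countable_SIGMA)
  have "negligible (\<Union>(c, d)\<in>H. N c d)"
    by (rule negligible_countable_Union) (use cH nN in \<open>auto simp: H_def\<close>)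
  then have "negligible ({a, b} \<union> (\<Union>(c, d)\<in>H. N c d))" by (intro negligible_Un) auto
  then show ?thesis
  proof (rule negligible_subset, clarify)
    fix x assume x: "x \<in> {a..b}" "\<not> u differentiable (at x)" "x \<notin> (\<Union>(c, d)\<in>H. N c d)" "x \<noteq> a"
    show "x = b"
    proof (rule ccontr)
      assume "x \<noteq> b"
      then have ax: "a < x" "x < b" using x by auto
      obtain c where c: "c \<in> \<rat>" "max a (x - \<delta>/2) < c" "c < x"
        using Rats_dense_in_real[of "max a (x - \<delta>/2)" x] ax d by auto
      obtain e where e: "e \<in> \<rat>" "x < e" "e < min b (x + \<delta>/2)"
        using Rats_dense_in_real[of x "min b (x + \<delta>/2)"] ax d by auto
      have "(c, e) \<in> H" "x \<in> N c e" unfolding H_def N_def using c e x by auto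
      then show False using x by blast
    qed
  qed
next
  case False
  then have "{x\<in>{a..b}. \<not> u differentiable (at x)} \<subseteq> {a}" by auto
  then show ?thesis by (metis negligible_sing negligible_subset)
qed

section \<open>The fundamental theorem of calculus for absolutely continuous functions\<close>

lemma absolutely_continuous_differentiable_AE:
  fixes \<sigma> :: "real \<Rightarrow> 'a::euclidean_space"
  assumes "absolutely_continuous_curve a b \<sigma>"
  shows "negligible {x\<in>{a..b}. \<not> \<sigma> differentiable (at x)}"
proof -
  have "negligible (\<Union>e\<in>Basis. {x\<in>{a..b}. \<not> (\<lambda>t. \<sigma> t \<bullet> e) differentiable (at x)})"
  proof (rule negligible_Union, simp, clarify)
    fix e :: 'a assume e: "e \<in> Basis"
    have "absolutely_continuous_curve a b (\<lambda>t. \<sigma> t \<bullet> e)"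
    proof (rule absolutely_continuous_curve_compose_lipschitz[OF assms, of _ 1])
      fix s t show "dist (\<sigma> s \<bullet> e) (\<sigma> t \<bullet> e) \<le> 1 * dist (\<sigma> s) (\<sigma> t)"
        using Basis_le_norm[OF e, of "\<sigma> s - \<sigma> t"] by (simp add: dist_norm inner_diff_left)
    qed
    then show "negligible {x\<in>{a..b}. \<not> (\<lambda>t. \<sigma> t \<bullet> e) differentiable (at x)}"
      by (rule absolutely_continuous_real_differentiable_AE)
  qed
  then show ?thesis
  proof (rule negligible_subset)
    show "{x\<in>{a..b}. \<not> \<sigma> differentiable (at x)} \<subseteq> (\<Union>e\<in>Basis. {x\<in>{a..b}. \<not> (\<lambda>t. \<sigma> t \<bullet> e) differentiable (at x)})"
      using differentiable_componentwise_within[of \<sigma> _ UNIV] by auto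
  qed
qed

text \<open>The gauge treats two kinds of tags. At a tag outside \<open>N\<close>, differentiability
  bounds the error by a multiple of the length of the interval. At a tag in \<open>N\<close> the
  integrand is 0 and the gauge confines the interval to an open set of measure below \<delta>, so
  absolute continuity makes the sum of these increments small.\<close>

lemma absolutely_continuous_has_integral:
  fixes u u' :: "real \<Rightarrow> real"
  assumes ac: "absolutely_continuous_curve a b u" and ab: "a \<le> b" and N: "negligible N"
    and der: "\<And>x. x \<in> {a..b} - N \<Longrightarrow> (u has_real_derivative u' x) (at x)"
  shows "((\<lambda>x. if x \<in> N then 0 else u' x) has_integral (u b - u a)) {a..b}"
  unfolding has_integral box_real[symmetric]
proof (intro allI impI)
  fix e :: real assume e: "0 < e"
  obtain \<delta> where d: "\<delta> > 0" "\<And>D. variation_family a b D \<Longrightarrow> (\<Sum>(s, t)\<in>D. t - s) < \<delta> \<Longrightarrow>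
        (\<Sum>(s, t)\<in>D. dist (u s) (u t)) < e / 2"
    using ac half_gt_zero[OF e] unfolding absolutely_continuous_curve_altdef by blast
  obtain U where U: "open U" "N \<subseteq> U" "U \<in> lmeasurable" "measure lebesgue U < \<delta>"
    using lmeasurable_outer_open[OF negligible_imp_measurable[OF N] d(1)] negligible_imp_measure0[OF N]
      by auto
  define \<epsilon> where "\<epsilon> = e / (2 * (b - a + 1))"
  have eps: "\<epsilon> > 0" "\<epsilon> * (b - a) < e / 2"
    unfolding \<epsilon>_def using e ab by (auto simp: field_simps)
  define f where "f x = (if x \<in> N then 0 else u' x)" for x
  have "\<exists>r>0. (x \<in> N \<longrightarrow> ball x r \<subseteq> U) \<and>
      (x \<in> {a..b} - N \<longrightarrow> (\<forall>y. \<bar>y - x\<bar> < r \<longrightarrow> \<bar>u y - u x - (y - x) * u' x\<bar> \<le> \<epsilon> * \<bar>y - x\<bar>))" for x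
  proof (cases "x \<in> N")
    case True
    then have "\<exists>r>0. ball x r \<subseteq> U" using U by (meson open_contains_ball subsetD)
    then show ?thesis using True by auto
  next
    case xN: False
    show ?thesis
    proof (cases "x \<in> {a..b}")
      case True
      then have "(u has_derivative (\<lambda>h. h * u' x)) (at x)"
        using der[of x] xN by (simp add: has_field_derivative_def mult_commute_abs)
      then have "\<exists>r>0. \<forall>y. norm (y - x) < r \<longrightarrow> norm (u y - u x - (y - x) * u' x) \<le> \<epsilon> * norm (y - x)"
        using eps(1) unfolding has_derivative_at_alt by blast
      then show ?thesis using xN by auto
    qed (use xN in \<open>auto intro: exI[of _ 1]\<close>)
  qed
  then obtain r where r: "\<And>x. r x > 0" "\<And>x. x \<in> N \<Longrightarrow> ball x (r x) \<subseteq> U"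
    "\<And>x y. x \<in> {a..b} - N \<Longrightarrow> \<bar>y - x\<bar> < r x \<Longrightarrow> \<bar>u y - u x - (y - x) * u' x\<bar> \<le> \<epsilon> * \<bar>y - x\<bar>"
    by metis
  show "\<exists>\<gamma>. gauge \<gamma> \<and> (\<forall>\<D>. \<D> tagged_division_of cbox a b \<and> \<gamma> fine \<D> \<longrightarrow>
          norm ((\<Sum>(x, k)\<in>\<D>. Henstock_Kurzweil_Integration.content k *\<^sub>R f x) - (u b - u a)) < e)"
  proof (intro exI[of _ "\<lambda>x. ball x (r x)"] conjI allI impI)
    show "gauge (\<lambda>x. ball x (r x))" using r(1) by (rule gauge_ball_dependent[rule_format])
    fix p assume "p tagged_division_of cbox a b \<and> (\<lambda>x. ball x (r x)) fine p"
    then have ptag: "p tagged_division_of cbox a b" and fine: "(\<lambda>x. ball x (r x)) fine p" by auto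
    have fp: "finite p" using ptag by blast
    have K: "Inf K \<le> x" "x \<le> Sup K" "K = {Inf K..Sup K}" "K \<subseteq> ball x (r x)" "a \<le> Inf K" "Sup K \<le> b" "x \<in> {a..b}"
      "Henstock_Kurzweil_Integration.content K = Sup K - Inf K" "interior K = {Inf K<..<Sup K}" if xK: "(x, K) \<in> p" for x K
    proof -
      obtain s t where st: "K = cbox s t" using tagged_division_ofD(4)[OF ptag xK] by blast
      have "x \<in> K" "K \<subseteq> cbox a b" using tagged_division_ofD(2,3)[OF ptag xK] by auto
      then show "Inf K \<le> x" "x \<le> Sup K" "K = {Inf K..Sup K}" "a \<le> Inf K" "Sup K \<le> b" "x \<in> {a..b}"
        "Henstock_Kurzweil_Integration.content K = Sup K - Inf K" "interior K = {Inf K<..<Sup K}"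
        unfolding st by auto
      show "K \<subseteq> ball x (r x)" using fine xK unfolding fine_def by blast
    qed
    define T where "T = (\<lambda>(x, K). Henstock_Kurzweil_Integration.content K * f x - (u (Sup K) - u (Inf K)))"
    have "u b - u a = (\<Sum>(x, K)\<in>p. u (Sup K) - u (Inf K))"
      using additive_tagged_division_1[OF ab, of p u] ptag by simp
    then have eq: "(\<Sum>(x, k)\<in>p. Henstock_Kurzweil_Integration.content k *\<^sub>R f x) - (u b - u a) = (\<Sum>i\<in>p. T i)"
      unfolding T_def by (simp add: sum_subtractf[symmetric] case_prod_beta)
    define p1 where "p1 = {i\<in>p. fst i \<notin> N}"
    define p2 where "p2 = {i\<in>p. fst i \<in> N}"
    have "p = p1 \<union> p2" "p1 \<inter> p2 = {}" "finite p1" "finite p2"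
      unfolding p1_def p2_def using fp by auto
    then have split: "(\<Sum>i\<in>p. T i) = (\<Sum>i\<in>p1. T i) + (\<Sum>i\<in>p2. T i)"
      using sum.union_disjoint[of p1 p2 T] by auto
    have "norm (\<Sum>i\<in>p1. T i) \<le> (\<Sum>i\<in>p1. \<epsilon> * (Sup (snd i) - Inf (snd i)))"
    proof (rule sum_norm_le)
      fix i assume "i \<in> p1"
      then obtain x K where i: "i = (x, K)" "(x, K) \<in> p" "x \<notin> N" unfolding p1_def by (cases i) auto
      note k = K[OF i(2)]
      have xr: "x \<in> {a..b} - N" using k i by auto
      have "Sup K \<in> ball x (r x)" "Inf K \<in> ball x (r x)"
        using k(1,2) k(3,4) by (metis atLeastAtMost_iff order_refl order_trans subsetD)+
      then have "\<bar>u (Sup K) - u x - (Sup K - x) * u' x\<bar> \<le> \<epsilon> * \<bar>Sup K - x\<bar>"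
        "\<bar>u (Inf K) - u x - (Inf K - x) * u' x\<bar> \<le> \<epsilon> * \<bar>Inf K - x\<bar>"
        by (auto intro!: r(3)[OF xr] simp: dist_real_def)
      moreover have "\<bar>Sup K - x\<bar> = Sup K - x" "\<bar>Inf K - x\<bar> = x - Inf K"
        using k(1,2) by auto
      ultimately have "\<bar>u (Sup K) - u x - (Sup K - x) * u' x\<bar> + \<bar>u (Inf K) - u x - (Inf K - x) * u' x\<bar>
          \<le> \<epsilon> * (Sup K - Inf K)" by (simp add: algebra_simps)
      moreover have "T i = (u (Inf K) - u x - (Inf K - x) * u' x) - (u (Sup K) - u x - (Sup K - x) * u' x)"
      proof -
        have "T i = (Sup K - Inf K) * u' x - (u (Sup K) - u (Inf K))"
          using i(1,3) by (simp only: T_def f_def prod.case k(8) if_False)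
        then show ?thesis by (simp add: algebra_simps)
      qed
      ultimately show "norm (T i) \<le> \<epsilon> * (Sup (snd i) - Inf (snd i))" using i by simp
    qed
    also have "\<dots> \<le> (\<Sum>i\<in>p. \<epsilon> * (Sup (snd i) - Inf (snd i)))"
    proof (rule sum_mono2[OF fp])
      fix i assume "i \<in> p - p1"
      then show "0 \<le> \<epsilon> * (Sup (snd i) - Inf (snd i))"
        using K(1,2)[of "fst i" "snd i"] eps by auto
    qed (auto simp: p1_def)
    also have "\<dots> = \<epsilon> * (b - a)"
      using additive_tagged_division_1[OF ab, of p "\<lambda>x. x"] ptag
        by (simp add: sum_distrib_left[symmetric] case_prod_beta)
    finally have s1: "norm (\<Sum>i\<in>p1. T i) < e / 2" using eps by simp
    \<comment> \<open>Degenerate intervals contribute nothing; without them distinct members of the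
      division have distinct end points, so sums over \<open>D\<close> and over \<open>p3\<close>
      agree.\<close>
    define p3 where "p3 = {i\<in>p2. Inf (snd i) < Sup (snd i)}"
    define D where "D = (\<lambda>i. (Inf (snd i), Sup (snd i))) ` p3"
    have p3p: "i \<in> p" "fst i \<in> N" "Inf (snd i) < Sup (snd i)" if "i \<in> p3" for i
      using that unfolding p3_def p2_def by auto
    have disj: "{Inf (snd i)<..<Sup (snd i)} \<inter> {Inf (snd j)<..<Sup (snd j)} = {}" if "i \<in> p3" "j \<in> p3" "i \<noteq> j" for i j
      using tagged_division_ofD(5)[OF ptag, of "fst i" "snd i" "fst j" "snd j"] p3p(1)[OF that(1)] p3p(1)[OF that(2)] that(3)
        K(9)[of "fst i" "snd i"] K(9)[of "fst j" "snd j"] by (simp add: prod_eq_iff)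
    have inj: "inj_on (\<lambda>i. (Inf (snd i), Sup (snd i))) p3"
    proof (rule inj_onI, rule ccontr)
      fix i j assume ij: "i \<in> p3" "j \<in> p3" "(Inf (snd i), Sup (snd i)) = (Inf (snd j), Sup (snd j))" "i \<noteq> j"
      then have "{Inf (snd i)<..<Sup (snd i)} = {}" using disj[OF ij(1,2,4)] by auto
      then show False using p3p(3)[OF ij(1)] by simp
    qed
    have DV: "variation_family a b D"
      unfolding variation_family_def
    proof (intro conjI)
      show "finite D" unfolding D_def p3_def p2_def using fp by auto
      show "\<forall>(s, t)\<in>D. a \<le> s \<and> s \<le> t \<and> t \<le> b"
      proof (clarify)
        fix s t assume "(s, t) \<in> D"
        then obtain i where "i \<in> p3" "s = Inf (snd i)" "t = Sup (snd i)" unfolding D_def by auto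
        then show "a \<le> s \<and> s \<le> t \<and> t \<le> b"
          using K(5,6)[of "fst i" "snd i"] p3p[of i] by auto
      qed
      show "pairwise (\<lambda>(s, t) (s', t'). {s<..<t} \<inter> {s'<..<t'} = {}) D"
        unfolding D_def pairwise_image by (auto simp: pairwise_def split_def dest: disj)
    qed
    have "(\<Sum>(s, t)\<in>D. t - s) \<le> measure lebesgue U"
    proof (rule variation_family_sum_le_measure[OF DV _ U(3)])
      fix s t assume "(s, t) \<in> D"
      then obtain i where i: "i \<in> p3" "s = Inf (snd i)" "t = Sup (snd i)" unfolding D_def by auto
      have "{s..t} \<subseteq> U"
        using K(3,4)[of "fst i" "snd i"] p3p(1,2)[OF i(1)] r(2)[of "fst i"] i by auto
      then show "{s<..<t} \<subseteq> U" by auto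
    qed
    then have "(\<Sum>(s, t)\<in>D. dist (u s) (u t)) < e / 2" using d(2)[OF DV] U(4) by linarith
    also have "(\<Sum>(s, t)\<in>D. dist (u s) (u t)) = (\<Sum>i\<in>p3. dist (u (Inf (snd i))) (u (Sup (snd i))))"
      unfolding D_def by (simp add: sum.reindex[OF inj] split_def)
    also have "\<dots> = (\<Sum>i\<in>p2. norm (T i))"
    proof (rule sum.mono_neutral_cong_left)
      show "finite p2" "p3 \<subseteq> p2" unfolding p3_def p2_def using fp by auto
      show "\<forall>i\<in>p2 - p3. norm (T i) = 0"
      proof
        fix i assume "i \<in> p2 - p3"
        then have i: "i \<in> p" "fst i \<in> N" "\<not> Inf (snd i) < Sup (snd i)"
          unfolding p3_def p2_def by auto
        then have "Inf (snd i) = Sup (snd i)" using K(1,2)[of "fst i" "snd i"] by auto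
        then show "norm (T i) = 0" using i unfolding T_def f_def by (auto simp: split_def)
      qed
      show "dist (u (Inf (snd i))) (u (Sup (snd i))) = norm (T i)" if "i \<in> p3" for i
        using p3p(2)[OF that] unfolding T_def f_def by (auto simp: split_def dist_real_def)
    qed
    finally have "(\<Sum>i\<in>p2. norm (T i)) < e / 2" .
    then have "norm (\<Sum>i\<in>p2. T i) < e / 2" using norm_sum[of T p2] by linarith
    then show "norm ((\<Sum>(x, k)\<in>p. Henstock_Kurzweil_Integration.content k *\<^sub>R f x) - (u b - u a)) < e"
      unfolding eq split
        using s1 norm_triangle_ineq[of "\<Sum>i\<in>p1. T i" "\<Sum>i\<in>p2. T i"] by linarith
  qed
qed

text \<open>This converts a pointwise bound on derivatives into a lower bound for a length. As
  \<open>g\<close> may fail to be measurable, the comparison passes through \<open>F\<close>, the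
  positive part of the derivative.\<close>

lemma absolutely_continuous_increment_le_nn_integral:
  fixes u :: "real \<Rightarrow> real"
  assumes ac: "absolutely_continuous_curve a b u" and ab: "a \<le> b" and N: "negligible N"
    and g: "\<And>x D. x \<in> {a..b} - N \<Longrightarrow> (u has_real_derivative D) (at x) \<Longrightarrow> ennreal D \<le> g x"
  shows "ennreal (u b - u a) \<le> (\<integral>\<^sup>+x\<in>{a..b}. g x \<partial>lebesgue)"
proof -
  define N' where "N' = N \<union> {x\<in>{a..b}. \<not> u differentiable (at x)}"
  have N': "negligible N'"
    unfolding N'_def by (intro negligible_Un N absolutely_continuous_real_differentiable_AE[OF ac])
  define f where "f x = (if x \<in> N' then 0 else deriv u x)" for x
  have der: "(u has_real_derivative deriv u x) (at x)" if "x \<in> {a..b} - N'" for x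
    using that unfolding N'_def by (auto simp: DERIV_deriv_iff_real_differentiable)
  have fi: "(f has_integral (u b - u a)) {a..b}"
    unfolding f_def[abs_def] by (rule absolutely_continuous_has_integral[OF ac ab N' der])
  define F where "F x = max 0 (f x * indicator {a..b} x)" for x
  have Fm: "F \<in> borel_measurable lebesgue"
    unfolding F_def[abs_def] using has_integral_implies_lebesgue_measurable_real[OF fi] by measurable
  have "(\<integral>\<^sup>+x. ennreal (F x) \<partial>lebesgue) \<le> (\<integral>\<^sup>+x\<in>{a..b}. g x \<partial>lebesgue)"
  proof (rule nn_integral_mono_AE)
    have "AE x in lebesgue. x \<notin> N'"
      using N' by (simp add: negligible_iff_null_sets AE_not_in)
    then show "AE x in lebesgue. ennreal (F x) \<le> g x * indicator {a..b} x"
    proof (rule AE_mp, intro AE_I2 impI)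
      fix x assume x: "x \<notin> N'"
      show "ennreal (F x) \<le> g x * indicator {a..b} x"
      proof (cases "x \<in> {a..b}")
        case True
        then have "ennreal (deriv u x) \<le> g x" using g[OF _ der] x unfolding N'_def by auto
        then show ?thesis using True x unfolding F_def f_def by (auto simp: max_def)
      qed (simp add: F_def)
    qed
  qed
  moreover have "ennreal (u b - u a) \<le> (\<integral>\<^sup>+x. ennreal (F x) \<partial>lebesgue)"
  proof (cases "(\<integral>\<^sup>+x. ennreal (F x) \<partial>lebesgue) = \<infinity>")
    case False
    have Fint: "integrable lebesgue F"
      by (rule integrableI_nonneg[OF Fm]) (use False in \<open>auto simp: F_def top.not_eq_extremum\<close>)
    have "(F has_integral integral\<^sup>L lebesgue F) UNIV"
      by (rule has_integral_integral_lebesgue[OF Fint])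
    moreover have "((\<lambda>x. f x * indicator {a..b} x) has_integral (u b - u a)) UNIV"
    proof -
      have "(\<lambda>x. f x * indicator {a..b} x) = (\<lambda>x. if x \<in> {a..b} then f x else 0)"
        by (auto simp: indicator_def)
      then show ?thesis using fi by (simp only: has_integral_restrict_UNIV)
    qed
    moreover have "f x * indicator {a..b} x \<le> F x" for x unfolding F_def by simp
    ultimately have "u b - u a \<le> integral\<^sup>L lebesgue F"
      using has_integral_le by blast
    then show ?thesis
      using nn_integral_eq_integral[OF Fint] by (auto simp: F_def intro: ennreal_leI)
  qed simp
  ultimately show ?thesis by (rule order_trans[rotated])
qed

text \<open>Each coordinate of the derivative, set to 0 on a null set, has an integral by the
  fundamental theorem, and is therefore Lebesgue measurable.\<close>

lemma absolutely_continuous_measurable_derivative: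
  fixes \<sigma> :: "real \<Rightarrow> 'a::euclidean_space"
  assumes ac: "absolutely_continuous_curve a b \<sigma>" and ab: "a \<le> b"
  obtains w N where "w \<in> borel_measurable lebesgue" "negligible N"
    "\<And>t. t \<in> {a..b} - N \<Longrightarrow> (\<sigma> has_vector_derivative w t) (at t)"
proof -
  define N where "N = {x\<in>{a..b}. \<not> \<sigma> differentiable (at x)}"
  have N: "negligible N" unfolding N_def by (rule absolutely_continuous_differentiable_AE[OF ac])
  define w where "w t = (if t \<in> {a..b} - N then vector_derivative \<sigma> (at t) else 0)" for t
  have der: "(\<sigma> has_vector_derivative w t) (at t)" if "t \<in> {a..b} - N" for t
    using that unfolding w_def N_def by (auto simp: vector_derivative_works[symmetric])
  have "w \<in> borel_measurable lebesgue"
  proof (rule borel_measurable_euclidean_space[THEN iffD2], rule ballI)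
    fix e :: 'a assume e: "e \<in> Basis"
    have ace: "absolutely_continuous_curve a b (\<lambda>t. \<sigma> t \<bullet> e)"
    proof (rule absolutely_continuous_curve_compose_lipschitz[OF ac, of _ 1])
      fix s t show "dist (\<sigma> s \<bullet> e) (\<sigma> t \<bullet> e) \<le> 1 * dist (\<sigma> s) (\<sigma> t)"
        using Basis_le_norm[OF e, of "\<sigma> s - \<sigma> t"] by (simp add: dist_norm inner_diff_left)
    qed
    have "((\<lambda>x. if x \<in> N then 0 else w x \<bullet> e) has_integral (\<sigma> b \<bullet> e - \<sigma> a \<bullet> e)) {a..b}"
    proof (rule absolutely_continuous_has_integral[OF ace ab N])
      fix x assume "x \<in> {a..b} - N"
      from der[OF this] show "((\<lambda>t. \<sigma> t \<bullet> e) has_real_derivative w x \<bullet> e) (at x)"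
        unfolding has_vector_derivative_def has_field_derivative_def
        by (rule has_derivative_eq_rhs[OF has_derivative_inner_left]) (auto simp: inner_scaleR_left)
    qed
    from has_integral_implies_lebesgue_measurable_real[OF this]
    have "(\<lambda>x. (if x \<in> N then 0 else w x \<bullet> e) * indicator {a..b} x) \<in> borel_measurable lebesgue" .
    moreover have "(\<lambda>x. (if x \<in> N then 0 else w x \<bullet> e) * indicator {a..b} x) = (\<lambda>x. w x \<bullet> e)"
      unfolding w_def by auto
    ultimately show "(\<lambda>x. w x \<bullet> e) \<in> borel_measurable lebesgue" by simp
  qed
  then show thesis using that N der by blast
qed

section \<open>The four point inequality and geodesics\<close>

text \<open>Let \<open>M x z\<close> be the largest of the four cross terms. If one of
  \<open>M x y\<close> and \<open>M z w\<close> is at most \<open>M y w + C\<close>, the other is at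
  most \<open>M x z + C\<close>. Otherwise they are at most \<open>M x w + C\<close> and
  \<open>M y z + C\<close>. The remaining cases are symmetric.\<close>

lemma quasi_ultrametric_four_point:
  fixes M :: "'a \<Rightarrow> 'a \<Rightarrow> real"
  assumes sym: "\<And>x y. x \<in> X \<Longrightarrow> y \<in> X \<Longrightarrow> M x y = M y x"
    and ult: "\<And>x y z. x \<in> X \<Longrightarrow> y \<in> X \<Longrightarrow> z \<in> X \<Longrightarrow> M x z \<le> max (M x y) (M y z) + C"
    and X: "x \<in> X" "y \<in> X" "z \<in> X" "w \<in> X"
  shows "M x y + M z w \<le> max (M x z + M y w) (M x w + M y z) + 2 * C"
  using ult[of x z y] ult[of x w y] ult[of z x w] ult[of z y w]
    sym[of z y] sym[of w y] sym[of z x] sym[of w x] X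
  by (auto simp: max_def split: if_splits)

text \<open>The companion of \<open>p\<close> is the point \<open>q\<close> of another side at the
  same distance from the common vertex. One use of the four point inequality shows that
  \<open>q\<close> is hardly further than \<open>p\<close> from the other end of the side of
  \<open>p\<close>; a second use then bounds \<open>d p q\<close>.\<close>

lemma four_point_imp_side_thin:
  assumes four: "\<And>x y z w. x \<in> M \<Longrightarrow> y \<in> M \<Longrightarrow> z \<in> M \<Longrightarrow> w \<in> M \<Longrightarrow>
      d x y + d z w \<le> max (d x z + d y w) (d x w + d y z) + \<delta>"
    and ms: "Metric_space M d"
    and S: "geodesic_segment M d x y S1" "geodesic_segment M d y z S2" "geodesic_segment M d z x S3"
    and p: "p \<in> S1"
  shows "\<exists>q\<in>S2 \<union> S3. d p q \<le> 2 * \<delta>"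
proof -
  interpret Metric_space M d by (rule ms)
  have geo: "u \<in> M \<and> v \<in> M \<and> S \<subseteq> M \<and> (\<forall>q\<in>S. d u q + d q v = d u v) \<and>
      (\<forall>s. 0 \<le> s \<longrightarrow> s \<le> d u v \<longrightarrow> (\<exists>q\<in>S. d u q = s \<and> d q v = d u v - s))"
    if uv: "geodesic_segment M d u v S" for u v S
  proof -
    obtain a b \<sigma> where s: "a \<le> b" "geodesic M d {a..b} \<sigma>" "\<sigma> a = u" "\<sigma> b = v" "S = \<sigma> ` {a..b}"
      using uv unfolding geodesic_segment_def by blast
    have dd: "d (\<sigma> s) (\<sigma> t) = \<bar>s - t\<bar>" if "s \<in> {a..b}" "t \<in> {a..b}" for s t
      using s(2) that unfolding geodesic_def by blast
    have duv: "d u v = b - a" using dd[of a b] s by auto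
    have "\<exists>q\<in>S. d u q = r \<and> d q v = d u v - r" if "0 \<le> r" "r \<le> d u v" for r
    proof (intro bexI[of _ "\<sigma> (a + r)"])
      show "d u (\<sigma> (a + r)) = r \<and> d (\<sigma> (a + r)) v = d u v - r"
        using dd[of a "a + r"] dd[of "a + r" b] s that duv by auto
      show "\<sigma> (a + r) \<in> S" using s that duv by auto
    qed
    moreover have "d u q + d q v = d u v" if "q \<in> S" for q
      using that dd[of a] dd[of _ b] s duv by auto
    moreover have "u \<in> M \<and> v \<in> M \<and> S \<subseteq> M" using s unfolding geodesic_def by auto
    ultimately show ?thesis by blast
  qed
  have M: "x \<in> M" "y \<in> M" "z \<in> M" "p \<in> M" and pe: "d x p + d p y = d x y"
    using geo[OF S(1)] geo[OF S(2)] p by auto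
  have key: "d p q \<le> 2 * \<delta>"
    if q: "q \<in> M" and Y: "y' \<in> M" "x' \<in> M" and e: "d x' p + d p y' = d x' y'"
      and xq: "d x' q = d x' p" "d q z = d x' z - d x' p" and le: "d x' p + d y' z \<le> d x' z - d x' p + d x' y'"
    for q x' y'
  proof -
    have "d q y' + d x' z \<le> max (d q x' + d y' z) (d q z + d y' x') + \<delta>"
      using four[OF q Y(1) Y(2) M(3)] .
    then have 1: "d q y' \<le> d x' y' - d x' p + \<delta>"
      using xq le commute[of q x'] commute[of y' x'] by (auto simp: max_def split: if_splits)
    have "d p q + d x' y' \<le> max (d p x' + d q y') (d p y' + d q x') + \<delta>"
      using four[OF M(4) q Y(2) Y(1)] .
    then have "d p q + d x' y' \<le> max (d x' p + d q y') (d x' y') + \<delta>"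
      using e xq commute[of p x'] commute[of q x'] by (auto simp: max_def split: if_splits)
    moreover have "0 \<le> \<delta>" using four[OF M(4) M(4) M(4) M(4)] M mdist_zero by auto
    ultimately show ?thesis using 1 by (auto simp: max_def split: if_splits)
  qed
  show ?thesis
  \<comment> \<open>The condition says that \<open>d x p\<close> is at most the Gromov product of
    \<open>y\<close> and \<open>z\<close> at \<open>x\<close>. If it fails, \<open>d y p\<close> is
    at most the Gromov product of \<open>x\<close> and \<open>z\<close> at \<open>y\<close>, and the
    vertex \<open>y\<close> takes over.\<close>
  proof (cases "d x p + d y z \<le> d x z - d x p + d x y")
    case True
    have "d x p \<le> d x z"
      using True triangle[OF M(1) M(3) M(2)] commute[of z y] by linarith
    then obtain q where q: "q \<in> S3" "d z q = d x z - d x p" "d q x = d x p"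
      using geo[OF S(3)] commute[of x z]
        by (metis diff_ge_0_iff_ge diff_diff_eq2 add_diff_cancel_left' le_add_diff_inverse2 nonneg diff_le_self cancel_ab_semigroup_add_class.diff_right_commute diff_left_mono diff_zero)
    have "d p q \<le> 2 * \<delta>"
      using key[of q y x] geo[OF S(3)] q M pe True commute[of x q] commute[of q z] by auto
    then show ?thesis using q by blast
  next
    case False
    then have le: "d y p + d x z \<le> d y z - d y p + d y x"
      using pe commute[of p y] commute[of x y] by linarith
    have "d y p \<le> d y z"
      using le triangle[OF M(2) M(3) M(1)] commute[of z x] by linarith
    then obtain q where q: "q \<in> S2" "d y q = d y p" "d q z = d y z - d y p"
      using geo[OF S(2)] nonneg[of y p] by blast
    have "d p q \<le> 2 * \<delta>"
      using key[of q x y] geo[OF S(2)] q M pe le commute[of x p] commute[of p y] commute[of x y] by auto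
    then show ?thesis using q by blast
  qed
qed

lemma four_point_imp_gromov_hyperbolic:
  assumes four: "\<And>x y z w. x \<in> M \<Longrightarrow> y \<in> M \<Longrightarrow> z \<in> M \<Longrightarrow> w \<in> M \<Longrightarrow>
      d x y + d z w \<le> max (d x z + d y w) (d x w + d y z) + \<delta>"
    and pr: "proper_metric_space M d" and geo: "geodesic_metric_space M d"
  shows "gromov_hyperbolic M d"
proof -
  have ms: "Metric_space M d" using pr unfolding proper_metric_space_def by blast
  then interpret Metric_space M d .
  define \<eta> where "\<eta> = max 0 (2 * \<delta>)"
  note thin = four_point_imp_side_thin[OF four ms]
  have "thin_triangle d \<eta> S1 S2 S3" if tri: "geodesic_triangle M d S1 S2 S3" for S1 S2 S3
  proof -
    obtain x y z where S: "geodesic_segment M d x y S1" "geodesic_segment M d y z S2" "geodesic_segment M d z x S3"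
      using tri unfolding geodesic_triangle_def by blast
    have "\<forall>p\<in>S1. \<exists>q\<in>S2 \<union> S3. d p q \<le> 2 * \<delta>" "\<forall>p\<in>S2. \<exists>q\<in>S3 \<union> S1. d p q \<le> 2 * \<delta>"
      "\<forall>p\<in>S3. \<exists>q\<in>S1 \<union> S2. d p q \<le> 2 * \<delta>"
      using thin[OF _ _ _ _ S(1,2,3)] thin[OF _ _ _ _ S(2,3,1)] thin[OF _ _ _ _ S(3,1,2)] by blast+
    then show ?thesis unfolding thin_triangle_def \<eta>_def by (meson max.coboundedI2)
  qed
  then show ?thesis
    unfolding gromov_hyperbolic_def delta_hyperbolic_def using pr geo
    by (intro exI[of _ \<eta>]) (auto simp: \<eta>_def)
qed

text \<open>The maps that are geodesic up to an additive error form a decreasing family of closed subsets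
  of a product of compact sets, so by Tychonoff's theorem they have a common element.\<close>

lemma geodesic_segment_from_approximate:
  fixes d :: "'a::metric_space \<Rightarrow> 'a \<Rightarrow> real"
  assumes K: "compact K" "K \<subseteq> M" and cont: "continuous_on (K \<times> K) (\<lambda>(p, q). d p q)" and L: "L \<ge> 0"
    and xy: "x \<in> K" "y \<in> K"
    and approx: "\<And>e. e > 0 \<Longrightarrow> \<exists>f. (\<forall>s\<in>{0..L}. f s \<in> K) \<and> f 0 = x \<and> f L = y \<and>
       (\<forall>s\<in>{0..L}. \<forall>t\<in>{0..L}. \<bar>d (f s) (f t) - \<bar>s - t\<bar>\<bar> \<le> e)"
  shows "\<exists>S. geodesic_segment M d x y S"
proof -
  define X where "X = product_topology (\<lambda>t::real. euclidean :: 'a topology) {0..L}"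
  define P where "P = PiE {0..L} (\<lambda>t. K)"
  have cP: "compactin X P" unfolding X_def P_def by (simp add: compactin_PiE K(1))
  have proj: "continuous_map (subtopology X P) (top_of_set K) (\<lambda>f. f t)" if "t \<in> {0..L}" for t
  proof -
    have "continuous_map X euclidean (\<lambda>f. f t)"
      unfolding X_def using that by (rule continuous_map_product_projection)
    then have "continuous_map (subtopology X P) euclidean (\<lambda>f. f t)"
      by (rule continuous_map_from_subtopology)
    then show ?thesis
      by (rule continuous_map_into_subtopology) (use that in \<open>auto simp: P_def X_def PiE_def\<close>)
  qed
  define A where "A e = {f \<in> topspace (subtopology X P). f 0 = x \<and> f L = y \<and>
       (\<forall>s\<in>{0..L}. \<forall>t\<in>{0..L}. \<bar>d (f s) (f t) - \<bar>s - t\<bar>\<bar> \<le> e)}" for e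
  have tsp: "topspace (subtopology X P) = P" unfolding X_def P_def by (auto simp: PiE_def)
  have clA: "closedin (subtopology X P) (A e)" for e
  proof -
    let ?T = "subtopology X P"
    have 1: "closedin ?T {f \<in> topspace ?T. f t \<in> {c}}" if "t \<in> {0..L}" "c \<in> K" for t c
      by (rule closedin_continuous_map_preimage[OF proj[OF that(1)]]) (use that in \<open>auto intro: closed_subset\<close>)
    have 2: "closedin ?T {f \<in> topspace ?T. \<bar>d (f s) (f t) - \<bar>s - t\<bar>\<bar> \<in> {..e}}" if st: "s \<in> {0..L}" "t \<in> {0..L}" for s t
    proof (rule closedin_continuous_map_preimage[where Y=euclidean])
      have "continuous_map ?T (prod_topology (top_of_set K) (top_of_set K)) (\<lambda>f. (f s, f t))"
        by (rule continuous_map_pairedI[OF proj[OF st(1)] proj[OF st(2)]])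
      then have "continuous_map ?T (top_of_set (K \<times> K)) (\<lambda>f. (f s, f t))"
        by (simp only: subtopology_Times[symmetric] prod_topology_euclidean)
      moreover have "continuous_map (top_of_set (K \<times> K)) euclidean (\<lambda>pq. \<bar>(case pq of (p, q) \<Rightarrow> d p q) - \<bar>s - t\<bar>\<bar>)"
        using cont by (auto intro!: continuous_intros)
      ultimately have "continuous_map ?T euclidean ((\<lambda>pq. \<bar>(case pq of (p, q) \<Rightarrow> d p q) - \<bar>s - t\<bar>\<bar>) \<circ> (\<lambda>f. (f s, f t)))"
        by (rule continuous_map_compose)
      then show "continuous_map ?T euclidean (\<lambda>f. \<bar>d (f s) (f t) - \<bar>s - t\<bar>\<bar>)"
        by (simp add: o_def)
    qed auto
    have "A e = {f \<in> topspace ?T. f 0 \<in> {x}} \<inter> {f \<in> topspace ?T. f L \<in> {y}} \<inter>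
       (\<Inter>s\<in>{0..L}. \<Inter>t\<in>{0..L}. {f \<in> topspace ?T. \<bar>d (f s) (f t) - \<bar>s - t\<bar>\<bar> \<in> {..e}})"
      unfolding A_def using L by auto
    also have "closedin ?T \<dots>"
      using L xy by (intro closedin_Int closedin_INT 1 2) auto
    finally show ?thesis .
  qed
  have neA: "A e \<noteq> {}" if e: "e > 0" for e
  proof -
    obtain f where f: "\<forall>s\<in>{0..L}. f s \<in> K" "f 0 = x" "f L = y"
       "\<forall>s\<in>{0..L}. \<forall>t\<in>{0..L}. \<bar>d (f s) (f t) - \<bar>s - t\<bar>\<bar> \<le> e"
         using approx[OF e] by blast
    have "restrict f {0..L} \<in> P" unfolding P_def using f(1) by auto
    then have "restrict f {0..L} \<in> A e" unfolding A_def tsp using f L by simp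
    then show ?thesis by blast
  qed
  have comp: "compact_space (subtopology X P)" using cP by (rule compact_space_subtopology)
  have ne: "(\<Inter>e\<in>{0<..}. A e) \<noteq> {}"
  proof (rule compact_space_fip[THEN iffD1, OF comp, rule_format])
    show "(\<forall>C\<in>A ` {0<..}. closedin (subtopology X P) C) \<and> (\<forall>\<F>. finite \<F> \<and> \<F> \<subseteq> A ` {0<..} \<longrightarrow> \<Inter> \<F> \<noteq> {})"
    proof (intro conjI ballI allI impI)
      fix \<F> assume "finite \<F> \<and> \<F> \<subseteq> A ` {0<..}"
      then obtain E where E: "finite E" "E \<subseteq> {0<..}" "\<F> = A ` E" by (meson finite_subset_image)
      show "\<Inter> \<F> \<noteq> {}"
      proof (cases "E = {}")
        case False
        define e where "e = Min E"
        have "e > 0" "\<And>e'. e' \<in> E \<Longrightarrow> e \<le> e'"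
          using E False unfolding e_def by (auto simp: subset_iff)
        then have "A e \<subseteq> A e'" if "e' \<in> E" for e'
          unfolding A_def using that by (auto intro: order_trans)
        then have "A e \<subseteq> \<Inter> \<F>" unfolding E(3) by blast
        then show ?thesis using neA[OF \<open>e > 0\<close>] by blast
      qed (use E in auto)
    qed (use clA in auto)
  qed
  then obtain f where f: "\<And>e. e > 0 \<Longrightarrow> f \<in> A e" by blast
  have fK: "f t \<in> K" if "t \<in> {0..L}" for t using f[of 1] that unfolding A_def tsp P_def by auto
  have "d (f s) (f t) = \<bar>s - t\<bar>" if "s \<in> {0..L}" "t \<in> {0..L}" for s t
  proof -
    have "\<bar>d (f s) (f t) - \<bar>s - t\<bar>\<bar> \<le> 0"
      by (rule field_le_epsilon) (use f that in \<open>auto simp: A_def\<close>)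
    then show ?thesis by simp
  qed
  moreover have "f 0 = x" "f L = y" using f[of 1] unfolding A_def by auto
  ultimately show ?thesis
    unfolding geodesic_segment_def geodesic_def using L fK K(2)
    by (intro exI[of _ "f ` {0..L}"] exI[of _ 0] exI[of _ L] exI[of _ f]) (auto simp: is_interval_cc)
qed

section \<open>Convex polynomials\<close>

lemma vector_smult_scaleR:
  fixes w :: "complex^'n"
  shows "\<zeta> *s (t *\<^sub>R w) = t *\<^sub>R (\<zeta> *s w)" "complex_of_real t *s w = t *\<^sub>R w"
    "(t *\<^sub>R \<zeta>) *s w = t *\<^sub>R (\<zeta> *s w)" "\<zeta> *s (- w) = - (\<zeta> *s w)"
  by (simp_all add: vec_eq_iff complex_eq_iff)

lemma continuous_on_vector_smult [continuous_intros]: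
  fixes w :: "'a::topological_space \<Rightarrow> complex^'n"
  assumes "continuous_on S f" "continuous_on S w"
  shows "continuous_on S (\<lambda>x. f x *s w x)"
  unfolding vector_scalar_mult_def using assms by (intro continuous_intros) auto

text \<open>Comparing \<open>p(t)\<close> with \<open>2^n * p(t/2)\<close> removes the leading term.\<close>

lemma poly_coeff_bound:
  "\<exists>C\<ge>0. \<forall>(p::real poly) A. degree p \<le> n \<longrightarrow> (\<forall>t\<in>{0..1}. \<bar>poly p t\<bar> \<le> A) \<longrightarrow> (\<forall>j. \<bar>coeff p j\<bar> \<le> C * A)"
proof (induction n)
  case 0
  have "\<bar>coeff p j\<bar> \<le> 1 * A" if "degree p \<le> 0" "\<forall>t\<in>{0..1}. \<bar>poly p t\<bar> \<le> A" for p :: "real poly" and A j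
  proof (cases j)
    case 0
    then show ?thesis using bspec[OF that(2), of 0] by (simp add: poly_0_coeff_0)
  next
    case (Suc k)
    then show ?thesis using bspec[OF that(2), of 0] that(1) by (simp add: coeff_eq_0)
  qed
  then show ?case by (intro exI[of _ 1]) auto
next
  case (Suc n)
  then obtain C where C: "C \<ge> 0" "\<And>(p::real poly) A j. degree p \<le> n \<Longrightarrow> (\<forall>t\<in>{0..1}. \<bar>poly p t\<bar> \<le> A) \<Longrightarrow> \<bar>coeff p j\<bar> \<le> C * A"
    by blast
  define C1 where "C1 = C * (1 + 2 ^ Suc n)"
  define C2 where "C2 = 1 + real (Suc n) * C1"
  have C1: "C1 \<ge> 0" using C(1) unfolding C1_def by simp
  have "\<bar>coeff p j\<bar> \<le> max C1 C2 * A"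
    if p: "degree p \<le> Suc n" and A: "\<forall>t\<in>{0..1}. \<bar>poly p t\<bar> \<le> A" for p :: "real poly" and A j
  proof -
    have A0: "A \<ge> 0" using bspec[OF A, of 0] by auto
    \<comment> \<open>The coefficient of degree \<open>i\<close> is multiplied by
      \<open>1 - 2 ^ (Suc n - i)\<close>. This is 0 for the leading one and at least 1 in modulus
      for the others, so a bound for \<open>r\<close> bounds all lower coefficients of
      \<open>p\<close>.\<close>
    define r where "r = p - smult (2 ^ Suc n) (pcompose p [:0, 1/2:])"
    have cr: "coeff r i = coeff p i * (1 - 2 ^ Suc n * (1/2) ^ i)" for i
      unfolding r_def by (simp add: coeff_pcompose_linear algebra_simps)
    have "degree r \<le> n"
    proof (rule degree_le, intro allI impI)
      fix i assume "n < i"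
      show "coeff r i = 0"
      proof (cases "i = Suc n")
        case True
        then show ?thesis unfolding cr by (simp add: power_divide)
      next
        case False
        then have "coeff p i = 0" using p \<open>n < i\<close> by (intro coeff_eq_0) auto
        then show ?thesis unfolding cr by simp
      qed
    qed
    moreover have "\<bar>poly r t\<bar> \<le> (1 + 2 ^ Suc n) * A" if "t \<in> {0..1}" for t
    proof -
      have pr: "poly r t = poly p t - 2 ^ Suc n * poly p (t / 2)"
        unfolding r_def by (simp add: poly_pcompose)
      have "\<bar>poly p t\<bar> \<le> A" "\<bar>poly p (t / 2)\<bar> \<le> A" using A that by auto
      then have "\<bar>2 ^ Suc n * poly p (t / 2)\<bar> \<le> 2 ^ Suc n * A"
        by (simp add: abs_mult)
      then show ?thesis
        using \<open>\<bar>poly p t\<bar> \<le> A\<close> unfolding pr by (simp add: algebra_simps)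
    qed
    ultimately have r: "\<bar>coeff r i\<bar> \<le> C1 * A" for i
      using C(2)[of r "(1 + 2 ^ Suc n) * A" i] unfolding C1_def by (simp add: mult.assoc)
    have low: "\<bar>coeff p i\<bar> \<le> C1 * A" if "i \<le> n" for i
    proof -
      have "(2::real) ^ Suc n * (1/2) ^ i = 2 ^ (Suc n - i)"
        using that by (simp add: power_divide power_diff field_simps)
      moreover have "(2::real) ^ 1 \<le> 2 ^ (Suc n - i)" using that by (intro power_increasing) auto
      ultimately have "1 \<le> \<bar>1 - 2 ^ Suc n * (1/2) ^ i :: real\<bar>" by simp
      then have "\<bar>coeff p i\<bar> * 1 \<le> \<bar>coeff r i\<bar>"
        unfolding cr abs_mult by (intro mult_left_mono) auto
      then show ?thesis using r[of i] by simp
    qed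
    \<comment> \<open>The leading coefficient is recovered from the value at 1 and the lower
      coefficients.\<close>
    have "poly p 1 = (\<Sum>i\<le>Suc n. coeff p i)"
      using p by (simp add: poly_altdef sum.mono_neutral_left[of "{..Suc n}" "{..degree p}"] coeff_eq_0)
    then have "coeff p (Suc n) = poly p 1 - (\<Sum>i\<le>n. coeff p i)" by simp
    moreover have "\<bar>\<Sum>i\<le>n. coeff p i\<bar> \<le> (\<Sum>i\<le>n. C1 * A)"
      by (rule order_trans[OF sum_abs sum_mono]) (use low in auto)
    moreover have "\<bar>poly p 1\<bar> \<le> A" using A by auto
    ultimately have top: "\<bar>coeff p (Suc n)\<bar> \<le> C2 * A"
      unfolding C2_def by (simp add: algebra_simps)
    have m: "C1 * A \<le> max C1 C2 * A" "C2 * A \<le> max C1 C2 * A"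
      using A0 by (auto intro: mult_right_mono)
    consider "j \<le> n" | "j = Suc n" | "j > Suc n" by linarith
    then show ?thesis
    proof cases
      case 3
      then have "coeff p j = 0" using p by (intro coeff_eq_0) auto
      then show ?thesis using A0 C1 by (simp add: max_def)
    qed (use low[of j] top m in auto)
  qed
  then show ?case using C1 by (intro exI[of _ "max C1 C2"]) auto
qed

lemma poly_growth:
  "\<exists>C\<ge>1. \<forall>(p::real poly) A. degree p \<le> n \<longrightarrow> (\<forall>t\<in>{0..1}. \<bar>poly p t\<bar> \<le> A) \<longrightarrow> (\<forall>T\<ge>1. \<bar>poly p T\<bar> \<le> C * A * T ^ n)"
proof -
  obtain C where C: "C \<ge> 0" "\<And>(p::real poly) A j. degree p \<le> n \<Longrightarrow> (\<forall>t\<in>{0..1}. \<bar>poly p t\<bar> \<le> A) \<Longrightarrow> \<bar>coeff p j\<bar> \<le> C * A"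
    using poly_coeff_bound[of n] by blast
  have "\<bar>poly p T\<bar> \<le> (1 + real (Suc n) * C) * A * T ^ n"
    if p: "degree p \<le> n" and A: "\<forall>t\<in>{0..1}. \<bar>poly p t\<bar> \<le> A" and T: "T \<ge> 1" for p :: "real poly" and A T
  proof -
    have A0: "A \<ge> 0" using bspec[OF A, of 0] by auto
    have "poly p T = (\<Sum>i\<le>n. coeff p i * T ^ i)"
      using p by (simp add: poly_altdef sum.mono_neutral_left[of "{..n}" "{..degree p}"] coeff_eq_0)
    also have "\<bar>\<dots>\<bar> \<le> (\<Sum>i\<le>n. C * A * T ^ n)"
    proof (rule order_trans[OF sum_abs sum_mono])
      fix i assume "i \<in> {..n}"
      then have "T ^ i \<le> T ^ n" using T by (intro power_increasing) auto
      then show "\<bar>coeff p i * T ^ i\<bar> \<le> C * A * T ^ n"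
        using C(2)[OF p A, of i] T C(1) A0 by (auto simp: abs_mult intro!: mult_mono)
    qed
    also have "\<dots> \<le> (1 + real (Suc n) * C) * A * T ^ n" using A0 T by (simp add: algebra_simps)
    finally show ?thesis .
  qed
  then show ?thesis using C(1) by (intro exI[of _ "1 + real (Suc n) * C"]) auto
qed

text \<open>Fixing the constant by choice lets it occur in later explicit constants; it depends on
  the degree alone, hence not on the base point or direction of a line.\<close>

definition growth :: "nat \<Rightarrow> real" where
  "growth n = (SOME C. C \<ge> 1 \<and> (\<forall>(p::real poly) A. degree p \<le> n \<longrightarrow> (\<forall>t\<in>{0..1}. \<bar>poly p t\<bar> \<le> A) \<longrightarrow>
      (\<forall>T\<ge>1. \<bar>poly p T\<bar> \<le> C * A * T ^ n)))"

lemma growth: "growth n \<ge> 1"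
    "degree (p::real poly) \<le> n \<Longrightarrow> (\<And>t. t \<in> {0..1} \<Longrightarrow> \<bar>poly p t\<bar> \<le> A) \<Longrightarrow> T \<ge> 1 \<Longrightarrow> \<bar>poly p T\<bar> \<le> growth n * A * T ^ n"
  using someI_ex[OF poly_growth[of n]] unfolding growth_def[symmetric] by blast+

text \<open>\<open>line_poly\<close> keeps only the degree bound on real lines, which provides the
  finite type. \<open>coercive\<close> is nondegeneracy along the lines through 0 in a form uniform
  in the direction. \<open>DP\<close> is a parameter so that derivatives need not be chosen
  repeatedly.\<close>

locale convex_poly =
  fixes P :: "complex^'d::finite \<Rightarrow> real" and DP :: "complex^'d \<Rightarrow> complex^'d \<Rightarrow> real" and m :: nat
  assumes convex: "convex_on UNIV P"
    and nonneg: "P z \<ge> 0"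
    and deriv: "(P has_derivative DP p) (at p)"
    and line_poly: "\<exists>q. degree q \<le> m \<and> (\<forall>t. P (p + t *\<^sub>R v) = poly q t)"
    and m1: "m \<ge> 1"
    and even: "P (- z) = P z"
    and coercive: "\<exists>B. \<forall>v. (\<forall>\<zeta>. cmod \<zeta> \<le> 1 \<longrightarrow> P (\<zeta> *s v) \<le> M) \<longrightarrow> norm v \<le> B"
begin

abbreviation "G \<equiv> growth m"

lemma G1: "G \<ge> 1" by (rule growth)

text \<open>The gap between \<open>P\<close> and its tangent plane at \<open>p\<close> (a Bregman
  divergence): nonnegative and convex in \<open>w\<close>, and equal to 0 at
  \<open>w = 0\<close>.\<close>

definition Q :: "complex^'d \<Rightarrow> complex^'d \<Rightarrow> real" where "Q p w = P (p + w) - P p - DP p w"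

lemma DP_linear: "linear (DP p)"
  using deriv[of p] by (simp add: has_derivative_def bounded_linear.linear)

lemma DP_bounded_linear: "bounded_linear (DP p)"
  using deriv[of p] by (simp add: has_derivative_def)

lemmas DP_simps = linear_add[OF DP_linear] linear_diff[OF DP_linear] linear_scale[OF DP_linear] linear_neg[OF DP_linear] linear_0[OF DP_linear]

lemma P_cont: "continuous_on S P"
  by (meson deriv has_derivative_continuous continuous_at_imp_continuous_on)

lemma P_cont' [continuous_intros]: "continuous_on S f \<Longrightarrow> continuous_on S (\<lambda>x. P (f x))"
  using continuous_on_compose2[OF P_cont[of UNIV]] by blast

lemma DP_cont [continuous_intros]: "continuous_on S f \<Longrightarrow> continuous_on S (\<lambda>x. DP p (f x))"
  using bounded_linear.continuous_on[OF DP_bounded_linear] by blast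

lemma P_convexD: "0 \<le> t \<Longrightarrow> t \<le> 1 \<Longrightarrow> P ((1 - t) *\<^sub>R a + t *\<^sub>R b) \<le> (1 - t) * P a + t * P b"
  using convex_onD[OF convex, of t a b] by auto

lemma Q_nonneg: "Q p w \<ge> 0"
proof -
  have "((\<lambda>t. P (p + t *\<^sub>R w)) has_derivative (\<lambda>t. DP p (t *\<^sub>R w))) (at 0)"
    by (rule has_derivative_compose[of "\<lambda>t. p + t *\<^sub>R w" "\<lambda>t. t *\<^sub>R w" 0 UNIV P "DP p"])
      (auto intro!: derivative_eq_intros deriv)
  then have "((\<lambda>t. P (p + t *\<^sub>R w)) has_real_derivative DP p w) (at 0)"
    by (simp add: has_field_derivative_def DP_simps mult_commute_abs)
  then have "((\<lambda>t. (P (p + t *\<^sub>R w) - P p) / t) \<longlongrightarrow> DP p w) (at_right 0)"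
    unfolding has_field_derivative_iff by (auto intro: tendsto_within_subset)
  moreover have "\<forall>\<^sub>F t in at_right 0. (P (p + t *\<^sub>R w) - P p) / t \<le> P (p + w) - P p"
    unfolding eventually_at_right_field
  proof (intro exI[of _ 1] conjI allI impI)
    fix t :: real assume t: "t > 0" "t < 1"
    have "P ((1 - t) *\<^sub>R p + t *\<^sub>R (p + w)) \<le> (1 - t) * P p + t * P (p + w)"
      by (rule P_convexD) (use t in auto)
    moreover have "(1 - t) *\<^sub>R p + t *\<^sub>R (p + w) = p + t *\<^sub>R w" by (simp add: algebra_simps)
    ultimately show "(P (p + t *\<^sub>R w) - P p) / t \<le> P (p + w) - P p"
      using t by (simp add: field_simps)
  qed simp
  ultimately have "DP p w \<le> P (p + w) - P p"
    by (rule tendsto_upperbound) simp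
  then show ?thesis unfolding Q_def by simp
qed

lemma Q_0 [simp]: "Q p 0 = 0" unfolding Q_def by (simp add: DP_simps)

text \<open>Moving the base point changes \<open>Q\<close> only by a real linear functional and a
  constant. This lets estimates at \<open>p + y\<close> be read at \<open>p\<close>.\<close>

lemma Q_shift: "Q p (y + s) = Q p y + (DP (p + y) s - DP p s) + Q (p + y) s"
  unfolding Q_def by (simp add: DP_simps algebra_simps)

lemma Q_convexD: "0 \<le> t \<Longrightarrow> t \<le> 1 \<Longrightarrow> Q p ((1 - t) *\<^sub>R a + t *\<^sub>R b) \<le> (1 - t) * Q p a + t * Q p b"
  using P_convexD[of t "p + a" "p + b"] unfolding Q_def by (simp add: DP_simps algebra_simps)

text \<open>On a ray \<open>Q\<close> is \<open>P\<close> minus an affine function; since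
  \<open>m \<ge> 1\<close>, its degree is still at most \<open>m\<close>.\<close>

lemma Q_growth:
  assumes "\<And>t. t \<in> {0..1} \<Longrightarrow> Q p (t *\<^sub>R w) \<le> A" "T \<ge> 1"
  shows "Q p (T *\<^sub>R w) \<le> G * A * T ^ m"
proof -
  obtain q where q: "degree q \<le> m" "\<And>t. P (p + t *\<^sub>R w) = poly q t" using line_poly by blast
  define r where "r = q - [:P p, DP p w:]"
  have r: "poly r t = Q p (t *\<^sub>R w)" for t unfolding r_def Q_def by (simp add: q DP_simps)
  have "degree r \<le> m" unfolding r_def using q(1) m1 by (intro degree_diff_le) auto
  moreover have "\<bar>poly r t\<bar> \<le> A" if "t \<in> {0..1}" for t
    using assms(1)[OF that] Q_nonneg unfolding r by simp
  ultimately have "\<bar>poly r T\<bar> \<le> G * A * T ^ m" using growth(2) assms(2) by blast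
  then show ?thesis unfolding r by simp
qed

text \<open>The supremum over the disc measures the whole complex direction of \<open>w\<close>, as
  is needed for comparison with holomorphic discs, and makes \<open>psi\<close> bound
  \<open>Q\<close> at \<open>- w\<close> as well.\<close>

definition psi :: "complex^'d \<Rightarrow> complex^'d \<Rightarrow> real" where
  "psi p w = (SUP \<zeta>\<in>cball 0 1. Q p (\<zeta> *s w))"

lemma psi_bdd: "bdd_above ((\<lambda>\<zeta>. Q p (\<zeta> *s w)) ` cball 0 1)"
proof -
  have "compact ((\<lambda>\<zeta>. Q p (\<zeta> *s w)) ` cball 0 1)"
    unfolding Q_def by (intro compact_continuous_image continuous_intros) auto
  then show ?thesis by (simp add: bounded_imp_bdd_above compact_imp_bounded)
qed

lemma psi_upper: "cmod \<zeta> \<le> 1 \<Longrightarrow> Q p (\<zeta> *s w) \<le> psi p w"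
  unfolding psi_def by (rule cSUP_upper[OF _ psi_bdd]) simp

lemma psi_least: "(\<And>\<zeta>. cmod \<zeta> \<le> 1 \<Longrightarrow> Q p (\<zeta> *s w) \<le> A) \<Longrightarrow> psi p w \<le> A"
  unfolding psi_def by (rule cSUP_least) auto

lemma psi_nonneg: "psi p w \<ge> 0" using psi_upper[of 0 p w] by simp

lemma psi_0 [simp]: "psi p 0 = 0" by (rule antisym[OF psi_least psi_nonneg]) simp

lemma psi_convexD:
  assumes "0 \<le> t" "t \<le> 1"
  shows "psi p ((1 - t) *\<^sub>R a + t *\<^sub>R b) \<le> (1 - t) * psi p a + t * psi p b"
proof (rule psi_least)
  fix \<zeta> :: complex assume z: "cmod \<zeta> \<le> 1"
  have "\<zeta> *s ((1 - t) *\<^sub>R a + t *\<^sub>R b) = (1 - t) *\<^sub>R (\<zeta> *s a) + t *\<^sub>R (\<zeta> *s b)"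
    by (simp add: vector_add_ldistrib vector_smult_scaleR)
  then have "Q p (\<zeta> *s ((1 - t) *\<^sub>R a + t *\<^sub>R b)) \<le> (1 - t) * Q p (\<zeta> *s a) + t * Q p (\<zeta> *s b)"
    using Q_convexD[OF assms] by simp
  also have "\<dots> \<le> (1 - t) * psi p a + t * psi p b"
    using psi_upper[OF z] assms by (intro add_mono mult_left_mono) auto
  finally show "Q p (\<zeta> *s ((1 - t) *\<^sub>R a + t *\<^sub>R b)) \<le> (1 - t) * psi p a + t * psi p b" .
qed

lemma psi_growth:
  assumes "T \<ge> 1" shows "psi p (T *\<^sub>R w) \<le> G * psi p w * T ^ m"
proof (rule psi_least)
  fix \<zeta> :: complex assume z: "cmod \<zeta> \<le> 1"
  have "Q p (T *\<^sub>R (\<zeta> *s w)) \<le> G * psi p w * T ^ m"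
  proof (rule Q_growth[OF _ assms])
    fix t :: real assume "t \<in> {0..1}"
    then have "cmod (t *\<^sub>R \<zeta>) \<le> 1" using z by (simp add: mult_le_one)
    from psi_upper[OF this, of p w] show "Q p (t *\<^sub>R (\<zeta> *s w)) \<le> psi p w"
      by (simp add: vector_smult_scaleR)
  qed
  then show "Q p (\<zeta> *s T *\<^sub>R w) \<le> G * psi p w * T ^ m" by (simp add: vector_smult_scaleR)
qed

text \<open>The complex linear functional with imaginary part \<open>DP p\<close>.\<close>

definition ell :: "complex^'d \<Rightarrow> complex^'d \<Rightarrow> complex" where
  "ell p w = Complex (DP p (\<i> *s w)) (DP p w)"

lemma ell_add: "ell p (v + w) = ell p v + ell p w"
  by (simp add: ell_def complex_eq_iff vector_add_ldistrib DP_simps)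

lemma ell_smult: "ell p (\<zeta> *s w) = \<zeta> * ell p w"
proof -
  have 1: "\<zeta> *s w = Re \<zeta> *\<^sub>R w + Im \<zeta> *\<^sub>R (\<i> *s w)"
    by (simp add: vec_eq_iff complex_eq_iff)
  have 2: "\<i> *s (\<zeta> *s w) = Re \<zeta> *\<^sub>R (\<i> *s w) - Im \<zeta> *\<^sub>R w"
    by (simp add: vec_eq_iff complex_eq_iff)
  show ?thesis unfolding ell_def 2 by (simp add: 1 DP_simps complex_eq_iff)
qed

lemma Im_ell [simp]: "Im (ell p w) = DP p w" by (simp add: ell_def)

text \<open>The engulfing property at scale \<open>F\<close>: if \<open>w\<close> is a direction of size \<open>h\<close> at \<open>p + y\<close> and \<open>y\<close> lies
  at scale \<open>F\<close> from \<open>p\<close>, then \<open>T w\<close> with \<open>T^m = F / h\<close> is still of scale \<open>F\<close> seen from \<open>p\<close>.\<close>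

lemma engulf:
  assumes T: "T \<ge> 1" and F: "T ^ m * h \<le> F" and y: "psi p y \<le> F"
    and w: "\<And>\<zeta>. cmod \<zeta> \<le> 1 \<Longrightarrow> Q (p + y) (\<zeta> *s w) \<le> 2 * h"
  shows "cmod (ell (p + y) w - ell p w) \<le> 2 * (1 + 2 * G) * F / T"
    and "0 \<le> \<tau> \<Longrightarrow> 2 * \<tau> \<le> T \<Longrightarrow>
      psi p (y + \<tau> *\<^sub>R w) \<le> psi p y + 2 * (\<tau> / T) * (G * 2 ^ m * (2 + 2 * G) * F)"
proof -
  have h0: "h \<ge> 0" using w[of 0] by simp
  have F0: "F \<ge> 0" using y psi_nonneg[of p y] by linarith
  have big: "Q (p + y) (T *\<^sub>R (\<zeta> *s w)) \<le> 2 * G * F" if z: "cmod \<zeta> \<le> 1" for \<zeta>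
  proof -
    have "Q (p + y) (T *\<^sub>R (\<zeta> *s w)) \<le> G * (2 * h) * T ^ m"
    proof (rule Q_growth[OF _ T])
      fix t :: real assume "t \<in> {0..1}"
      then have "cmod (t *\<^sub>R \<zeta>) \<le> 1" using z by (simp add: mult_le_one)
      from w[OF this] show "Q (p + y) (t *\<^sub>R (\<zeta> *s w)) \<le> 2 * h"
        by (simp add: vector_smult_scaleR)
    qed
    also have "\<dots> = 2 * G * (T ^ m * h)" by simp
    also have "\<dots> \<le> 2 * G * F" using F G1 by (intro mult_left_mono) auto
    finally show ?thesis .
  qed
  have Qy: "Q p y \<le> F" using psi_upper[of 1 p y] y by simp
  \<comment> \<open>The left side of \<open>Q_shift\<close> is nonnegative and its two
    \<open>Q\<close> terms on the right are bounded, so the difference of the derivatives cannot be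
    very negative. Replacing \<zeta> by its negative gives the two-sided bound.\<close>
  have D1: "- (1 + 2 * G) * F \<le> DP (p + y) (T *\<^sub>R (\<zeta> *s w)) - DP p (T *\<^sub>R (\<zeta> *s w))" if z: "cmod \<zeta> \<le> 1" for \<zeta>
    using Q_shift[of p y "T *\<^sub>R (\<zeta> *s w)"] Q_nonneg[of p "y + T *\<^sub>R (\<zeta> *s w)"] big[OF z] Qy
      by (simp add: algebra_simps)
  have D2: "\<bar>DP (p + y) (T *\<^sub>R (\<zeta> *s w)) - DP p (T *\<^sub>R (\<zeta> *s w))\<bar> \<le> (1 + 2 * G) * F" if z: "cmod \<zeta> \<le> 1" for \<zeta>
    using D1[OF z] D1[of "- \<zeta>"] z by (simp add: DP_simps abs_le_iff algebra_simps)
  have "T * cmod (ell (p + y) w - ell p w) = cmod (ell (p + y) (complex_of_real T *s w) - ell p (complex_of_real T *s w))"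
    using T by (simp add: ell_smult right_diff_distrib[symmetric] norm_mult)
  also have "\<dots> \<le> \<bar>DP (p + y) (T *\<^sub>R (\<i> *s w)) - DP p (T *\<^sub>R (\<i> *s w))\<bar> + \<bar>DP (p + y) (T *\<^sub>R (1 *s w)) - DP p (T *\<^sub>R (1 *s w))\<bar>"
    using cmod_le[of "ell (p + y) (complex_of_real T *s w) - ell p (complex_of_real T *s w)"]
    by (simp add: ell_def vector_smult_scaleR)
  also have "\<dots> \<le> (1 + 2 * G) * F + (1 + 2 * G) * F" by (intro add_mono D2) auto
  finally show "cmod (ell (p + y) w - ell p w) \<le> 2 * (1 + 2 * G) * F / T"
    using T by (simp add: field_simps)
  define C where "C = G * 2 ^ m * (2 + 2 * G) * F"
  \<comment> \<open>Half of \<open>T w\<close> is the midpoint of \<open>y + T w\<close> and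
    \<open>- y\<close>, and \<open>psi p y\<close> also controls \<open>Q p\<close> at
    \<open>- y\<close>. The same holds for every rotation of \<open>w\<close>.\<close>
  have half: "psi p ((1/2) *\<^sub>R (T *\<^sub>R w)) \<le> (3/2 + 2 * G) * F"
  proof (rule psi_least)
    fix \<zeta> :: complex assume z: "cmod \<zeta> \<le> 1"
    have "Q p (y + T *\<^sub>R (\<zeta> *s w)) \<le> (2 + 4 * G) * F"
      using Q_shift[of p y "T *\<^sub>R (\<zeta> *s w)"] big[OF z] Qy D2[OF z] by (simp add: algebra_simps)
    moreover have "Q p (- y) \<le> F" using psi_upper[of "-1" p y] y by (simp add: vector_smult_lneg)
    moreover have "Q p ((1 - 1/2) *\<^sub>R (y + T *\<^sub>R (\<zeta> *s w)) + (1/2) *\<^sub>R (- y))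
        \<le> (1 - 1/2) * Q p (y + T *\<^sub>R (\<zeta> *s w)) + (1/2) * Q p (- y)"
      by (rule Q_convexD) auto
    moreover have "(1 - 1/2) *\<^sub>R (y + T *\<^sub>R (\<zeta> *s w)) + (1/2) *\<^sub>R (- y) = \<zeta> *s ((1/2) *\<^sub>R (T *\<^sub>R w))"
      by (simp add: vector_smult_scaleR algebra_simps)
    ultimately show "Q p (\<zeta> *s ((1/2) *\<^sub>R (T *\<^sub>R w))) \<le> (3/2 + 2 * G) * F"
      by (simp add: algebra_simps)
  qed
  \<comment> \<open>\<open>b\<close> is twice the midpoint of \<open>y\<close> and
    \<open>T w / 2\<close>; doubling costs the factor \<open>G * 2 ^ m\<close> of
    \<open>psi_growth\<close>.\<close>
  define b where "b = y + (1/2) *\<^sub>R (T *\<^sub>R w)"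
  have "psi p b \<le> C"
  proof -
    have "psi p ((1 - 1/2) *\<^sub>R y + (1/2) *\<^sub>R ((1/2) *\<^sub>R (T *\<^sub>R w)))
       \<le> (1 - 1/2) * psi p y + (1/2) * psi p ((1/2) *\<^sub>R (T *\<^sub>R w))"
      by (rule psi_convexD) auto
    also have "\<dots> \<le> (1 - 1/2) * F + (1/2) * ((3/2 + 2 * G) * F)"
      by (intro add_mono mult_left_mono half y) auto
    also have "\<dots> \<le> (2 + 2 * G) * F"
    proof -
      have "(1 - 1/2) * F + (1/2) * ((3/2 + 2 * G) * F) = 5/4 * F + G * F" "(2 + 2 * G) * F = 2 * F + 2 * (G * F)"
        by (simp_all add: algebra_simps)
      moreover have "0 \<le> G * F" using F0 G1 by (intro mult_nonneg_nonneg) auto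
      ultimately show ?thesis using F0 by linarith
    qed
    finally have "psi p ((1 - 1/2) *\<^sub>R y + (1/2) *\<^sub>R ((1/2) *\<^sub>R (T *\<^sub>R w))) \<le> (2 + 2 * G) * F" .
    moreover have "b = 2 *\<^sub>R ((1 - 1/2) *\<^sub>R y + (1/2) *\<^sub>R ((1/2) *\<^sub>R (T *\<^sub>R w)))"
      unfolding b_def by (simp add: scaleR_add_right)
    moreover have "psi p (2 *\<^sub>R z) \<le> G * psi p z * 2 ^ m" for z by (rule psi_growth) simp
    ultimately show ?thesis unfolding C_def using G1
      by (smt (verit, best) mult.assoc mult.commute mult_left_mono mult_nonneg_nonneg zero_le_power)
  qed
  assume tau: "0 \<le> \<tau>" "2 * \<tau> \<le> T"
  \<comment> \<open>\<open>y + \<tau> w\<close> divides the segment from \<open>y\<close> to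
    \<open>b = y + T w / 2\<close> in the ratio \<open>s\<close>, so convexity makes the increase
    linear in \<open>\<tau> / T\<close>.\<close>
  define s where "s = 2 * \<tau> / T"
  have s: "0 \<le> s" "s \<le> 1" unfolding s_def using tau T by auto
  have "y + \<tau> *\<^sub>R w = (1 - s) *\<^sub>R y + s *\<^sub>R b"
    unfolding b_def s_def using T by (simp add: algebra_simps)
  then have "psi p (y + \<tau> *\<^sub>R w) \<le> (1 - s) * psi p y + s * psi p b"
    using psi_convexD[OF s] by simp
  also have "\<dots> \<le> psi p y + s * C"
    using mult_right_mono[of "1 - s" 1 "psi p y"] mult_left_mono[OF \<open>psi p b \<le> C\<close> s(1)] s psi_nonneg[of p y]
    by (intro add_mono) auto
  finally show "psi p (y + \<tau> *\<^sub>R w) \<le> psi p y + 2 * (\<tau> / T) * (G * 2 ^ m * (2 + 2 * G) * F)"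
    unfolding s_def C_def by simp
qed

text \<open>Adding the bounds for \<open>Q\<close> at \<open>\<zeta> w\<close> and at its negative
  cancels the derivative. As \<open>\<zeta> w\<close> is the midpoint of
  \<open>p + \<zeta> w\<close> and \<open>-(p - \<zeta> w)\<close>, convexity and evenness then
  bound \<open>P\<close> at \<open>\<zeta> w\<close> itself.\<close>

lemma psi_coercive: "\<exists>B. \<forall>w. psi p w \<le> M \<longrightarrow> norm w \<le> B"
proof -
  obtain B where B: "\<And>v. (\<forall>\<zeta>. cmod \<zeta> \<le> 1 \<longrightarrow> P (\<zeta> *s v) \<le> M + P p) \<Longrightarrow> norm v \<le> B"
    using coercive by blast
  have "norm w \<le> B" if w: "psi p w \<le> M" for w
  proof (rule B, intro allI impI)
    fix \<zeta> :: complex assume z: "cmod \<zeta> \<le> 1"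
    have "Q p (\<zeta> *s w) \<le> M" using psi_upper[OF z] w by (rule order_trans)
    moreover have "Q p (- (\<zeta> *s w)) \<le> M"
      using psi_upper[of "- \<zeta>" p w] z w by (simp add: vector_smult_lneg)
    ultimately have "P (p + \<zeta> *s w) + P (p - \<zeta> *s w) \<le> 2 * M + 2 * P p"
      unfolding Q_def by (simp add: DP_simps)
    moreover have "P ((1 - 1/2) *\<^sub>R (p + \<zeta> *s w) + (1/2) *\<^sub>R (- (p - \<zeta> *s w)))
        \<le> (1 - 1/2) * P (p + \<zeta> *s w) + (1/2) * P (- (p - \<zeta> *s w))"
      by (rule P_convexD) auto
    moreover have "(1 - 1/2) *\<^sub>R (p + \<zeta> *s w) + (1/2) *\<^sub>R (- (p - \<zeta> *s w)) = \<zeta> *s w"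
      by (simp add: algebra_simps scaleR_add_left[symmetric])
    ultimately show "P (\<zeta> *s w) \<le> M + P p" using even[of "p - \<zeta> *s w"] by simp
  qed
  then show ?thesis by blast
qed

end

section \<open>Nonnegative homogeneous convex polynomials satisfy the assumptions of
  \<open>convex_poly\<close>\<close>

lemma differentiable_prod_real:
  fixes f :: "'i \<Rightarrow> 'a::real_normed_vector \<Rightarrow> real"
  assumes "\<And>i. i \<in> I \<Longrightarrow> f i differentiable (at x)"
  shows "(\<lambda>x. \<Prod>i\<in>I. f i x) differentiable (at x)"
  using assms by (induction I rule: infinite_finite_induct) auto

lemma homogeneous_polynomialE:
  assumes "homogeneous_polynomial m P"
  obtains A c where "finite A" "\<And>a b. (a, b) \<in> A \<Longrightarrow> (\<Sum>i\<in>UNIV. a i) + (\<Sum>i\<in>UNIV. b i) = m"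
    "\<And>z. P z = (\<Sum>(a, b)\<in>A. c a b * real_monomial a b z)"
  using assms unfolding homogeneous_polynomial_def
proof (elim exE conjE)
  fix A c
  assume "finite A" "\<forall>(a, b)\<in>A. (\<Sum>i\<in>UNIV. a i) + (\<Sum>i\<in>UNIV. b i) = m"
    "\<forall>z. P z = (\<Sum>(a, b)\<in>A. c a b * real_monomial a b z)"
  then show thesis by (intro that[of A c]) auto
qed

lemma homogeneous_polynomial_differentiable:
  assumes "homogeneous_polynomial m P"
  shows "P differentiable (at x)"
proof -
  obtain A c where A: "finite A" "\<And>z. P z = (\<Sum>(a, b)\<in>A. c a b * real_monomial a b z)"
    by (rule homogeneous_polynomialE[OF assms], rule that)
  have lin: "(\<lambda>z::complex^'a. Re (z $ i)) differentiable (at x)" "(\<lambda>z::complex^'a. Im (z $ i)) differentiable (at x)" for i x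
    by (auto intro!: bounded_linear_imp_differentiable bounded_linear_compose[OF bounded_linear_Re]
        bounded_linear_compose[OF bounded_linear_Im] bounded_linear_vec_nth)
  have "real_monomial a b differentiable (at x)" for a b
    unfolding real_monomial_def[abs_def]
    by (intro differentiable_prod_real differentiable_mult differentiable_power lin)
  then have "(\<lambda>z. \<Sum>i\<in>A. c (fst i) (snd i) * real_monomial (fst i) (snd i) z) differentiable (at x)"
    using A(1) by (intro differentiable_sum differentiable_mult) auto
  moreover have "P = (\<lambda>z. \<Sum>i\<in>A. c (fst i) (snd i) * real_monomial (fst i) (snd i) z)"
    by (rule ext) (simp add: A(2) case_prod_beta)
  ultimately show ?thesis by simp
qed

lemma homogeneous_polynomial_scaleR:
  assumes "homogeneous_polynomial m P"
  shows "P (t *\<^sub>R z) = t ^ m * P z"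
proof -
  obtain A c where A: "\<And>a b. (a, b) \<in> A \<Longrightarrow> (\<Sum>i\<in>UNIV. a i) + (\<Sum>i\<in>UNIV. b i) = m"
    "\<And>z. P z = (\<Sum>(a, b)\<in>A. c a b * real_monomial a b z)"
    by (rule homogeneous_polynomialE[OF assms], rule that)
  have "real_monomial a b (t *\<^sub>R z) = t ^ m * real_monomial a b z" if "(a, b) \<in> A" for a b
  proof -
    have "real_monomial a b (t *\<^sub>R z) = (\<Prod>i\<in>UNIV. (t ^ a i * t ^ b i) * (Re (z $ i) ^ a i * Im (z $ i) ^ b i))"
      unfolding real_monomial_def by (intro prod.cong) (simp_all add: power_mult_distrib)
    also have "\<dots> = (\<Prod>i\<in>UNIV. t ^ a i * t ^ b i) * real_monomial a b z"
      unfolding real_monomial_def by (rule prod.distrib)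
    also have "(\<Prod>i\<in>UNIV. t ^ a i * t ^ b i) = t ^ ((\<Sum>i\<in>UNIV. a i) + (\<Sum>i\<in>UNIV. b i))"
      unfolding prod.distrib power_add power_sum ..
    finally show ?thesis using A(1)[OF that] by simp
  qed
  then show ?thesis unfolding A(2) sum_distrib_left by (intro sum.cong) auto
qed

lemma homogeneous_polynomial_line:
  assumes "homogeneous_polynomial m P"
  shows "\<exists>q. degree q \<le> m \<and> (\<forall>t. P (p + t *\<^sub>R v) = poly q t)"
proof -
  obtain A c where A: "finite A" "\<And>a b. (a, b) \<in> A \<Longrightarrow> (\<Sum>i\<in>UNIV. a i) + (\<Sum>i\<in>UNIV. b i) = m"
    "\<And>z. P z = (\<Sum>(a, b)\<in>A. c a b * real_monomial a b z)"
    by (rule homogeneous_polynomialE[OF assms], rule that)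
  define R where "R a b = (\<Prod>i\<in>UNIV. [:Re (p $ i), Re (v $ i):] ^ a i * [:Im (p $ i), Im (v $ i):] ^ b i)"
    for a b :: "'a \<Rightarrow> nat"
  have "poly (R a b) t = real_monomial a b (p + t *\<^sub>R v)" for a b t
    unfolding R_def real_monomial_def by (simp add: poly_prod)
  then have "P (p + t *\<^sub>R v) = poly (\<Sum>(a, b)\<in>A. smult (c a b) (R a b)) t" for t
    unfolding A(3) by (simp add: poly_sum case_prod_beta)
  moreover have "degree (\<Sum>(a, b)\<in>A. smult (c a b) (R a b)) \<le> m"
  proof (rule degree_sum_le[OF A(1)], clarify)
    fix a b assume ab: "(a, b) \<in> A"
    have lin: "degree ([:x, y:] ^ k) \<le> k" for x y :: real and k
      using degree_power_le[of "[:x, y:]" k] by (rule order_trans) simp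
    have "degree (R a b) \<le> (\<Sum>i\<in>UNIV. degree ([:Re (p $ i), Re (v $ i):] ^ a i * [:Im (p $ i), Im (v $ i):] ^ b i))"
      unfolding R_def by (rule order_trans[OF degree_prod_sum_le]) (auto simp: o_def)
    also have "\<dots> \<le> (\<Sum>i\<in>UNIV. a i + b i)"
      by (intro sum_mono order_trans[OF degree_mult_le] add_mono lin)
    also have "\<dots> = m" using A(2)[OF ab] by (simp add: sum.distrib)
    finally show "degree (smult (c a b) (R a b)) \<le> m" using degree_smult_le order_trans by blast
  qed
  ultimately show ?thesis by blast
qed

text \<open>In odd degree, \<open>P\<close> and its reflection would have opposite signs, so
  nonnegativity forces \<open>P = 0\<close> and evenness holds in any case. In degree 0,
  \<open>P\<close> would be the constant \<open>P 0 = 0\<close>, against nondegeneracy. Coercivity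
  follows by homogeneity from a positive lower bound on the unit sphere.\<close>

lemma convex_poly_homogeneous:
  fixes P :: "complex^'d::finite \<Rightarrow> real"
  assumes h: "homogeneous_polynomial m P" and nn: "\<forall>z. P z \<ge> 0" and nd: "nondegenerate P"
    and conv: "convex_on UNIV P" and P0: "P 0 = 0"
  shows "\<exists>DP. convex_poly P DP m"
proof -
  note hom = homogeneous_polynomial_scaleR[OF h]
  have nline: "\<exists>\<zeta>. P (p + \<zeta> *s v) \<noteq> 0" if "v \<noteq> 0" for p v
    using nd that unfolding nondegenerate_def complex_affine_line_def by (auto simp: subset_iff)
  have m1: "m \<ge> 1"
  proof (rule ccontr)
    assume "\<not> 1 \<le> m"
    then have "P z = 0" for z using hom[of 0 z] P0 by simp
    moreover have "(1::complex^'d) \<noteq> 0" by simp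
    ultimately show False using nline[of 1] by blast
  qed
  have even: "P (- z) = P z" for z
  proof -
    have e: "P (- z) = (-1) ^ m * P z" using hom[of "-1" z] by simp
    show ?thesis
    proof (cases "even m")
      case False
      then show ?thesis using e nn[rule_format, of z] nn[rule_format, of "- z"] by simp
    qed (use e in simp)
  qed
  define DP where "DP p = (SOME D. (P has_derivative D) (at p))" for p
  have der: "(P has_derivative DP p) (at p)" for p
    using homogeneous_polynomial_differentiable[OF h, of p]
      unfolding differentiable_def DP_def by (rule someI_ex)
  have Pc: "continuous_on S P" for S
    by (meson der has_derivative_continuous continuous_at_imp_continuous_on)
  have Pz: "continuous_on S (\<lambda>v. P (\<zeta> *s v))" for S \<zeta>
    by (rule continuous_on_compose2[OF Pc[of UNIV]]) (auto intro!: continuous_intros)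
  have coer: "\<exists>B. \<forall>v. (\<forall>\<zeta>. cmod \<zeta> \<le> 1 \<longrightarrow> P (\<zeta> *s v) \<le> M) \<longrightarrow> norm v \<le> B" for M
  proof -
    have pos: "\<exists>\<zeta>. cmod \<zeta> \<le> 1 \<and> P (\<zeta> *s v) > 0" if v: "v \<noteq> 0" for v
    proof (rule ccontr)
      assume no: "\<nexists>\<zeta>. cmod \<zeta> \<le> 1 \<and> P (\<zeta> *s v) > 0"
      obtain \<zeta> where z: "P (\<zeta> *s v) \<noteq> 0" using nline[OF v, of 0] by auto
      \<comment> \<open>Dividing by \<open>r\<close> moves \<zeta> into the unit disc and multiplies
        \<open>P\<close> by a positive factor only.\<close>
      define r where "r = cmod \<zeta> + 1"
      have r: "r > 0" "cmod \<zeta> \<le> r" unfolding r_def using norm_ge_zero[of \<zeta>] by linarith+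
      have "cmod ((1/r) *\<^sub>R \<zeta>) \<le> 1" using r by simp
      then have "P (((1/r) *\<^sub>R \<zeta>) *s v) = 0" using no nn by (metis less_eq_real_def)
      moreover have "P (((1/r) *\<^sub>R \<zeta>) *s v) = (1/r) ^ m * P (\<zeta> *s v)"
        using hom[of "1/r" "\<zeta> *s v"] by (simp add: vector_smult_scaleR)
      ultimately show False using z r by simp
    qed
    have "\<exists>c>0. \<forall>v\<in>sphere 0 1. \<exists>\<zeta>. cmod \<zeta> \<le> 1 \<and> P (\<zeta> *s v) \<ge> c"
    proof -
      \<comment> \<open>A finite subcover gives one constant for all directions; \<zeta> may still
        depend on the direction.\<close>
      define \<U> where "\<U> = {{v. P (\<zeta> *s v) > c} |\<zeta> c. cmod \<zeta> \<le> 1 \<and> c > 0}"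
      have op: "open B" if "B \<in> \<U>" for B
        using that open_Collect_less[OF continuous_on_const Pz] unfolding \<U>_def by blast
      have cov: "sphere (0::complex^'d) 1 \<subseteq> \<Union> \<U>"
      proof
        fix v :: "complex^'d" assume "v \<in> sphere 0 1"
        then have "v \<noteq> 0" by auto
        then obtain \<zeta> where z: "cmod \<zeta> \<le> 1" "P (\<zeta> *s v) > 0" using pos by blast
        then have "P (\<zeta> *s v) / 2 > 0" by simp
        then have "{w. P (\<zeta> *s w) > P (\<zeta> *s v) / 2} \<in> \<U>"
          unfolding \<U>_def using z(1) by blast
        moreover have "v \<in> {w. P (\<zeta> *s w) > P (\<zeta> *s v) / 2}" using z by simp
        ultimately show "v \<in> \<Union> \<U>" by blast
      qed
      obtain \<T> where T: "\<T> \<subseteq> \<U>" "finite \<T>" "sphere (0::complex^'d) 1 \<subseteq> \<Union> \<T>"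
        using compactE[OF compact_sphere cov op] by blast
      have "\<forall>B\<in>\<T>. \<exists>c. c > 0 \<and> (\<exists>\<zeta>. cmod \<zeta> \<le> 1 \<and> B = {v. P (\<zeta> *s v) > c})"
        using T(1) unfolding \<U>_def by blast
      then obtain c where c: "\<And>B. B \<in> \<T> \<Longrightarrow> c B > 0 \<and> (\<exists>\<zeta>. cmod \<zeta> \<le> 1 \<and> B = {v. P (\<zeta> *s v) > c B})"
        by metis
      define c0 where "c0 = Min (insert 1 (c ` \<T>))"
      have "c0 > 0" unfolding c0_def using T(2) c by (subst Min_gr_iff) auto
      moreover have "\<exists>\<zeta>. cmod \<zeta> \<le> 1 \<and> P (\<zeta> *s v) \<ge> c0" if "v \<in> sphere 0 1" for v
      proof -
        obtain B where B: "B \<in> \<T>" "v \<in> B" using T(3) \<open>v \<in> sphere 0 1\<close> by blast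
        then obtain \<zeta> where "cmod \<zeta> \<le> 1" "P (\<zeta> *s v) > c B" using c by blast
        moreover have "c0 \<le> c B" unfolding c0_def using T(2) B by (intro Min_le) auto
        ultimately show ?thesis by (intro exI[of _ \<zeta>]) auto
      qed
      ultimately show ?thesis by blast
    qed
    then obtain c where c: "c > 0" "\<And>v. norm v = 1 \<Longrightarrow> \<exists>\<zeta>. cmod \<zeta> \<le> 1 \<and> P (\<zeta> *s v) \<ge> c"
      by auto
    have "norm v \<le> max 1 (M / c)" if v: "\<forall>\<zeta>. cmod \<zeta> \<le> 1 \<longrightarrow> P (\<zeta> *s v) \<le> M" for v
    proof (cases "norm v \<le> 1")
      case False
      define w where "w = (1 / norm v) *\<^sub>R v"
      have vw: "v = norm v *\<^sub>R w" unfolding w_def using False by auto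
      have "norm w = 1" unfolding w_def using False by auto
      then obtain \<zeta> where z: "cmod \<zeta> \<le> 1" "P (\<zeta> *s w) \<ge> c" using c(2) by blast
      have "\<zeta> *s v = norm v *\<^sub>R (\<zeta> *s w)" by (subst vw) (simp add: vector_smult_scaleR)
      then have "P (\<zeta> *s v) = norm v ^ m * P (\<zeta> *s w)" using hom by simp
      moreover have "norm v ^ 1 \<le> norm v ^ m" using False m1 by (intro power_increasing) auto
      ultimately have "norm v * c \<le> P (\<zeta> *s v)" using z(2) c(1) by (simp add: mult_mono)
      then have "norm v * c \<le> M" using v z(1) by (meson order_trans)
      then have "norm v \<le> M / c" using c(1) by (simp add: field_simps)
      then show ?thesis by simp
    qed simp
    then show ?thesis by blast
  qed
  have "convex_poly P DP m"
    by unfold_locales (use conv nn der homogeneous_polynomial_line[OF h] m1 even coer in auto)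
  then show ?thesis by blast
qed

section \<open>The Kobayashi distance of a convex domain\<close>

lemma norm_vector_smult: "norm (\<zeta> *s (w :: complex^'n)) = cmod \<zeta> * norm w"
  by (simp add: norm_vec_def norm_mult L2_set_right_distrib)

locale convex_domain =
  fixes \<Omega> :: "(complex^'n::finite) set"
  assumes open_domain: "open \<Omega>" and convex_domain: "convex \<Omega>"
begin

abbreviation "k \<equiv> kobayashi_metric \<Omega>"

definition disc :: "complex^'n \<Rightarrow> complex^'n \<Rightarrow> complex \<Rightarrow> (complex \<Rightarrow> complex^'n) \<Rightarrow> bool" where
  "disc x v \<xi> f \<longleftrightarrow> holomorphic_map f (ball 0 1) \<and> f ` ball 0 1 \<subseteq> \<Omega> \<and> f 0 = x \<and>
                       \<xi> *s (\<chi> i. deriv (\<lambda>z. f z $ i) 0) = v"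

lemma k_altdef: "k x v = Inf {cmod \<xi> |\<xi> f. disc x v \<xi> f}"
  unfolding kobayashi_metric_def disc_def ..

lemma k_bdd: "bdd_below {cmod \<xi> |\<xi> f. disc x v \<xi> f}"
  by (rule bdd_belowI[of _ 0]) auto

lemma k_le: "disc x v \<xi> f \<Longrightarrow> k x v \<le> cmod \<xi>"
  unfolding k_altdef by (rule cInf_lower[OF _ k_bdd]) auto

lemma disc_affine:
  assumes "\<And>\<zeta>. cmod \<zeta> < 1 \<Longrightarrow> x + \<zeta> *s v \<in> \<Omega>"
  shows "disc x (\<xi> *s v) \<xi> (\<lambda>\<zeta>. x + \<zeta> *s v)"
proof -
  have "deriv (\<lambda>z. (x + z *s v) $ i) 0 = v $ i" for i
    by (rule DERIV_imp_deriv) (auto intro!: derivative_eq_intros)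
  then show ?thesis
    using assms unfolding disc_def holomorphic_map_def
    by (auto intro!: holomorphic_intros simp: vec_eq_iff)
qed

lemma k_affine:
  assumes "\<And>\<zeta>. cmod \<zeta> < 1 \<Longrightarrow> x + \<zeta> *s v \<in> \<Omega>"
  shows "k x v \<le> 1"
  using k_le[OF disc_affine[OF assms, of 1]] by simp

lemma disc_ball:
  assumes "ball x r \<subseteq> \<Omega>" "r > 0"
  shows "\<exists>f \<xi>. disc x v \<xi> f \<and> cmod \<xi> = norm v / r"
proof (cases "v = 0")
  case True
  have "x \<in> \<Omega>" using assms by auto
  then show ?thesis
    using True disc_affine[of x 0 0] by (intro exI[of _ "\<lambda>\<zeta>. x + \<zeta> *s 0"] exI[of _ 0]) auto
next
  case False
  define w where "w = (r / norm v) *\<^sub>R v"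
  have nw: "norm w = r" unfolding w_def using False assms(2) by simp
  have in\<Omega>: "x + \<zeta> *s w \<in> \<Omega>" if "cmod \<zeta> < 1" for \<zeta>
  proof -
    have "norm (\<zeta> *s w) < r" unfolding norm_vector_smult nw using that assms(2) by simp
    then have "x + \<zeta> *s w \<in> ball x r" by (simp add: dist_norm)
    then show ?thesis using assms by blast
  qed
  have "complex_of_real (norm v / r) *s w = v"
    unfolding w_def vector_smult_scaleR using False assms(2) by simp
  then show ?thesis using disc_affine[OF in\<Omega>, of "complex_of_real (norm v / r)"] assms(2)
    by (intro exI[of _ "\<lambda>\<zeta>. x + \<zeta> *s w"] exI[of _ "complex_of_real (norm v / r)"]) (simp add: norm_divide)
qed

lemma k_ball: "ball x r \<subseteq> \<Omega> \<Longrightarrow> r > 0 \<Longrightarrow> k x v \<le> norm v / r"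
  using disc_ball[of x r v] k_le by metis

lemma k_nonempty:
  assumes "x \<in> \<Omega>" shows "{cmod \<xi> |\<xi> f. disc x v \<xi> f} \<noteq> {}"
proof -
  obtain r where "r > 0" "ball x r \<subseteq> \<Omega>" using open_domain assms open_contains_ball by blast
  then show ?thesis using disc_ball[of x r v] by auto
qed

lemma k_nonneg: "x \<in> \<Omega> \<Longrightarrow> k x v \<ge> 0"
  unfolding k_altdef by (rule cInf_greatest[OF k_nonempty]) auto

lemma k_lessD: "x \<in> \<Omega> \<Longrightarrow> k x v < c \<Longrightarrow> \<exists>\<xi> f. disc x v \<xi> f \<and> cmod \<xi> < c"
  unfolding k_altdef using cInf_lessD[OF k_nonempty, of x v c] by auto

lemma k_smult: assumes "x \<in> \<Omega>" shows "k x (c *s v) \<le> cmod c * k x v"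
proof (cases "c = 0")
  case True
  obtain r where "r > 0" "ball x r \<subseteq> \<Omega>" using open_domain assms open_contains_ball by blast
  then show ?thesis using True k_ball[of x r 0] by simp
next
  case False
  have "k x (c *s v) / cmod c \<le> cmod \<xi>" if "disc x v \<xi> f" for \<xi> f
  proof -
    have "disc x (c *s v) (c * \<xi>) f" using that unfolding disc_def by (metis vector_smult_assoc)
    from k_le[OF this] show ?thesis using False by (simp add: norm_mult field_simps)
  qed
  then have "k x (c *s v) / cmod c \<le> k x v"
    unfolding k_altdef[of x v] by (intro cInf_greatest[OF k_nonempty[OF assms]]) auto
  then show ?thesis using False by (simp add: field_simps)
qed

lemma k_minus: assumes "x \<in> \<Omega>" shows "k x (- v) = k x v"
  using k_smult[OF assms, of "-1" v] k_smult[OF assms, of "-1" "- v"] by (simp add: vector_smult_lneg)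

lemma k_scaleR: assumes "x \<in> \<Omega>" "c \<ge> 0" shows "k x (c *\<^sub>R v) \<le> c * k x v"
  using k_smult[OF assms(1), of "complex_of_real c" v] assms(2) by (simp add: vector_smult_scaleR)

text \<open>Upper semicontinuity: shrink the disc to get room, then move its centre and derivative.\<close>

lemma k_usc:
  assumes x: "x \<in> \<Omega>" and kc: "k x v < c"
  shows "\<exists>e>0. \<forall>x' v'. dist x' x < e \<longrightarrow> dist v' v < e \<longrightarrow> x' \<in> \<Omega> \<and> k x' v' < c"
proof -
  \<comment> \<open>The correction of the derivative below divides by \<open>\<xi>\<close>. If
    \<open>\<xi>\<close> is 0 then \<open>v\<close> is 0, and the constant disc with a small
    positive \<open>\<xi>\<close> serves instead.\<close>
  obtain \<xi> f where f: "disc x v \<xi> f" "cmod \<xi> < c" "\<xi> \<noteq> 0"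
  proof -
    obtain \<xi> f where f: "disc x v \<xi> f" "cmod \<xi> < c" using k_lessD[OF x kc] by blast
    show thesis
    proof (cases "\<xi> = 0")
      case True
      then have v: "v = 0" using f(1) unfolding disc_def by simp
      have c: "c > 0" using f(2) True by simp
      have "disc x ((c/2) *s 0) (complex_of_real (c/2)) (\<lambda>\<zeta>. x + \<zeta> *s 0)"
        by (rule disc_affine) (use x in simp)
      then show thesis using that[of "complex_of_real (c/2)" "\<lambda>\<zeta>. x + \<zeta> *s 0"] v c by simp
    qed (use that f in blast)
  qed
  \<comment> \<open>The slack between \<open>cmod \<xi>\<close> and \<open>c\<close> pays for
    restricting the disc to radius \<open>r\<close>, where its image is compact in the
    domain.\<close>
  obtain r where r: "0 < r" "r < 1" "cmod \<xi> / r < c"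
  proof -
    have "cmod \<xi> / c < 1" "0 < c" using f(2) norm_ge_zero[of \<xi>] by (auto simp del: norm_ge_zero) 
    then obtain r where "cmod \<xi> / c < r" "r < 1" using dense by blast
    moreover have "0 \<le> cmod \<xi> / c" using \<open>0 < c\<close> by simp
    ultimately have "0 < r" "r < 1" "cmod \<xi> / c < r" by linarith+
    then show thesis using that[of r] \<open>0 < c\<close> by (simp add: field_simps)
  qed
  have hol: "(\<lambda>z. f z $ i) holomorphic_on ball 0 1" for i
    using f(1) unfolding disc_def holomorphic_map_def by blast
  have fcont: "continuous_on (ball 0 1) f"
    using continuous_on_vec_lambda[of "ball 0 1" "\<lambda>i z. f z $ i"] holomorphic_on_imp_continuous_on[OF hol]
      by simp
  have "cball 0 r \<subseteq> (ball 0 1 :: complex set)" using r by auto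
  then have "compact (f ` cball 0 r)"
    by (intro compact_continuous_image continuous_on_subset[OF fcont]) auto
  moreover have "f ` cball 0 r \<subseteq> \<Omega>"
    using f(1) \<open>cball 0 r \<subseteq> ball 0 1\<close> unfolding disc_def by blast
  ultimately obtain \<eta> where \<eta>: "\<eta> > 0" "(\<Union>y\<in>f ` cball 0 r. ball y \<eta>) \<subseteq> \<Omega>"
    using compact_subset_open_imp_ball_epsilon_subset[of "f ` cball 0 r" \<Omega>] open_domain by blast
  define e where "e = min (\<eta> / 2) (\<eta> / 2 * cmod \<xi>)"
  have e: "e > 0" "e \<le> \<eta> / 2" "e \<le> \<eta> / 2 * cmod \<xi>"
    unfolding e_def using \<eta> f(3) by auto
  have "x' \<in> \<Omega> \<and> k x' v' < c" if x': "dist x' x < e" and v': "dist v' v < e" for x' v'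
  proof -
    \<comment> \<open>\<open>g\<close> has derivative \<open>r\<close> times that of
      \<open>f\<close> plus \<open>w\<close> at 0; multiplied by \<open>\<xi> / r\<close> this is
      \<open>v + (v' - v)\<close>.\<close>
    define w where "w = (of_real r / \<xi>) *s (v' - v)"
    have "norm w = r / cmod \<xi> * norm (v' - v)"
      unfolding w_def norm_vector_smult using r by (simp add: norm_divide)
    also have "\<dots> \<le> 1 / cmod \<xi> * (\<eta> / 2 * cmod \<xi>)"
      using r v' e(3) f(3) by (intro mult_mono divide_right_mono) (auto simp: dist_norm)
    finally have nw: "norm w \<le> \<eta> / 2" using f(3) by simp
    define g where "g \<zeta> = f (of_real r * \<zeta>) + (x' - x) + \<zeta> *s w" for \<zeta>
    have g\<Omega>: "g \<zeta> \<in> \<Omega>" if z: "cmod \<zeta> < 1" for \<zeta>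
    proof -
      have "cmod (of_real r * \<zeta>) \<le> r * 1" unfolding norm_mult using r z by (intro mult_mono) auto
      then have "f (of_real r * \<zeta>) \<in> f ` cball 0 r" by auto
      moreover have "norm (\<zeta> *s w) \<le> 1 * (\<eta> / 2)"
        unfolding norm_vector_smult using z nw by (intro mult_mono) auto
      then have "norm ((x' - x) + \<zeta> *s w) < \<eta>"
        using norm_triangle_ineq[of "x' - x" "\<zeta> *s w"] x' e(2) by (simp add: dist_norm)
      then have "g \<zeta> \<in> ball (f (of_real r * \<zeta>)) \<eta>"
        unfolding g_def mem_ball dist_norm
          by (metis (no_types, lifting) add.assoc add_diff_cancel_left' norm_minus_commute)
      ultimately show ?thesis using \<eta>(2) by blast
    qed
    have dg: "deriv (\<lambda>z. g z $ i) 0 = of_real r * deriv (\<lambda>z. f z $ i) 0 + w $ i" for i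
    proof (rule DERIV_imp_deriv)
      have "((\<lambda>z. f z $ i) has_field_derivative deriv (\<lambda>z. f z $ i) 0) (at (of_real r * 0))"
        using holomorphic_derivI[OF hol[of i], of 0] by simp
      then have "((\<lambda>z. f (of_real r * z) $ i) has_field_derivative deriv (\<lambda>z. f z $ i) 0 * of_real r) (at 0)"
        by (rule DERIV_chain2) (auto intro!: derivative_eq_intros)
      then show "((\<lambda>z. g z $ i) has_field_derivative of_real r * deriv (\<lambda>z. f z $ i) 0 + w $ i) (at 0)"
        unfolding g_def by (auto intro!: derivative_eq_intros)
    qed
    have "disc x' v' (\<xi> / of_real r) g"
      unfolding disc_def
    proof (intro conjI)
      show "holomorphic_map g (ball 0 1)"
        unfolding holomorphic_map_def
      proof
        fix i
        have rz: "r * cmod z < 1" if "cmod z < 1" for z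
          using mult_left_le_one_le[of "cmod z" r] r that by simp
        have "((\<lambda>z. f z $ i) \<circ> (\<lambda>z. of_real r * z)) holomorphic_on ball 0 1"
          by (rule holomorphic_on_compose_gen[OF _ hol[of i]])
            (use r rz in \<open>auto intro!: holomorphic_intros simp: norm_mult\<close>)
        then show "(\<lambda>z. g z $ i) holomorphic_on ball 0 1"
          unfolding g_def o_def by (auto intro!: holomorphic_intros)
      qed
      show "g ` ball 0 1 \<subseteq> \<Omega>" using g\<Omega> by auto
      show "g 0 = x'" using f(1) unfolding g_def disc_def by simp
      have "\<xi> *s (\<chi> i. deriv (\<lambda>z. f z $ i) 0) = v" using f(1) unfolding disc_def by blast
      then have vi: "\<xi> * deriv (\<lambda>z. f z $ i) 0 = v $ i" for i by (auto simp: vec_eq_iff)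
      show "(\<xi> / of_real r) *s (\<chi> i. deriv (\<lambda>z. g z $ i) 0) = v'"
        unfolding dg using r f(3) by (simp add: vec_eq_iff w_def vi[symmetric] field_simps)
    qed
    from k_le[OF this] have "k x' v' \<le> cmod \<xi> / r" using r by (simp add: norm_divide)
    moreover have "x' \<in> \<Omega>" using g\<Omega>[of 0] f(1) unfolding g_def disc_def by simp
    ultimately show ?thesis using r by auto
  qed
  then show ?thesis using e(1) by blast
qed

text \<open>By upper semicontinuity the strict sublevel sets are open in the product of the domain
  and the space of vectors. The extension by 0 adds only the closed set over the complement of the
  domain.\<close>

lemma k_measurable:
  assumes "\<sigma> \<in> borel_measurable M" "w \<in> borel_measurable M"
  shows "(\<lambda>t. if \<sigma> t \<in> \<Omega> then k (\<sigma> t) (w t) else 0) \<in> borel_measurable M"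
proof -
  define \<kappa> where "\<kappa> = (\<lambda>(x, v). if x \<in> \<Omega> then k x v else 0)"
  have "\<kappa> \<in> borel_measurable borel"
  proof (rule borel_measurableI_less)
    fix c :: real
    define U where "U = {(x, v). x \<in> \<Omega> \<and> k x v < c}"
    have "open U" unfolding open_dist
    proof
      fix xv assume "xv \<in> U"
      then obtain x v where xv: "xv = (x, v)" "x \<in> \<Omega>" "k x v < c" unfolding U_def by auto
      obtain e where e: "e > 0" "\<And>x' v'. dist x' x < e \<Longrightarrow> dist v' v < e \<Longrightarrow> x' \<in> \<Omega> \<and> k x' v' < c"
        using k_usc[OF xv(2,3)] by blast
      have "y \<in> U" if "dist y xv < e" for y
        using e(2)[of "fst y" "snd y"] that dist_fst_le[of y xv] dist_snd_le[of y xv] unfolding xv(1) U_def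
        by (cases y) auto
      then show "\<exists>e>0. \<forall>y. dist y xv < e \<longrightarrow> y \<in> U" using e(1) by blast
    qed
    then have "U \<in> sets borel" by simp
    moreover have "{xv. fst xv \<notin> \<Omega>} \<in> sets (borel :: ((complex^'n) \<times> (complex^'n)) measure)"
    proof -
      have "closed {xv :: (complex^'n) \<times> (complex^'n). fst xv \<in> - \<Omega>}"
        using continuous_closed_vimage[of "- \<Omega>" fst] open_domain
          by (auto simp: vimage_def intro: continuous_intros)
      then show ?thesis by simp
    qed
    moreover have "{xv \<in> space borel. \<kappa> xv < c} = U \<union> (if 0 < c then {xv. fst xv \<notin> \<Omega>} else {})"
      unfolding \<kappa>_def U_def by (auto split: if_splits)
    ultimately show "{xv \<in> space borel. \<kappa> xv < c} \<in> sets borel" by auto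
  qed
  moreover have "(\<lambda>t. (\<sigma> t, w t)) \<in> borel_measurable M"
    using assms by (rule borel_measurable_Pair)
  ultimately have "(\<lambda>t. \<kappa> (\<sigma> t, w t)) \<in> borel_measurable M"
    by (rule measurable_compose[rotated])
  then show ?thesis unfolding \<kappa>_def by simp
qed

section \<open>Lengths of absolutely continuous curves\<close>

definition admissible :: "real \<Rightarrow> real \<Rightarrow> (real \<Rightarrow> complex^'n) \<Rightarrow> bool" where
  "admissible a b \<sigma> \<longleftrightarrow> a \<le> b \<and> absolutely_continuous_curve a b \<sigma> \<and> \<sigma> ` {a..b} \<subseteq> \<Omega>"

abbreviation "len \<equiv> kobayashi_length \<Omega>"

text \<open>The integrand in \<open>kobayashi_length\<close> uses the derivative within the given
  interval. One Borel density \<open>g\<close> serves all subintervals at once, so additivity and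
  reversal of length become statements about integrals of \<open>g\<close>.\<close>

lemma length_density:
  assumes adm: "admissible a b \<sigma>"
  obtains g N w where "g \<in> borel_measurable borel" "negligible N"
    "\<And>t. t \<in> {a..b} - N \<Longrightarrow> (\<sigma> has_vector_derivative w t) (at t)"
    "\<And>t. t \<in> {a..b} - N \<Longrightarrow> g t = ennreal (k (\<sigma> t) (w t))"
    "\<And>c d. a \<le> c \<Longrightarrow> c \<le> d \<Longrightarrow> d \<le> b \<Longrightarrow> len c d \<sigma> = (\<integral>\<^sup>+t\<in>{c..d}. g t \<partial>lborel)"
proof -
  have ab: "a \<le> b" and ac: "absolutely_continuous_curve a b \<sigma>" and \<Omega>: "\<And>t. t \<in> {a..b} \<Longrightarrow> \<sigma> t \<in> \<Omega>"
    using adm unfolding admissible_def by auto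
  obtain w N where w: "w \<in> borel_measurable lebesgue" "negligible N"
    "\<And>t. t \<in> {a..b} - N \<Longrightarrow> (\<sigma> has_vector_derivative w t) (at t)"
    by (rule absolutely_continuous_measurable_derivative[OF ac ab], rule that)
  \<comment> \<open>The curve is continuous only on its interval, so it is extended by 0 to be
    measurable on the whole line.\<close>
  have "(\<lambda>t. indicator {a..b} t *\<^sub>R \<sigma> t) \<in> borel_measurable borel"
    by (rule borel_measurable_continuous_on_indicator) (use absolutely_continuous_curve_continuous[OF ac] in auto)
  then have "(\<lambda>t. indicator {a..b} t *\<^sub>R \<sigma> t) \<in> borel_measurable lebesgue"
    using measurable_completion[of _ lborel] by simp
  from k_measurable[OF this w(1)]
  have "(\<lambda>t. ennreal (if indicator {a..b} t *\<^sub>R \<sigma> t \<in> \<Omega> then k (indicator {a..b} t *\<^sub>R \<sigma> t) (w t) else 0)) \<in> borel_measurable lebesgue"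
    by measurable
  from completion_ex_borel_measurable[OF this] obtain g where g: "g \<in> borel_measurable lborel"
    "AE t in lborel. ennreal (if indicator {a..b} t *\<^sub>R \<sigma> t \<in> \<Omega> then k (indicator {a..b} t *\<^sub>R \<sigma> t) (w t) else 0) = g t"
    by blast
  then obtain N1 where N1: "N1 \<in> null_sets lborel"
    "\<And>t. t \<notin> N1 \<Longrightarrow> ennreal (if indicator {a..b} t *\<^sub>R \<sigma> t \<in> \<Omega> then k (indicator {a..b} t *\<^sub>R \<sigma> t) (w t) else 0) = g t"
    by (auto elim!: AE_E3)
  define N2 where "N2 = N \<union> N1"
  have N2: "negligible N2" unfolding N2_def
    using w(2) N1(1) by (intro negligible_Un) (auto simp: negligible_iff_null_sets null_sets_completionI)
  have gk: "g t = ennreal (k (\<sigma> t) (w t))" if "t \<in> {a..b} - N2" for t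
    using N1(2)[of t] \<Omega>[of t] that unfolding N2_def by auto
  have "len c d \<sigma> = (\<integral>\<^sup>+t\<in>{c..d}. g t \<partial>lborel)" if cd: "a \<le> c" "c \<le> d" "d \<le> b" for c d
  proof -
    have "len c d \<sigma> = (\<integral>\<^sup>+t\<in>{c..d}. g t \<partial>lebesgue)"
      unfolding kobayashi_length_def
    proof (rule nn_integral_cong_AE)
      \<comment> \<open>Excluding the end points leaves \<open>c < t < d\<close>, so the derivative
        within \<open>{c..d}\<close> is determined; this also covers \<open>c = d\<close>.\<close>
      have "negligible (N2 \<union> {c, d})" using N2 by (intro negligible_Un) auto
      then have "AE t in lebesgue. t \<notin> N2 \<union> {c, d}"
        by (simp only: negligible_iff_null_sets AE_not_in)
      then show "AE t in lebesgue. ennreal (k (\<sigma> t) (vector_derivative \<sigma> (at t within {c..d}))) * indicator {c..d} t = g t * indicator {c..d} t"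
      proof (rule AE_mp, intro AE_I2 impI)
        fix t assume t: "t \<notin> N2 \<union> {c, d}"
        show "ennreal (k (\<sigma> t) (vector_derivative \<sigma> (at t within {c..d}))) * indicator {c..d} t = g t * indicator {c..d} t"
        proof (cases "t \<in> {c..d}")
          case True
          then have td: "t \<in> {a..b} - N2" "c < t" "t < d" using t cd by auto
          have "vector_derivative \<sigma> (at t within {c..d}) = w t"
            by (rule vector_derivative_at_within_ivl) (use w(3)[of t] td in \<open>auto simp: N2_def\<close>)
          then show ?thesis using gk[OF td(1)] by simp
        qed simp
      qed
    qed
    then show ?thesis by (simp add: nn_integral_completion)
  qed
  then show thesis using that[of g N2 w] g(1) N2 gk w(3) unfolding N2_def by auto
qed

lemma admissible_subinterval: "admissible a b \<sigma> \<Longrightarrow> a \<le> c \<Longrightarrow> c \<le> d \<Longrightarrow> d \<le> b \<Longrightarrow> admissible c d \<sigma>"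
  unfolding admissible_def using absolutely_continuous_curve_subinterval by fastforce

lemma length_split:
  assumes adm: "admissible a b \<sigma>" and c: "a \<le> c" "c \<le> b"
  shows "len a b \<sigma> = len a c \<sigma> + len c b \<sigma>"
proof -
  obtain g N w where g: "g \<in> borel_measurable borel"
    "\<And>c d. a \<le> c \<Longrightarrow> c \<le> d \<Longrightarrow> d \<le> b \<Longrightarrow> len c d \<sigma> = (\<integral>\<^sup>+t\<in>{c..d}. g t \<partial>lborel)"
    by (rule length_density[OF adm], rule that)
  have "(\<integral>\<^sup>+t\<in>{a..b}. g t \<partial>lborel) = (\<integral>\<^sup>+t. g t * indicator {a..c} t + g t * indicator {c..b} t \<partial>lborel)"
  proof (rule nn_integral_cong_AE)
    show "AE t in lborel. g t * indicator {a..b} t = g t * indicator {a..c} t + g t * indicator {c..b} t"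
      using AE_lborel_singleton[of c] by eventually_elim (use c in \<open>auto simp: indicator_def\<close>)
  qed
  also have "\<dots> = (\<integral>\<^sup>+t\<in>{a..c}. g t \<partial>lborel) + (\<integral>\<^sup>+t\<in>{c..b}. g t \<partial>lborel)"
    using g(1) by (intro nn_integral_add) auto
  finally show ?thesis using g(2) c by simp
qed

lemma length_reverse:
  assumes adm: "admissible a b \<sigma>"
  shows "admissible (r - b) (r - a) (\<lambda>t. \<sigma> (r - t))" "len (r - b) (r - a) (\<lambda>t. \<sigma> (r - t)) = len a b \<sigma>"
proof -
  have ab: "a \<le> b" and \<Omega>: "\<And>t. t \<in> {a..b} \<Longrightarrow> \<sigma> t \<in> \<Omega>"
    using adm unfolding admissible_def by auto
  show adm': "admissible (r - b) (r - a) (\<lambda>t. \<sigma> (r - t))"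
    using adm absolutely_continuous_curve_reverse[of a b \<sigma> r] unfolding admissible_def by auto
  obtain g N w where g: "g \<in> borel_measurable borel" "negligible N"
    "\<And>t. t \<in> {a..b} - N \<Longrightarrow> (\<sigma> has_vector_derivative w t) (at t)"
    "\<And>t. t \<in> {a..b} - N \<Longrightarrow> g t = ennreal (k (\<sigma> t) (w t))"
    "\<And>c d. a \<le> c \<Longrightarrow> c \<le> d \<Longrightarrow> d \<le> b \<Longrightarrow> len c d \<sigma> = (\<integral>\<^sup>+t\<in>{c..d}. g t \<partial>lborel)"
    by (rule length_density[OF adm], rule that)
  have "len (r - b) (r - a) (\<lambda>t. \<sigma> (r - t)) = (\<integral>\<^sup>+t\<in>{r - b..r - a}. g (r - t) \<partial>lebesgue)"
    unfolding kobayashi_length_def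
  proof (rule nn_integral_cong_AE)
    have "negligible ((\<lambda>x. r - x) ` N)"
    proof (rule negligible_locally_Lipschitz_image[OF order_refl g(2)])
      fix x assume "x \<in> N"
      show "\<exists>T B. open T \<and> x \<in> T \<and> (\<forall>y\<in>N \<inter> T. norm (r - y - (r - x)) \<le> B * norm (y - x))"
        by (intro exI[of _ UNIV] exI[of _ 1]) auto
    qed
    then have "negligible ((\<lambda>x. r - x) ` N \<union> {r - b, r - a})" by (intro negligible_Un) auto
    then have "AE t in lebesgue. t \<notin> (\<lambda>x. r - x) ` N \<union> {r - b, r - a}"
      by (simp only: negligible_iff_null_sets AE_not_in)
    then show "AE t in lebesgue. ennreal (k (\<sigma> (r - t)) (vector_derivative (\<lambda>t. \<sigma> (r - t)) (at t within {r - b..r - a}))) * indicator {r - b..r - a} t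
        = g (r - t) * indicator {r - b..r - a} t"
    proof (rule AE_mp, intro AE_I2 impI)
      fix t assume t: "t \<notin> (\<lambda>x. r - x) ` N \<union> {r - b, r - a}"
      show "ennreal (k (\<sigma> (r - t)) (vector_derivative (\<lambda>t. \<sigma> (r - t)) (at t within {r - b..r - a}))) * indicator {r - b..r - a} t
        = g (r - t) * indicator {r - b..r - a} t"
      proof (cases "t \<in> {r - b..r - a}")
        case True
        have "r - t \<notin> N"
        proof
          assume "r - t \<in> N"
          then have "t \<in> (\<lambda>x. r - x) ` N" by (intro image_eqI[of _ _ "r - t"]) auto
          then show False using t by blast
        qed
        then have rt: "r - t \<in> {a..b} - N" using True by auto
        have "((\<sigma> \<circ> (\<lambda>t. r - t)) has_vector_derivative (-1) *\<^sub>R w (r - t)) (at t)"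
        proof (rule vector_diff_chain_at)
          show "((\<lambda>t. r - t) has_vector_derivative -1) (at t)" by (auto intro!: derivative_eq_intros)
          show "(\<sigma> has_vector_derivative w (r - t)) (at (r - t))" by (rule g(3)[OF rt])
        qed
        then have "vector_derivative (\<lambda>t. \<sigma> (r - t)) (at t within {r - b..r - a}) = - w (r - t)"
          by (intro vector_derivative_at_within_ivl) (use True t in \<open>auto simp: o_def\<close>)
        then show ?thesis using g(4)[OF rt] k_minus[OF \<Omega>] rt by simp
      qed simp
    qed
  qed
  also have "\<dots> = (\<integral>\<^sup>+t\<in>{r - b..r - a}. g (r - t) \<partial>lborel)"
    by (rule nn_integral_completion)
  also have "\<dots> = (\<integral>\<^sup>+t. (\<lambda>s. g s * indicator {a..b} s) (r + (-1) * t) \<partial>lborel)"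
    by (rule nn_integral_cong) (auto simp: indicator_def)
  also have "\<dots> = (\<integral>\<^sup>+t\<in>{a..b}. g t \<partial>lborel)"
    using nn_integral_real_affine[of "\<lambda>s. g s * indicator {a..b} s" "-1" r] g(1) by simp
  also have "\<dots> = len a b \<sigma>" using g(5) ab by simp
  finally show "len (r - b) (r - a) (\<lambda>t. \<sigma> (r - t)) = len a b \<sigma>" .
qed

lemma admissible_concat: "admissible a b \<sigma> \<Longrightarrow> admissible b c \<sigma> \<Longrightarrow> admissible a c \<sigma>"
  unfolding admissible_def using absolutely_continuous_curve_concat[of a b \<sigma> c]
  by (auto simp: ivl_disj_un_two_touch(4)[of a b c, symmetric] image_Un)

lemma length_cong:
  assumes "\<And>t. t \<in> {a..b} \<Longrightarrow> \<sigma> t = \<tau> t"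
  shows "admissible a b \<sigma> = admissible a b \<tau>" "len a b \<sigma> = len a b \<tau>"
proof -
  have "(\<Sum>(s, t)\<in>D. dist (\<sigma> s) (\<sigma> t)) = (\<Sum>(s, t)\<in>D. dist (\<tau> s) (\<tau> t))" if "variation_family a b D" for D
    using that assms by (intro sum.cong) (auto simp: variation_family_def)
  then have "absolutely_continuous_curve a b \<sigma> = absolutely_continuous_curve a b \<tau>"
    unfolding absolutely_continuous_curve_altdef by simp
  moreover have "\<sigma> ` {a..b} = \<tau> ` {a..b}" by (rule image_cong) (use assms in auto)
  ultimately show "admissible a b \<sigma> = admissible a b \<tau>"
    unfolding admissible_def by simp
  have "vector_derivative \<sigma> (at t within {a..b}) = vector_derivative \<tau> (at t within {a..b})" if "t \<in> {a..b}" for t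
  proof -
    have "(\<sigma> has_vector_derivative D) (at t within {a..b}) \<longleftrightarrow> (\<tau> has_vector_derivative D) (at t within {a..b})" for D
      using assms that by (intro has_vector_derivative_cong_ev) (auto intro: always_eventually)
    then show ?thesis unfolding vector_derivative_def by simp
  qed
  then show "len a b \<sigma> = len a b \<tau>"
    unfolding kobayashi_length_def using assms by (intro nn_integral_cong) (auto simp: indicator_def)
qed

section \<open>The distance as an infimum of lengths\<close>

abbreviation "K \<equiv> kobayashi_dist \<Omega>"

definition lengths :: "complex^'n \<Rightarrow> complex^'n \<Rightarrow> ennreal set" where
  "lengths x y = {len a b \<sigma> |a b \<sigma>. admissible a b \<sigma> \<and> \<sigma> a = x \<and> \<sigma> b = y}"

lemma K_altdef: "K x y = enn2real (Inf (lengths x y))"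
  unfolding kobayashi_dist_def lengths_def admissible_def by (simp add: conj_assoc)

lemma K_le_length: "admissible a b \<sigma> \<Longrightarrow> ennreal (K (\<sigma> a) (\<sigma> b)) \<le> len a b \<sigma>"
proof -
  assume "admissible a b \<sigma>"
  then have "Inf (lengths (\<sigma> a) (\<sigma> b)) \<le> len a b \<sigma>"
    unfolding lengths_def by (intro Inf_lower) blast
  \<comment> \<open>This also holds for an infinite infimum, which \<open>enn2real\<close> sends to
    0.\<close>
  moreover have "ennreal (enn2real I) \<le> I" for I by (cases I) auto
  ultimately show ?thesis unfolding K_altdef by (rule order_trans[rotated])
qed

lemma length_bound:
  assumes adm: "admissible a b \<sigma>" and M: "M \<ge> 0"
    and der: "\<And>t. t \<in> {a<..<b} \<Longrightarrow> (\<sigma> has_vector_derivative \<sigma>' t) (at t)"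
    and kM: "\<And>t. t \<in> {a<..<b} \<Longrightarrow> k (\<sigma> t) (\<sigma>' t) \<le> M"
  shows "len a b \<sigma> \<le> ennreal (M * (b - a))"
proof -
  have ab: "a \<le> b" using adm unfolding admissible_def by auto
  have "len a b \<sigma> \<le> (\<integral>\<^sup>+t\<in>{a..b}. ennreal M \<partial>lebesgue)"
    unfolding kobayashi_length_def
  proof (rule nn_integral_mono_AE)
    have "AE t in lebesgue. t \<notin> {a, b}"
      by (rule AE_not_in) (simp add: negligible_iff_null_sets[symmetric])
    then show "AE t in lebesgue. ennreal (k (\<sigma> t) (vector_derivative \<sigma> (at t within {a..b}))) * indicator {a..b} t \<le> ennreal M * indicator {a..b} t"
    proof (rule AE_mp, intro AE_I2 impI)
      fix t assume t: "t \<notin> {a, b}"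
      show "ennreal (k (\<sigma> t) (vector_derivative \<sigma> (at t within {a..b}))) * indicator {a..b} t \<le> ennreal M * indicator {a..b} t"
      proof (cases "t \<in> {a..b}")
        case True
        then have ti: "t \<in> {a<..<b}" using t by auto
        then have "vector_derivative \<sigma> (at t within {a..b}) = \<sigma>' t"
          by (intro vector_derivative_at_within_ivl der) auto
        then show ?thesis using kM[OF ti] by (simp add: ennreal_leI indicator_def)
      qed simp
    qed
  qed
  also have "\<dots> = ennreal (M * (b - a))"
    using ab M by (simp add: nn_integral_cmult_indicator ennreal_mult)
  finally show ?thesis .
qed

lemma K_curve_bound:
  assumes "admissible a b \<sigma>" "M \<ge> 0"
    "\<And>t. t \<in> {a<..<b} \<Longrightarrow> (\<sigma> has_vector_derivative \<sigma>' t) (at t)"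
    "\<And>t. t \<in> {a<..<b} \<Longrightarrow> k (\<sigma> t) (\<sigma>' t) \<le> M"
  shows "K (\<sigma> a) (\<sigma> b) \<le> M * (b - a)"
proof -
  have "ennreal (K (\<sigma> a) (\<sigma> b)) \<le> ennreal (M * (b - a))"
    using K_le_length[OF assms(1)] length_bound[OF assms] by (rule order_trans)
  moreover have "0 \<le> M * (b - a)" using assms(1,2) unfolding admissible_def by simp
  ultimately show ?thesis by (simp add: ennreal_le_iff)
qed

lemma admissible_segment:
  assumes "\<And>s. s \<in> {0..1} \<Longrightarrow> x + s *\<^sub>R v \<in> \<Omega>"
  shows "admissible 0 1 (\<lambda>s. x + s *\<^sub>R v)"
  unfolding admissible_def
proof (intro conjI)
  show "absolutely_continuous_curve 0 1 (\<lambda>s. x + s *\<^sub>R v)"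
    by (rule lipschitz_imp_absolutely_continuous_curve[of _ _ _ "norm v"])
      (simp add: dist_norm scaleR_left_diff_distrib[symmetric] mult.commute)
qed (use assms in auto)

lemma segment_has_vector_derivative: "((\<lambda>s. x + s *\<^sub>R v) has_vector_derivative v) (at t)"
  by (auto intro!: derivative_eq_intros)

lemma K_segment_le:
  assumes "\<And>s. s \<in> {0..1} \<Longrightarrow> x + s *\<^sub>R v \<in> \<Omega>" "M \<ge> 0" "\<And>s. s \<in> {0..1} \<Longrightarrow> k (x + s *\<^sub>R v) v \<le> M"
  shows "K x (x + v) \<le> M"
  using K_curve_bound[OF admissible_segment[OF assms(1)] assms(2) segment_has_vector_derivative] assms(3)
    by auto

lemma segment_in_domain: "x \<in> \<Omega> \<Longrightarrow> y \<in> \<Omega> \<Longrightarrow> s \<in> {0..1} \<Longrightarrow> x + s *\<^sub>R (y - x) \<in> \<Omega>"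
  using convex_domain convexD_alt[of \<Omega> x y s] by (simp add: algebra_simps)

text \<open>The segment stays a fixed distance away from the complement, so \<open>k_ball\<close>
  bounds its speed. Finiteness rules out that \<open>K\<close> takes the default value 0 of
  \<open>enn2real\<close>.\<close>

lemma finite_length_curve:
  assumes "x \<in> \<Omega>" "y \<in> \<Omega>"
  shows "\<exists>l\<in>lengths x y. l < \<infinity>"
proof -
  let ?c = "\<lambda>s. x + s *\<^sub>R (y - x)"
  have in\<Omega>: "?c s \<in> \<Omega>" if "s \<in> {0..1}" for s using segment_in_domain[OF assms that] .
  have "compact (?c ` {0..1})" by (intro compact_continuous_image continuous_intros) auto
  then obtain r where r: "r > 0" "(\<Union>y\<in>?c ` {0..1}. ball y r) \<subseteq> \<Omega>"
    using compact_subset_open_imp_ball_epsilon_subset[of "?c ` {0..1}" \<Omega>] open_domain in\<Omega>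
      by blast
  have "len 0 1 ?c \<le> ennreal (norm (y - x) / r * (1 - 0))"
  proof (rule length_bound[OF admissible_segment[OF in\<Omega>] _ segment_has_vector_derivative])
    fix t :: real assume "t \<in> {0<..<1}"
    then show "k (?c t) (y - x) \<le> norm (y - x) / r" using r by (intro k_ball) force+
  qed (use r in auto)
  then have "len 0 1 ?c < \<infinity>" by (metis ennreal_less_top infinity_ennreal_def le_less_trans)
  moreover have "len 0 1 ?c \<in> lengths x y"
    unfolding lengths_def
      using admissible_segment[OF in\<Omega>] by (intro CollectI exI[of _ 0] exI[of _ 1] exI[of _ ?c]) auto
  ultimately show ?thesis by blast
qed

lemma ennreal_K: "x \<in> \<Omega> \<Longrightarrow> y \<in> \<Omega> \<Longrightarrow> ennreal (K x y) = Inf (lengths x y)"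
  unfolding K_altdef using finite_length_curve[of x y] by (simp add: Inf_less_iff ennreal_enn2real)

lemma K_nonneg: "0 \<le> K x y" unfolding K_altdef by simp

lemma K_lessD:
  assumes "x \<in> \<Omega>" "y \<in> \<Omega>" "K x y < c"
  shows "\<exists>a b \<sigma>. admissible a b \<sigma> \<and> \<sigma> a = x \<and> \<sigma> b = y \<and> len a b \<sigma> < ennreal c"
proof -
  have "Inf (lengths x y) < ennreal c"
    unfolding ennreal_K[OF assms(1,2), symmetric]
      using assms(3) K_nonneg[of x y] by (simp add: ennreal_less_iff)
  then show ?thesis unfolding Inf_less_iff lengths_def by blast
qed

lemma K_refl: assumes "x \<in> \<Omega>" shows "K x x = 0"
  using K_segment_le[of x 0 0] k_scaleR[OF assms, of 0 0] assms K_nonneg[of x x] by (intro antisym) auto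

lemma K_sym: assumes "x \<in> \<Omega>" "y \<in> \<Omega>" shows "K x y = K y x"
proof -
  have le: "K y x \<le> K x y" if xy: "x \<in> \<Omega>" "y \<in> \<Omega>" for x y
  proof (rule field_le_epsilon)
    fix e :: real assume "e > 0"
    then obtain a b \<sigma> where s: "admissible a b \<sigma>" "\<sigma> a = x" "\<sigma> b = y" "len a b \<sigma> < ennreal (K x y + e)"
      using K_lessD[OF xy, of "K x y + e"] by auto
    have "ennreal (K y x) \<le> len (0 - b) (0 - a) (\<lambda>t. \<sigma> (0 - t))"
      using K_le_length[OF length_reverse(1)[OF s(1), of 0]] s by simp
    then have "ennreal (K y x) < ennreal (K x y + e)" using s(4) unfolding length_reverse(2)[OF s(1)] by simp
    then show "K y x \<le> K x y + e" using K_nonneg[of y x] by (simp add: ennreal_less_iff)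
  qed
  show ?thesis using le[OF assms] le[OF assms(2,1)] by simp
qed

lemma K_triangle: assumes "x \<in> \<Omega>" "y \<in> \<Omega>" "z \<in> \<Omega>" shows "K x z \<le> K x y + K y z"
proof (rule field_le_epsilon)
  fix e :: real assume e: "e > 0"
  obtain a b \<sigma> where s: "admissible a b \<sigma>" "\<sigma> a = x" "\<sigma> b = y" "len a b \<sigma> < ennreal (K x y + e / 2)"
    using K_lessD[OF assms(1,2), of "K x y + e / 2"] e by auto
  obtain c d \<tau> where t: "admissible c d \<tau>" "\<tau> c = y" "\<tau> d = z" "len c d \<tau> < ennreal (K y z + e / 2)"
    using K_lessD[OF assms(2,3), of "K y z + e / 2"] e by auto
  \<comment> \<open>Two reversals compose to the translation by \<open>h\<close>, after which the
    second curve starts where the first one ends.\<close>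
  define h where "h = b - c"
  have t1: "admissible (0 - d) (0 - c) (\<lambda>t. \<tau> (0 - t))" "len (0 - d) (0 - c) (\<lambda>t. \<tau> (0 - t)) = len c d \<tau>"
    using length_reverse[OF t(1), of 0] by auto
  have t2: "admissible (h + c) (h + d) (\<lambda>t. \<tau> (t - h))" "len (h + c) (h + d) (\<lambda>t. \<tau> (t - h)) = len c d \<tau>"
    using length_reverse[OF t1(1), of h] t1(2) by (simp_all add: algebra_simps)
  define B where "B = h + d"
  have hb: "h + c = b" unfolding h_def by simp
  define \<rho> where "\<rho> t = (if t \<le> b then \<sigma> t else \<tau> (t - h))" for t
  have bB: "b \<le> B" using t(1) unfolding B_def h_def admissible_def by simp
  have ab: "a \<le> b" using s(1) unfolding admissible_def by simp
  have r1: "\<rho> t = \<sigma> t" if "t \<in> {a..b}" for t using that unfolding \<rho>_def by simp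
  have r2: "\<rho> t = \<tau> (t - h)" if "t \<in> {b..B}" for t
    using that s(3) t(2) hb unfolding \<rho>_def by (cases "t = b") (auto simp: h_def)
  have a1: "admissible a b \<rho>" "len a b \<rho> = len a b \<sigma>" using length_cong[OF r1] s(1) by auto
  have a2: "admissible b B \<rho>" "len b B \<rho> = len c d \<tau>"
    using length_cong[OF r2] t2 unfolding hb B_def by auto
  have "\<rho> a = x" "\<rho> B = z" using r1[of a] r2[of B] ab bB s(2) t(3) unfolding B_def by auto
  then have "ennreal (K x z) \<le> len a B \<rho>"
    using K_le_length[OF admissible_concat[OF a1(1) a2(1)]] by simp
  also have "\<dots> = len a b \<sigma> + len c d \<tau>"
    using length_split[OF admissible_concat[OF a1(1) a2(1)] ab bB] a1(2) a2(2) by simp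
  also have "\<dots> < ennreal (K x y + e / 2) + ennreal (K y z + e / 2)"
    using s(4) t(4) by (rule add_strict_mono)
  also have "\<dots> = ennreal (K x y + K y z + e)"
    using K_nonneg e by (simp add: ennreal_plus[symmetric] del: ennreal_plus)
  finally show "K x z \<le> K x y + K y z + e" using K_nonneg[of x z] by (simp add: ennreal_less_iff)
qed

lemma K_ball_le:
  assumes "ball x r \<subseteq> \<Omega>" "r > 0" "dist x y \<le> r / 2"
  shows "K x y \<le> 2 * dist x y / r"
proof -
  have b: "ball (x + s *\<^sub>R (y - x)) (r / 2) \<subseteq> \<Omega>" if "s \<in> {0..1}" for s
  proof -
    have "dist x (x + s *\<^sub>R (y - x)) \<le> 1 * dist x y"
      using that by (auto simp: dist_norm norm_minus_commute intro: mult_left_le_one_le)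
    then have "ball (x + s *\<^sub>R (y - x)) (r / 2) \<subseteq> ball x r"
      using assms(3) by (simp add: ball_subset_ball_iff dist_commute)
    then show ?thesis using assms(1) by blast
  qed
  have "K x (x + (y - x)) \<le> 2 * dist x y / r"
  proof (rule K_segment_le)
    fix s :: real assume s: "s \<in> {0..1}"
    show "x + s *\<^sub>R (y - x) \<in> \<Omega>"
      using b[OF s] assms(2) by (meson centre_in_ball half_gt_zero subsetD)
    show "k (x + s *\<^sub>R (y - x)) (y - x) \<le> 2 * dist x y / r"
      using k_ball[OF b[OF s], of "y - x"] assms(2) by (simp add: dist_norm norm_minus_commute mult.commute)
  qed (use assms(2) in simp)
  then show ?thesis by simp
qed

lemma K_continuous: "continuous_on (\<Omega> \<times> \<Omega>) (\<lambda>(p, q). K p q)"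
  unfolding continuous_on_iff
proof (intro ballI allI impI)
  fix pq :: "(complex^'n) \<times> (complex^'n)" and e :: real assume pq: "pq \<in> \<Omega> \<times> \<Omega>" and e: "e > 0"
  obtain p q where p: "pq = (p, q)" "p \<in> \<Omega>" "q \<in> \<Omega>" using pq by (cases pq) auto
  obtain r1 where r1: "r1 > 0" "ball p r1 \<subseteq> \<Omega>"
    using open_domain p open_contains_ball by blast
  obtain r2 where r2: "r2 > 0" "ball q r2 \<subseteq> \<Omega>"
    using open_domain p open_contains_ball by blast
  define r where "r = min r1 r2"
  have r: "r > 0" "ball p r \<subseteq> \<Omega>" "ball q r \<subseteq> \<Omega>"
    using r1 r2 unfolding r_def by auto
  define d where "d = min (r / 2) (e * r / 8)"
  have d: "d > 0" "d \<le> r / 2" "d \<le> e * r / 8" unfolding d_def using r e by auto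
  have "dist (K p' q') (K p q) < e" if pq': "p' \<in> \<Omega>" "q' \<in> \<Omega>" "dist (p', q') (p, q) < d" for p' q'
  proof -
    have dd: "dist p p' < d" "dist q q' < d"
      using pq'(3) dist_fst_le[of "(p', q')" "(p, q)"] dist_snd_le[of "(p', q')" "(p, q)"]
        by (auto simp: dist_commute)
    have small: "2 * t / r \<le> e / 4" if "t \<le> d" for t
      using that d(3) r(1) by (simp add: field_simps)
    have "K p p' \<le> e / 4" using K_ball_le[OF r(2,1), of p'] dd(1) d(2) small[of "dist p p'"] by linarith
    moreover have "K q q' \<le> e / 4"
      using K_ball_le[OF r(3,1), of q'] dd(2) d(2) small[of "dist q q'"] by linarith
    moreover have "K p' q' \<le> K p p' + K p q + K q q'"
      using K_triangle[OF pq'(1) p(2) pq'(2)] K_triangle[OF p(2,3) pq'(2)] K_sym[OF pq'(1) p(2)] by linarith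
    moreover have "K p q \<le> K p p' + K p' q' + K q q'"
      using K_triangle[OF p(2) pq'(1) p(3)] K_triangle[OF pq'(1,2) p(3)] K_sym[OF pq'(2) p(3)] by linarith
    ultimately show ?thesis using e by (simp add: dist_real_def abs_less_iff)
  qed
  then show "\<exists>d>0. \<forall>x'\<in>\<Omega> \<times> \<Omega>. dist x' pq < d \<longrightarrow> dist (case x' of (p, q) \<Rightarrow> K p q) (case pq of (p, q) \<Rightarrow> K p q) < e"
    using d(1) unfolding p(1) by auto
qed

text \<open>The source of all lower bounds for \<open>K\<close>. At almost every time the curve
  agrees with its tangent line up to o(h), and the local Lipschitz bound absorbs this error, so a
  one-sided estimate along straight rays suffices. It is required only for \<kappa> above
  \<open>k x v\<close>, because the infimum defining \<open>k\<close> need not be attained.\<close>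

lemma K_lipschitz:
  assumes lip: "\<And>C. compact C \<Longrightarrow> C \<subseteq> \<Omega> \<Longrightarrow> \<exists>L. \<forall>x\<in>C. \<forall>y\<in>C. \<bar>\<Phi> x - \<Phi> y\<bar> \<le> L * dist x y"
    and dini: "\<And>x v \<kappa>. x \<in> \<Omega> \<Longrightarrow> k x v < \<kappa> \<Longrightarrow> \<exists>\<delta>>0. \<forall>\<tau>. 0 < \<tau> \<longrightarrow> \<tau> < \<delta> \<longrightarrow> \<Phi> (x + \<tau> *\<^sub>R v) \<le> \<Phi> x + \<kappa> * \<tau>"
    and xy: "x \<in> \<Omega>" "y \<in> \<Omega>"
  shows "\<Phi> y - \<Phi> x \<le> K x y"
proof -
  have main: "ennreal (\<Phi> (\<sigma> b) - \<Phi> (\<sigma> a)) \<le> len a b \<sigma>" if adm: "admissible a b \<sigma>" for a b \<sigma>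
  proof -
    have ab: "a \<le> b" and ac: "absolutely_continuous_curve a b \<sigma>" and \<Omega>: "\<And>t. t \<in> {a..b} \<Longrightarrow> \<sigma> t \<in> \<Omega>"
      using adm unfolding admissible_def by auto
    have "compact (\<sigma> ` {a..b})"
      using absolutely_continuous_curve_continuous[OF ac] by (intro compact_continuous_image) auto
    then obtain L where L: "\<And>x y. x \<in> \<sigma> ` {a..b} \<Longrightarrow> y \<in> \<sigma> ` {a..b} \<Longrightarrow> \<bar>\<Phi> x - \<Phi> y\<bar> \<le> L * dist x y"
      using lip[of "\<sigma> ` {a..b}"] \<Omega> by blast
    have acu: "absolutely_continuous_curve a b (\<lambda>t. \<Phi> (\<sigma> t))"
      by (rule absolutely_continuous_curve_compose_lipschitz[OF ac, of _ L]) (use L in \<open>auto simp: dist_real_def\<close>)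
    define N where "N = {x\<in>{a..b}. \<not> \<sigma> differentiable (at x)} \<union> {a, b}"
    have N: "negligible N"
      unfolding N_def by (intro negligible_Un absolutely_continuous_differentiable_AE[OF ac]) auto
    show ?thesis
      unfolding kobayashi_length_def
    proof (rule absolutely_continuous_increment_le_nn_integral[OF acu ab N])
      fix t D assume t: "t \<in> {a..b} - N" and D: "((\<lambda>t. \<Phi> (\<sigma> t)) has_real_derivative D) (at t)"
      define v where "v = vector_derivative \<sigma> (at t)"
      have v: "(\<sigma> has_vector_derivative v) (at t)"
        using t unfolding N_def v_def by (auto simp: vector_derivative_works[symmetric])
      have tab: "a < t" "t < b" using t unfolding N_def by auto
      have vd: "vector_derivative \<sigma> (at t within {a..b}) = v"
        by (rule vector_derivative_at_within_ivl[OF v]) (use tab in auto)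
      have st: "\<sigma> t \<in> \<Omega>" using \<Omega> tab by auto
      obtain r where r: "r > 0" "cball (\<sigma> t) r \<subseteq> \<Omega>"
        using open_domain st open_contains_cball by blast
      obtain L' where L': "\<And>x y. x \<in> cball (\<sigma> t) r \<Longrightarrow> y \<in> cball (\<sigma> t) r \<Longrightarrow> \<bar>\<Phi> x - \<Phi> y\<bar> \<le> L' * dist x y"
        using lip[OF compact_cball r(2)] by blast
      have "D \<le> \<kappa>" if \<kappa>: "k (\<sigma> t) v < \<kappa>" for \<kappa>
      proof -
        obtain \<delta> where \<delta>: "\<delta> > 0" "\<And>\<tau>. 0 < \<tau> \<Longrightarrow> \<tau> < \<delta> \<Longrightarrow> \<Phi> (\<sigma> t + \<tau> *\<^sub>R v) \<le> \<Phi> (\<sigma> t) + \<kappa> * \<tau>"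
          using dini[OF st \<kappa>] by blast
        have quot: "((\<lambda>h. norm ((\<sigma> (t + h) - \<sigma> t) /\<^sub>R h - v)) \<longlongrightarrow> 0) (at_right 0)"
        proof -
          have "((\<lambda>h. norm (\<sigma> (t + h) - \<sigma> t - h *\<^sub>R v) / norm h) \<longlongrightarrow> 0) (at 0)"
            using v unfolding has_vector_derivative_def has_derivative_at by blast
          then have "((\<lambda>h. norm (\<sigma> (t + h) - \<sigma> t - h *\<^sub>R v) / norm h) \<longlongrightarrow> 0) (at_right 0)"
            by (auto intro: tendsto_within_subset)
          moreover have "\<forall>\<^sub>F h in at_right 0. norm (\<sigma> (t + h) - \<sigma> t - h *\<^sub>R v) / norm h = norm ((\<sigma> (t + h) - \<sigma> t) /\<^sub>R h - v)"
            unfolding eventually_at_right_field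
          proof (intro exI[of _ 1] conjI allI impI)
            fix h :: real assume "0 < h"
            then have "(\<sigma> (t + h) - \<sigma> t) /\<^sub>R h - v = (\<sigma> (t + h) - \<sigma> t - h *\<^sub>R v) /\<^sub>R h"
              by (simp add: scaleR_diff_right)
            then show "norm (\<sigma> (t + h) - \<sigma> t - h *\<^sub>R v) / norm h = norm ((\<sigma> (t + h) - \<sigma> t) /\<^sub>R h - v)"
              using \<open>0 < h\<close> by (simp add: divide_inverse mult.commute)
          qed simp
          ultimately show ?thesis by (rule Lim_transform_eventually)
        qed
        have "((\<lambda>h. (\<Phi> (\<sigma> (t + h)) - \<Phi> (\<sigma> t)) / h) \<longlongrightarrow> D) (at_right 0)"
          using D unfolding DERIV_def by (auto intro: tendsto_within_subset)
        moreover have "((\<lambda>h. \<kappa> + L' * norm ((\<sigma> (t + h) - \<sigma> t) /\<^sub>R h - v)) \<longlongrightarrow> \<kappa> + L' * 0) (at_right 0)"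
          by (intro tendsto_intros quot)
        moreover have "\<forall>\<^sub>F h in at_right 0. (\<Phi> (\<sigma> (t + h)) - \<Phi> (\<sigma> t)) / h \<le> \<kappa> + L' * norm ((\<sigma> (t + h) - \<sigma> t) /\<^sub>R h - v)"
        proof -
          have "((\<lambda>h. \<sigma> (t + h)) \<longlongrightarrow> \<sigma> (t + 0)) (at_right 0)"
          proof -
            have "isCont \<sigma> t" using v by (rule has_vector_derivative_continuous)
            then have "((\<lambda>h. \<sigma> (t + h)) \<longlongrightarrow> \<sigma> t) (at 0)"
              by (simp add: isCont_def LIM_offset_zero_iff)
            then show ?thesis by (auto intro: tendsto_within_subset)
          qed
          then have "\<forall>\<^sub>F h in at_right 0. dist (\<sigma> (t + h)) (\<sigma> t) < r"
            using r(1) by (auto dest: tendstoD)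
          moreover have "((\<lambda>h. \<sigma> t + h *\<^sub>R v) \<longlongrightarrow> \<sigma> t + 0 *\<^sub>R v) (at_right 0)"
            by (intro tendsto_intros)
          then have "\<forall>\<^sub>F h in at_right 0. dist (\<sigma> t + h *\<^sub>R v) (\<sigma> t) < r"
            using r(1) by (auto dest: tendstoD)
          moreover have "\<forall>\<^sub>F h in at_right 0. h < \<delta>" "\<forall>\<^sub>F h in at_right (0::real). 0 < h"
            using \<delta>(1) by (auto simp: eventually_at_right_field)
          ultimately show ?thesis
          proof eventually_elim
            case (elim h)
            have "\<Phi> (\<sigma> (t + h)) - \<Phi> (\<sigma> t + h *\<^sub>R v) \<le> L' * dist (\<sigma> (t + h)) (\<sigma> t + h *\<^sub>R v)"
              using L'[of "\<sigma> (t + h)" "\<sigma> t + h *\<^sub>R v"] elim(1,2)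
                by (auto simp: dist_commute abs_le_iff)
            moreover have "dist (\<sigma> (t + h)) (\<sigma> t + h *\<^sub>R v) = h * norm ((\<sigma> (t + h) - \<sigma> t) /\<^sub>R h - v)"
            proof -
              have "\<sigma> (t + h) - (\<sigma> t + h *\<^sub>R v) = h *\<^sub>R ((\<sigma> (t + h) - \<sigma> t) /\<^sub>R h - v)"
                using elim(4) by (simp add: algebra_simps)
              then show ?thesis using elim(4) by (simp add: dist_norm)
            qed
            ultimately have "\<Phi> (\<sigma> (t + h)) - \<Phi> (\<sigma> t) \<le> (\<kappa> + L' * norm ((\<sigma> (t + h) - \<sigma> t) /\<^sub>R h - v)) * h"
              using \<delta>(2)[OF elim(4,3)] by (simp add: algebra_simps)
            then show ?case using elim(4) by (simp add: divide_le_eq)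
          qed
        qed
        ultimately have "D \<le> \<kappa> + L' * 0" by (intro tendsto_le[of "at_right (0::real)"]) auto
        then show ?thesis by simp
      qed
      then have "D \<le> k (\<sigma> t) v" by (rule dense_ge)
      then show "ennreal D \<le> ennreal (k (\<sigma> t) (vector_derivative \<sigma> (at t within {a..b})))"
        unfolding vd by (rule ennreal_leI)
    qed
  qed
  have "ennreal (\<Phi> y - \<Phi> x) \<le> ennreal (K x y)"
    unfolding ennreal_K[OF xy] by (rule Inf_greatest) (use main in \<open>auto simp: lengths_def\<close>)
  then show ?thesis using K_nonneg[of x y] by (simp add: ennreal_le_iff)
qed

text \<open>A curve of length below \<open>K x y + e\<close> is parametrized proportionally to arc
  length over \<open>{0..K x y}\<close>. Arc length bounds distances from above; the triangle
  inequality through the two outer arcs bounds them from below.\<close>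

lemma approximate_geodesic:
  assumes xy: "x \<in> \<Omega>" "y \<in> \<Omega>" and L: "K x y > 0" and e: "e > 0"
  shows "\<exists>f. (\<forall>s\<in>{0..K x y}. f s \<in> \<Omega> \<and> K x (f s) \<le> K x y + e) \<and> f 0 = x \<and> f (K x y) = y \<and>
     (\<forall>s\<in>{0..K x y}. \<forall>t\<in>{0..K x y}. \<bar>K (f s) (f t) - \<bar>s - t\<bar>\<bar> \<le> e)"
proof -
  define L where "L = K x y"
  have L0: "L > 0" unfolding L_def by (rule L)
  obtain a b \<sigma> where s: "admissible a b \<sigma>" "\<sigma> a = x" "\<sigma> b = y" "len a b \<sigma> < ennreal (L + e)"
    using K_lessD[OF xy, of "K x y + e"] e unfolding L_def by auto
  have ab: "a \<le> b" and \<Omega>: "\<And>t. t \<in> {a..b} \<Longrightarrow> \<sigma> t \<in> \<Omega>"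
    using s(1) unfolding admissible_def by auto
  obtain g N w where g: "g \<in> borel_measurable borel"
    "\<And>c d. a \<le> c \<Longrightarrow> c \<le> d \<Longrightarrow> d \<le> b \<Longrightarrow> len c d \<sigma> = (\<integral>\<^sup>+t\<in>{c..d}. g t \<partial>lborel)"
    by (rule length_density[OF s(1)], rule that)
  \<comment> \<open>The length is finite, so the density is finite almost everywhere and has a
    real-valued version; its indefinite integral is the arc length, which is continuous.\<close>
  define G where "G t = enn2real (g t * indicator {a..b} t)" for t
  have fin: "(\<integral>\<^sup>+t\<in>{a..b}. g t \<partial>lborel) < \<infinity>"
    using s(4) g(2)[of a b] ab by (metis infinity_ennreal_def ennreal_less_top order.strict_trans order_refl)
  have gm: "(\<lambda>t. g t * indicator {a..b} t) \<in> borel_measurable lborel" using g(1) by measurable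
  have Gm: "G \<in> borel_measurable lborel" unfolding G_def[abs_def] using gm by measurable
  have AEg: "AE t in lborel. ennreal (G t) = g t * indicator {a..b} t"
    using nn_integral_PInf_AE[OF gm] fin
      unfolding G_def by (auto elim!: eventually_mono simp: less_top ennreal_enn2real_if)
  have Gint: "integrable lborel G"
  proof (rule integrableI_nonneg[OF Gm])
    show "AE x in lborel. 0 \<le> G x" unfolding G_def by simp
    show "(\<integral>\<^sup>+x. ennreal (G x) \<partial>lborel) < \<infinity>"
      using fin nn_integral_cong_AE[OF AEg] by simp
  qed
  have Gon: "G integrable_on {c..d}" for c d
    using integrable_on_lborel[OF Gint] integrable_on_subcbox[of G UNIV c d] by simp
  define \<Lambda> where "\<Lambda> t = integral {a..t} G" for t
  have lenL: "len c d \<sigma> = ennreal (\<Lambda> d - \<Lambda> c)" "\<Lambda> c \<le> \<Lambda> d" if cd: "a \<le> c" "c \<le> d" "d \<le> b" for c d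
  proof -
    have G0: "0 \<le> G t" for t unfolding G_def by simp
    have i: "\<Lambda> d - \<Lambda> c = integral {c..d} G"
      unfolding \<Lambda>_def using Henstock_Kurzweil_Integration.integral_combine[OF cd(1,2) Gon] by simp
    have nn: "0 \<le> integral {c..d} G" using Gon G0 by (intro integral_nonneg) auto
    have "len c d \<sigma> = (\<integral>\<^sup>+t. ennreal (G t * indicator {c..d} t) \<partial>lborel)"
      unfolding g(2)[OF cd]
    proof (rule nn_integral_cong_AE)
      show "AE t in lborel. g t * indicator {c..d} t = ennreal (G t * indicator {c..d} t)"
        using AEg by eventually_elim (use cd in \<open>auto simp: indicator_def split: if_splits\<close>)
    qed
    also have "\<dots> = ennreal (integral {c..d} G)"
    proof (rule nn_integral_has_integral_lborel)
      show "(\<lambda>t. G t * indicator {c..d} t) \<in> borel_measurable borel" using Gm by measurable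
      have "(\<lambda>t. G t * indicator {c..d} t) = (\<lambda>t. if t \<in> {c..d} then G t else 0)"
        by (auto simp: indicator_def)
      then show "((\<lambda>t. G t * indicator {c..d} t) has_integral integral {c..d} G) UNIV"
        using integrable_integral[OF Gon[of c d]] by (simp only: has_integral_restrict_UNIV)
    qed (use G0 in auto)
    finally show "len c d \<sigma> = ennreal (\<Lambda> d - \<Lambda> c)" "\<Lambda> c \<le> \<Lambda> d"
      using i nn by auto
  qed
  have cont: "continuous_on {a..b} \<Lambda>"
    unfolding \<Lambda>_def by (rule indefinite_integral_continuous_1[OF Gon])
  have \<Lambda>a: "\<Lambda> a = 0" unfolding \<Lambda>_def by simp
  define l where "l = \<Lambda> b"
  have l0: "0 \<le> l" using lenL(2)[of a b] ab \<Lambda>a unfolding l_def by auto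
  have l: "len a b \<sigma> = ennreal l" using lenL(1)[of a b] ab \<Lambda>a unfolding l_def by auto
  have lLe: "l < L + e" using s(4) l l0 by (simp add: ennreal_less_iff)
  have Kle: "K (\<sigma> c) (\<sigma> d) \<le> \<bar>\<Lambda> d - \<Lambda> c\<bar>" if "c \<in> {a..b}" "d \<in> {a..b}" for c d
  proof -
    have *: "K (\<sigma> c) (\<sigma> d) \<le> \<Lambda> d - \<Lambda> c" if "a \<le> c" "c \<le> d" "d \<le> b" for c d
      using K_le_length[OF admissible_subinterval[OF s(1) that]] lenL[OF that] by (simp add: ennreal_le_iff)
    show ?thesis
    proof (cases "c \<le> d")
      case True
      then show ?thesis using *[of c d] that by auto
    next
      case False
      then show ?thesis using *[of d c] that K_sym[OF \<Omega> \<Omega>, of c d] by auto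
    qed
  qed
  have Ll: "L \<le> l" using Kle[of a b] ab s(2,3) \<Lambda>a l0 unfolding L_def l_def by auto
  have lpos: "l > 0" using Ll L0 by simp
  have "\<exists>t. t \<in> {a..b} \<and> \<Lambda> t = r * (l / L)" if r: "r \<in> {0..L}" for r
  proof -
    have "r * l \<le> L * l" using r l0 by (intro mult_right_mono) auto
    then have "0 \<le> r * (l / L)" "r * (l / L) \<le> l" using r L0 l0 by (auto simp: field_simps)
    then have "\<exists>t\<ge>a. t \<le> b \<and> \<Lambda> t = r * (l / L)"
      using IVT'[of \<Lambda> a "r * (l / L)" b] cont ab \<Lambda>a unfolding l_def by auto
    then show ?thesis by auto
  qed
  then obtain T where T: "\<And>r. r \<in> {0..L} \<Longrightarrow> T r \<in> {a..b} \<and> \<Lambda> (T r) = r * (l / L)"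
    by metis
  \<comment> \<open>Arc length may be constant on stretches, so \<open>T 0\<close> and
    \<open>T L\<close> need not be \<open>a\<close> and \<open>b\<close>; the end values are imposed
    instead.\<close>
  define f where "f r = (if r = 0 then x else if r = L then y else \<sigma> (T r))" for r
  have f: "\<exists>t\<in>{a..b}. f r = \<sigma> t \<and> \<Lambda> t = r * (l / L)" if "r \<in> {0..L}" for r
  proof -
    consider "r = 0" | "r = L" "r \<noteq> 0" | "r \<noteq> 0" "r \<noteq> L" by blast
    then show ?thesis
    proof cases
      case 1
      then show ?thesis using s(2) \<Lambda>a ab unfolding f_def by (intro bexI[of _ a]) auto
    next
      case 2
      then show ?thesis using s(3) ab L0 unfolding f_def l_def by (intro bexI[of _ b]) auto
    next
      case 3
      then show ?thesis using T[OF that] unfolding f_def by (intro bexI[of _ "T r"]) auto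
    qed
  qed
  have f\<Omega>: "f r \<in> \<Omega>" if "r \<in> {0..L}" for r using f[OF that] \<Omega> by auto
  have ratio: "1 \<le> l / L" "r * (l / L) \<le> r + e" if "r \<in> {0..L}" for r
  proof -
    show "1 \<le> l / L" using Ll L0 by simp
    have "r * (l - L) \<le> L * (l - L)" using that Ll by (intro mult_right_mono) auto
    also have "\<dots> \<le> L * e" using lLe L0 by simp
    finally show "r * (l / L) \<le> r + e" using L0 by (simp add: field_simps)
  qed
  have up: "K (f r) (f r') \<le> \<bar>r - r'\<bar> * (l / L)" if rr: "r \<in> {0..L}" "r' \<in> {0..L}" for r r'
  proof -
    obtain t t' where "t \<in> {a..b}" "f r = \<sigma> t" "\<Lambda> t = r * (l / L)" "t' \<in> {a..b}" "f r' = \<sigma> t'" "\<Lambda> t' = r' * (l / L)"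
      using f[OF rr(1)] f[OF rr(2)] by blast
    moreover have "\<bar>r' * (l / L) - r * (l / L)\<bar> = \<bar>r - r'\<bar> * (l / L)"
      using l0 L0
        by (simp add: left_diff_distrib[symmetric] abs_mult abs_minus_commute del: times_divide_eq_right)
    ultimately show ?thesis using Kle[of t t'] by simp
  qed
  have f0: "f 0 = x" and fL: "f L = y" using L0 unfolding f_def by auto
  have lo: "r' - r - e \<le> K (f r) (f r')" if rr: "r \<in> {0..L}" "r' \<in> {0..L}" "r \<le> r'" for r r'
  proof -
    have "L \<le> K x (f r) + K (f r) (f r') + K (f r') y"
      using K_triangle[OF xy(1) f\<Omega>[OF rr(1)] xy(2)] K_triangle[OF f\<Omega>[OF rr(1)] f\<Omega>[OF rr(2)] xy(2)]
        unfolding L_def by linarith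
    moreover have "K x (f r) \<le> r * (l / L)" using up[of 0 r] rr f0 L0 by simp
    moreover have "K (f r') y \<le> (L - r') * (l / L)" using up[of r' L] rr fL L0 by simp
    moreover have "r * q + (L - r') * q = (L - (r' - r)) * q" for q :: real by (simp add: algebra_simps)
    from this[of "l / L"] have "r * (l / L) + (L - r') * (l / L) = (L - (r' - r)) * (l / L)" .
    ultimately have "L \<le> K (f r) (f r') + (L - (r' - r)) * (l / L)" by linarith
    also have "(L - (r' - r)) * (l / L) \<le> L - (r' - r) + e" by (rule ratio(2)) (use rr in auto)
    finally show ?thesis by simp
  qed
  have "\<bar>K (f r) (f r') - \<bar>r - r'\<bar>\<bar> \<le> e" if rr: "r \<in> {0..L}" "r' \<in> {0..L}" for r r'
  proof -
    have "\<bar>r - r'\<bar> * (l / L) \<le> \<bar>r - r'\<bar> + e" by (rule ratio(2)) (use rr in auto)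
    then have 1: "K (f r) (f r') \<le> \<bar>r - r'\<bar> + e" using up[OF rr] by linarith
    have 2: "\<bar>r - r'\<bar> - e \<le> K (f r) (f r')"
    proof (cases "r \<le> r'")
      case True
      then show ?thesis using lo[OF rr] by auto
    next
      case False
      then show ?thesis using lo[OF rr(2,1)] K_sym[OF f\<Omega> f\<Omega>, OF rr] by auto
    qed
    show ?thesis using 1 2 by linarith
  qed
  moreover have "K x (f r) \<le> L + e" if "r \<in> {0..L}" for r
    using up[of 0 r] ratio(2)[OF that] that f0 L0 by auto
  ultimately show ?thesis using f\<Omega> f0 fL unfolding L_def by blast
qed

end

section \<open>The domain above the graph of a convex polynomial\<close>

text \<open>The Cayley transform \<open>h\<close> sends the half plane to the disc and
  \<open>g 0\<close> to 0, and its derivative at \<open>g 0\<close> has modulus 1 / (2 Im (g 0)).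
  The Schwarz lemma for \<open>h\<close> then gives the bound.\<close>

lemma half_plane_schwarz:
  assumes hol: "g holomorphic_on ball 0 1" and pos: "\<And>z. cmod z < 1 \<Longrightarrow> Im (g z) > 0"
  shows "cmod (deriv g 0) \<le> 2 * Im (g 0)"
proof -
  define c where "c = g 0"
  have c: "Im c > 0" unfolding c_def using pos[of 0] by simp
  have nz: "g z - cnj c \<noteq> 0" if "cmod z < 1" for z
  proof
    assume "g z - cnj c = 0"
    then have "Im (g z) = - Im c" by (simp add: complex_eq_iff)
    then show False using pos[OF that] c by simp
  qed
  define h where "h z = (g z - c) / (g z - cnj c)" for z
  have holh: "h holomorphic_on ball 0 1"
    unfolding h_def using nz by (auto intro!: holomorphic_intros hol)
  have h0: "h 0 = 0" unfolding h_def c_def by simp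
  have hb: "cmod (h z) < 1" if z: "cmod z < 1" for z
  proof -
    have "(Im (g z) - Im c)\<^sup>2 < (Im (g z) + Im c)\<^sup>2"
      using pos[OF z] c by (simp add: power2_eq_square algebra_simps)
    then have "(cmod (g z - c))\<^sup>2 < (cmod (g z - cnj c))\<^sup>2"
      unfolding cmod_power2 by simp
    then have "cmod (g z - c) < cmod (g z - cnj c)" by (rule power2_less_imp_less) simp
    then show ?thesis unfolding h_def norm_divide using nz[OF z] by simp
  qed
  have "cmod (deriv h 0) \<le> 1" using Schwarz_Lemma(2)[OF holh h0 hb, of 0] by simp
  moreover have "deriv h 0 = deriv g 0 / (c - cnj c)"
  proof (rule DERIV_imp_deriv)
    have "(g has_field_derivative deriv g 0) (at 0)" using holomorphic_derivI[OF hol, of 0] by simp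
    then have "(h has_field_derivative ((deriv g 0 - 0) * (g 0 - cnj c) - (g 0 - c) * (deriv g 0 - 0)) / ((g 0 - cnj c) * (g 0 - cnj c))) (at 0)"
      unfolding h_def[abs_def] using nz[of 0] by (intro DERIV_divide DERIV_diff DERIV_const) auto
    then show "(h has_field_derivative deriv g 0 / (c - cnj c)) (at 0)"
      using nz[of 0] unfolding c_def by simp
  qed
  moreover have "cmod (c - cnj c) = 2 * Im c" using c by (simp add: complex_diff_cnj norm_mult)
  ultimately have "cmod (deriv g 0) / (2 * Im c) \<le> 1" by (metis norm_divide)
  then show ?thesis using c unfolding c_def[symmetric] by (simp add: field_simps)
qed

section \<open>Splitting off the coordinate with index \<open>None\<close>\<close>

definition base :: "complex^('d::finite option) \<Rightarrow> complex^'d" where "base z = (\<chi> i. z $ Some i)"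

definition fibre :: "complex \<Rightarrow> complex^('d::finite option)" where
  "fibre a = (\<chi> j. case j of None \<Rightarrow> a | Some i \<Rightarrow> 0)"

lemma base_simps [simp]:
  "base (x + y) = base x + base y" "base (x - y) = base x - base y" "base (- x) = - base x" "base 0 = 0"
  "base (\<zeta> *s x) = \<zeta> *s base x" "base (t *\<^sub>R x) = t *\<^sub>R base x" "base (fibre a) = 0" "base x $ i = x $ Some i"
  by (simp_all add: base_def fibre_def vec_eq_iff)

lemma fibre_simps [simp]: "fibre a $ None = a" "fibre 0 = 0"
  by (simp_all add: fibre_def vec_eq_iff split: option.split)

lemma fibre_arith: "fibre (a + b) = fibre a + fibre b" "fibre (\<zeta> * a) = \<zeta> *s fibre a" "fibre (t *\<^sub>R a) = t *\<^sub>R fibre a"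
  by (simp_all add: fibre_def vec_eq_iff split: option.split)

lemma norm_le_base: "norm z \<le> cmod (z $ None) + norm (base z)"
proof -
  define w :: "complex^('a option)" where "w = (\<chi> j. case j of None \<Rightarrow> 0 | Some i \<Rightarrow> z $ Some i)"
  have U: "(UNIV :: 'a option set) = insert None (Some ` UNIV)" by (auto simp: UNIV_option_conv)
  have L2: "(\<Sum>j\<in>UNIV. f j) = f None + (\<Sum>i\<in>UNIV. f (Some i))" for f :: "'a option \<Rightarrow> real"
    unfolding U by (subst sum.insert) (auto simp: sum.reindex)
  have "norm (fibre (z $ None) :: complex^('a option)) = cmod (z $ None)"
    unfolding norm_vec_def L2_set_def L2 by (simp add: fibre_def)
  moreover have "norm w = norm (base z)"
    unfolding norm_vec_def L2_set_def L2 by (simp add: w_def)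
  moreover have "z = fibre (z $ None) + w"
    unfolding w_def fibre_def by (simp add: vec_eq_iff split: option.split)
  ultimately show ?thesis using norm_triangle_ineq[of "fibre (z $ None)" w] by simp
qed

lemma norm_fibre: "norm (fibre a) = cmod a"
proof (rule antisym)
  show "norm (fibre a :: complex^('a option)) \<le> cmod a"
    using norm_le_base[of "fibre a :: complex^('a option)"] by simp
  show "cmod a \<le> norm (fibre a :: complex^('a option))"
    using Finite_Cartesian_Product.norm_nth_le[of "fibre a :: complex^('a option)" None] by simp
qed

lemma base_bounded_linear: "bounded_linear base"
  by (simp add: linear_conv_bounded_linear[symmetric] linearI)

lemma base_continuous [continuous_intros]: "continuous_on S f \<Longrightarrow> continuous_on S (\<lambda>x. base (f x))"
  by (rule bounded_linear.continuous_on[OF base_bounded_linear])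

section \<open>Supporting functionals of the domain and the growth of \<open>reach\<close>\<close>

context convex_poly
begin

definition Dom :: "(complex^('d option)) set" where "Dom = {z. Im (z $ None) > P (base z)}"

definition height :: "complex^('d option) \<Rightarrow> real" where "height z = Im (z $ None) - P (base z)"

text \<open>\<open>support p\<close> is real exactly on the supporting hyperplane of the domain over \<open>p\<close>; \<open>support_diff p\<close> is its
  linear part.\<close>

definition support :: "complex^'d \<Rightarrow> complex^('d option) \<Rightarrow> complex" where
  "support p z = z $ None - \<i> * of_real (P p) - ell p (base z - p)"

definition support_diff :: "complex^'d \<Rightarrow> complex^('d option) \<Rightarrow> complex" where
  "support_diff p v = v $ None - ell p (base v)"

lemma Dom_height: "z \<in> Dom \<longleftrightarrow> height z > 0" unfolding Dom_def height_def by auto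

lemma support_add: "support p (z + w) = support p z + support_diff p w"
  unfolding support_def support_diff_def
    using ell_add[of p "base z - p" "base w"] by (simp add: algebra_simps)

lemma support_diff_smult: "support_diff p (\<zeta> *s v) = \<zeta> * support_diff p v"
  unfolding support_diff_def by (simp add: ell_smult algebra_simps)

lemma support_diff_scaleR: "support_diff p (t *\<^sub>R v) = of_real t * support_diff p v"
  using support_diff_smult[of p "of_real t" v] by (simp add: vector_smult_scaleR)

lemma Im_support: "Im (support p z) = height z + Q p (base z - p)"
  unfolding support_def height_def Q_def by simp

lemma Im_support_ge: "height z \<le> Im (support p z)" unfolding Im_support using Q_nonneg by simp

lemma continuous_height: "continuous_on S height"
  unfolding height_def by (intro continuous_intros)

lemma open_Dom: "open Dom"
proof -
  have "Dom = {z. 0 < height z}" using Dom_height by auto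
  then show ?thesis using open_Collect_less[OF continuous_on_const continuous_height, of 0] by simp
qed

lemma height_concave:
  assumes "0 \<le> t" "t \<le> 1"
  shows "(1 - t) * height x + t * height y \<le> height ((1 - t) *\<^sub>R x + t *\<^sub>R y)"
  using P_convexD[OF assms, of "base x" "base y"] unfolding height_def by (simp add: algebra_simps)

lemma convex_Dom: "convex Dom"
  unfolding convex_alt
proof (intro ballI allI impI)
  fix x y and t :: real assume "x \<in> Dom" "y \<in> Dom" and t: "0 \<le> t \<and> t \<le> 1"
  then have "0 < height x" "0 < height y" by (auto simp: Dom_height)
  then have "0 < (1 - t) * height x + t * height y"
    using t by (cases "t = 0") (auto intro: add_nonneg_pos)
  then show "(1 - t) *\<^sub>R x + t *\<^sub>R y \<in> Dom"
    unfolding Dom_height using height_concave[of t x y] t by linarith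
qed

sublocale convex_domain Dom by unfold_locales (rule open_Dom convex_Dom)+

text \<open>This exhibits \<open>ell p\<close> as a combination of coordinates with complex
  coefficients, so its composition with a holomorphic disc is holomorphic.\<close>

lemma ell_basis: "ell p w = (\<Sum>i\<in>UNIV. w $ i * ell p (axis i 1))"
proof -
  have "ell p (\<Sum>i\<in>I. w $ i *s axis i 1) = (\<Sum>i\<in>I. w $ i * ell p (axis i 1))" for I :: "'d set"
    using ell_smult[of p 0 0] by (induction I rule: infinite_finite_induct) (simp_all add: ell_add ell_smult)
  then show ?thesis using basis_expansion[of w] by metis
qed

text \<open>The Schwarz lemma for the map \<open>support p\<close> into the upper half plane.\<close>

lemma support_diff_le:
  assumes x: "x \<in> Dom" and v: "k x v < c"
  shows "cmod (support_diff p v) \<le> 2 * c * Im (support p x)"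
proof -
  obtain \<xi> f where f: "disc x v \<xi> f" "cmod \<xi> < c" using k_lessD[OF x v] by blast
  have hol: "(\<lambda>z. f z $ j) holomorphic_on ball 0 1" for j
    using f(1) unfolding disc_def holomorphic_map_def by blast
  define g where "g z = support p (f z)" for z
  have g: "g z = f z $ None - \<i> * of_real (P p) - (\<Sum>i\<in>UNIV. (f z $ Some i - p $ i) * ell p (axis i 1))" for z
    unfolding g_def support_def by (subst ell_basis) simp
  have holg: "g holomorphic_on ball 0 1" unfolding g[abs_def] by (intro holomorphic_intros hol)
  have pos: "Im (g z) > 0" if "cmod z < 1" for z
  proof -
    have "f z \<in> Dom" using f(1) that unfolding disc_def by auto
    then show ?thesis unfolding g_def using Im_support_ge[of "f z" p] Dom_height by force
  qed
  define D where "D = (\<chi> j. deriv (\<lambda>z. f z $ j) 0)"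
  have dj: "((\<lambda>z. f z $ j) has_field_derivative D $ j) (at 0)" for j
    unfolding D_def using holomorphic_derivI[OF hol[of j], of 0] by simp
  have "deriv g 0 = support_diff p D"
  proof (rule DERIV_imp_deriv)
    have "(g has_field_derivative (D $ None - 0 - (\<Sum>i\<in>UNIV. (D $ Some i - 0) * ell p (axis i 1)))) (at 0)"
      unfolding g[abs_def] by (intro DERIV_diff DERIV_sum DERIV_cmult_right dj DERIV_const)
    then show "(g has_field_derivative support_diff p D) (at 0)"
      unfolding support_diff_def by (subst ell_basis) simp
  qed
  then have "cmod (support_diff p D) \<le> 2 * Im (support p x)"
    using half_plane_schwarz[OF holg pos] f(1) unfolding g_def disc_def by simp
  moreover have "v = \<xi> *s D" using f(1) unfolding disc_def D_def by simp
  ultimately have "cmod (support_diff p v) \<le> cmod \<xi> * (2 * Im (support p x))"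
    unfolding \<open>v = \<xi> *s D\<close> support_diff_smult norm_mult by (intro mult_left_mono) auto
  also have "\<dots> \<le> c * (2 * Im (support p x))"
    using f(2) Im_support_ge[of x p] x Dom_height[of x] by (intro mult_right_mono) auto
  finally show ?thesis by simp
qed

text \<open>Taking for \<open>p\<close> the base of \<open>x + (\<zeta>/2) v\<close> shows that this point lies in the closed domain.\<close>

lemma half_disc_closed:
  assumes x: "x \<in> Dom" and v: "k x v < 1" and z: "cmod \<zeta> \<le> 1"
  shows "P (base x + (\<zeta> / 2) *s base v) \<le> Im (x $ None) + Im (\<zeta> * v $ None) / 2"
proof -
  define p where "p = base x + (\<zeta> / 2) *s base v"
  have "cmod ((\<zeta> / 2) * support_diff p v) \<le> 1 / 2 * (2 * 1 * Im (support p x))"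
    unfolding norm_mult using z by (intro mult_mono support_diff_le[OF x v]) (auto simp: norm_divide)
  then have "\<bar>Im ((\<zeta> / 2) * support_diff p v)\<bar> \<le> 1 / 2 * (2 * 1 * Im (support p x))"
    using abs_Im_le_cmod order_trans by blast
  then have "0 \<le> Im (support p x + (\<zeta> / 2) * support_diff p v)"
    unfolding plus_complex.sel by linarith
  also have "support p x + (\<zeta> / 2) * support_diff p v = support p (x + (\<zeta> / 2) *s v)"
    by (simp add: support_add support_diff_smult)
  \<comment> \<open>The base of the point is \<open>p\<close>, so the linear term of
    \<open>support p\<close> vanishes there.\<close>
  also have "\<dots> = x $ None + (\<zeta> / 2) * v $ None - \<i> * of_real (P p)"
    using ell_smult[of p 0 0] unfolding support_def p_def by simp
  finally show ?thesis unfolding p_def[symmetric] by simp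
qed

text \<open>Subtracting the tangent plane at \<open>base x\<close> from
  \<open>half_disc_closed\<close> turns the linear terms into half of \<open>support_diff\<close>,
  which the Schwarz lemma bounds. As a result, half of \<open>base v\<close> satisfies the
  hypothesis on \<open>w\<close> in \<open>engulf\<close> with \<open>h = height x\<close>.\<close>

lemma Q_half_le:
  assumes x: "x \<in> Dom" and v: "k x v < 1" and z: "cmod \<zeta> \<le> 1"
  shows "Q (base x) (\<zeta> *s ((1/2) *\<^sub>R base v)) \<le> 2 * height x"
proof -
  have "\<bar>Im (\<zeta> * support_diff (base x) v)\<bar> \<le> 1 * (2 * 1 * Im (support (base x) x))"
    by (rule order_trans[OF abs_Im_le_cmod], unfold norm_mult)
      (intro mult_mono support_diff_le[OF x v] z, auto)
  then have d: "\<bar>Im (\<zeta> * support_diff (base x) v)\<bar> \<le> 2 * height x"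
    by (simp add: Im_support)
  have e: "\<zeta> *s ((1/2) *\<^sub>R base v) = (\<zeta> / 2) *s base v"
    by (simp add: vec_eq_iff complex_eq_iff)
  have "Q (base x) ((\<zeta> / 2) *s base v) \<le> height x + Im (\<zeta> * v $ None) / 2 - DP (base x) ((\<zeta> / 2) *s base v)"
    using half_disc_closed[OF assms] unfolding Q_def height_def by simp
  also have "DP (base x) ((\<zeta> / 2) *s base v) = Im (\<zeta> * ell (base x) (base v)) / 2"
  proof -
    have "DP (base x) ((\<zeta> / 2) *s base v) = Im (ell (base x) ((\<zeta> / 2) *s base v))" by simp
    also have "\<dots> = Im (\<zeta> / 2 * ell (base x) (base v))" by (simp only: ell_smult)
    finally show ?thesis by simp
  qed
  also have "height x + Im (\<zeta> * v $ None) / 2 - Im (\<zeta> * ell (base x) (base v)) / 2 = height x + Im (\<zeta> * support_diff (base x) v) / 2"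
    unfolding support_diff_def by (simp add: algebra_simps diff_divide_distrib)
  finally show ?thesis unfolding e using d by linarith
qed

text \<open>\<open>reach o z\<close> is the height to which \<open>o\<close> must be raised to see \<open>z\<close>.\<close>

definition reach :: "complex^('d option) \<Rightarrow> complex^('d option) \<Rightarrow> real" where
  "reach o' z = max (cmod (support (base o') z - of_real (Re (support (base o') o')))) (psi (base o') (base z - base o'))"

lemma reach_self: assumes "z \<in> Dom" shows "reach z z = height z"
proof -
  have "support (base z) z - of_real (Re (support (base z) z)) = \<i> * of_real (height z)"
    using Im_support[of "base z" z] by (simp add: complex_eq_iff)
  then show ?thesis unfolding reach_def using assms by (simp add: norm_mult Dom_height)
qed

lemma reach_ge_height: "height z \<le> reach o' z"
  using abs_Im_le_cmod[of "support (base o') z - of_real (Re (support (base o') o'))"] Im_support_ge[of z "base o'"]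
  unfolding reach_def by simp

text \<open>In \<open>reach_step_unit\<close> the support entry of \<open>reach\<close> moves at
  rate \<open>2 + 4 * (1 + 2 * G) = 6 + 8 * G\<close>, and the last summand is the rate of the
  \<open>psi\<close> entry. Their sum dominates both.\<close>

definition reach_const :: real where "reach_const = 6 + 8 * G + 4 * (G * 2 ^ m * (2 + 2 * G))"

lemma reach_const_ge: "reach_const \<ge> 1" "6 + 8 * G \<le> reach_const" "4 * (G * 2 ^ m * (2 + 2 * G)) \<le> reach_const"
  unfolding reach_const_def using G1 by (auto simp: add_nonneg_nonneg)

text \<open>With \<open>F\<close> the reach of \<open>x\<close>, both entries of the maximum move at
  a rate of order \<open>F / T\<close>. For the support entry, \<open>support_diff\<close> at the
  base of \<open>o'\<close> is the one at the base of \<open>x\<close>, bounded by twice the height,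
  plus a change of \<open>ell\<close> that \<open>engulf\<close> controls. For the other entry
  \<open>engulf\<close> applies directly.\<close>

lemma reach_step_unit:
  assumes x: "x \<in> Dom" and v: "k x v < 1" and \<tau>: "0 \<le> \<tau>" "\<tau> \<le> 1/4"
    and T: "T \<ge> 1" "T ^ m * height x = reach o' x"
  shows "reach o' (x + \<tau> *\<^sub>R v) \<le> reach o' x + reach_const * \<tau> * reach o' x / T"
proof -
  define p where "p = base o'"
  define y where "y = base x - p"
  \<comment> \<open>Because of this halving, a step \<tau> along \<open>v\<close> is a step
    \<open>2 * \<tau>\<close> along \<open>w\<close>; with \<open>\<tau> \<le> 1/4\<close> and
    \<open>T \<ge> 1\<close> it meets the step condition of \<open>engulf\<close>.\<close>
  define w where "w = (1/2) *\<^sub>R base v"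
  define F where "F = reach o' x"
  have h: "0 < height x" using x Dom_height by simp
  have hF: "height x \<le> F / T"
  proof -
    \<comment> \<open>The full power \<open>T ^ m\<close> is needed for \<open>engulf\<close>; for
      the height the weaker factor \<open>T\<close> is enough.\<close>
    have "T ^ 1 \<le> T ^ m" using T(1) m1 by (intro power_increasing) auto
    then have "T * height x \<le> F"
      using T(2) h unfolding F_def by (metis mult_right_mono less_imp_le power_one_right)
    then show ?thesis using T(1) by (simp add: field_simps)
  qed
  have F0: "F > 0" using reach_ge_height[of x o'] h unfolding F_def by simp
  have py: "p + y = base x" unfolding y_def by simp
  have w: "Q (p + y) (\<zeta> *s w) \<le> 2 * height x" if "cmod \<zeta> \<le> 1" for \<zeta>
    unfolding py w_def by (rule Q_half_le[OF x v that])
  have psiy: "psi p y \<le> F" unfolding F_def reach_def p_def y_def by simp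
  note eng = engulf[of T "height x" F p y w, OF T(1) _ psiy w]
  have e1: "cmod (ell (p + y) w - ell p w) \<le> 2 * (1 + 2 * G) * F / T"
    using eng(1) T(2) unfolding F_def by simp
  have bv: "base v = 2 *\<^sub>R w" unfolding w_def by simp
  have ell2: "ell q (2 *\<^sub>R w) = 2 * ell q w" for q
    using ell_smult[of q 2 w] vector_smult_scaleR(2)[of 2 w] by simp
  have "support_diff p v = support_diff (p + y) v + 2 * (ell (p + y) w - ell p w)"
    unfolding support_diff_def bv ell2 by (simp add: algebra_simps)
  then have "cmod (support_diff p v) \<le> cmod (support_diff (p + y) v) + cmod (2 * (ell (p + y) w - ell p w))"
    by (metis norm_triangle_ineq)
  moreover have "cmod (support_diff (p + y) v) \<le> 2 * height x"
    using support_diff_le[OF x v, of "p + y"] unfolding py Im_support by simp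
  ultimately have "cmod (support_diff p v) \<le> 2 * (F / T) + 2 * (2 * (1 + 2 * G) * F / T)"
    using e1 hF unfolding norm_mult by simp
  also have "\<dots> = (6 + 8 * G) * (F / T)" by (simp add: algebra_simps add_divide_distrib)
  also have "\<dots> \<le> reach_const * (F / T)"
    using reach_const_ge(2) F0 T(1) by (intro mult_right_mono) auto
  finally have d: "cmod (support_diff p v) \<le> reach_const * (F / T)" .
  have "cmod (support p (x + \<tau> *\<^sub>R v) - of_real (Re (support p o'))) \<le> cmod (support p x - of_real (Re (support p o'))) + cmod (of_real \<tau> * support_diff p v)"
    unfolding support_add support_diff_scaleR
      using norm_triangle_ineq[of "support p x - of_real (Re (support p o'))" "of_real \<tau> * support_diff p v"]
    by (simp add: algebra_simps)
  also have "\<dots> \<le> F + \<tau> * (reach_const * (F / T))"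
    unfolding norm_mult F_def reach_def p_def[symmetric]
      using \<tau> d unfolding F_def reach_def p_def[symmetric]
    by (intro add_mono mult_mono) auto
  finally have 1: "cmod (support p (x + \<tau> *\<^sub>R v) - of_real (Re (support p o'))) \<le> F + reach_const * \<tau> * F / T"
    by (simp add: mult_ac)
  have bxy: "base (x + \<tau> *\<^sub>R v) - p = y + (2 * \<tau>) *\<^sub>R w"
    unfolding y_def by (simp add: bv)
  have "psi p (y + (2 * \<tau>) *\<^sub>R w) \<le> psi p y + 2 * (2 * \<tau> / T) * (G * 2 ^ m * (2 + 2 * G) * F)"
    by (rule eng(2)) (use T \<tau> in \<open>auto simp: F_def\<close>)
  also have "\<dots> = psi p y + 4 * (G * 2 ^ m * (2 + 2 * G)) * (\<tau> * (F / T))" by simp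
  also have "\<dots> \<le> F + reach_const * (\<tau> * (F / T))"
    using reach_const_ge(3) F0 T(1) \<tau> psiy by (intro add_mono mult_right_mono) auto
  finally have 2: "psi p (y + (2 * \<tau>) *\<^sub>R w) \<le> F + reach_const * \<tau> * F / T" by simp
  show ?thesis
    using 1 2 unfolding reach_def[of o' "x + \<tau> *\<^sub>R v"] p_def[symmetric] bxy F_def by simp
qed

lemma reach_step:
  assumes x: "x \<in> Dom" and v: "k x v < \<kappa>" and \<tau>: "0 \<le> \<tau>" "\<kappa> * \<tau> \<le> 1/4"
    and T: "T \<ge> 1" "T ^ m * height x = reach o' x"
  shows "reach o' (x + \<tau> *\<^sub>R v) \<le> reach o' x + reach_const * (\<kappa> * \<tau>) * reach o' x / T"
proof -
  have \<kappa>: "\<kappa> > 0" using v k_nonneg[OF x, of v] by linarith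
  have "k x ((1 / \<kappa>) *\<^sub>R v) \<le> 1 / \<kappa> * k x v"
    by (rule k_scaleR[OF x]) (use \<kappa> in simp)
  also have "\<dots> < 1" using v \<kappa> by (simp add: field_simps)
  finally have "k x ((1 / \<kappa>) *\<^sub>R v) < 1" .
  from reach_step_unit[OF x this _ \<tau>(2) T] \<kappa> \<tau> show ?thesis by simp
qed

end

section \<open>The potential\<close>

lemma convex_on_locally_lipschitz:
  fixes f :: "'a::euclidean_space \<Rightarrow> real"
  assumes f: "convex_on UNIV f" and C: "compact C"
  shows "\<exists>L. \<forall>x\<in>C. \<forall>y\<in>C. \<bar>f x - f y\<bar> \<le> L * dist x y"
proof -
  obtain r where r: "r > 0" "C \<subseteq> cball 0 r"
    using compact_imp_bounded[OF C] by (metis bounded_pos bounded_iff mem_cball_0 subsetI)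
  have "continuous_on UNIV f" using convex_on_continuous[OF open_UNIV f] .
  then have "compact (f ` cball 0 (r + 1))"
    by (intro compact_continuous_image) (auto intro: continuous_on_subset)
  then obtain M where "\<forall>x\<in>cball 0 (r + 1). \<bar>f x\<bar> \<le> M"
    using compact_imp_bounded[of "f ` cball 0 (r + 1)"] unfolding bounded_iff by auto
  then have M: "\<bar>f x\<bar> \<le> M" if "norm x \<le> r + 1" for x using that by simp
  have le: "f y - f x \<le> 2 * M * dist x y" if x: "x \<in> C" and y: "y \<in> C" for x y
  proof (cases "x = y")
    case False
    define d where "d = dist x y"
    have d: "d > 0" using False unfolding d_def by simp
    \<comment> \<open>\<open>z\<close> lies one unit beyond \<open>y\<close> on the ray from
      \<open>x\<close>, still in the larger ball, and \<open>y\<close> divides the segment from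
      \<open>x\<close> to \<open>z\<close> with weight \<open>d / (1 + d)\<close>.\<close>
    define z where "z = y + (1 / d) *\<^sub>R (y - x)"
    have "norm z \<le> norm y + norm ((1 / d) *\<^sub>R (y - x))" unfolding z_def by (rule norm_triangle_ineq)
    also have "norm ((1 / d) *\<^sub>R (y - x)) = 1"
      using d unfolding d_def by (simp add: dist_norm norm_minus_commute)
    finally have z: "norm z \<le> r + 1" using y r(2) by auto
    have "y = (1 - d / (1 + d)) *\<^sub>R x + (d / (1 + d)) *\<^sub>R z"
    proof -
      have "(1 + d) *\<^sub>R y = x + d *\<^sub>R z" unfolding z_def using d by (simp add: algebra_simps)
      then have "(1 / (1 + d)) *\<^sub>R ((1 + d) *\<^sub>R y) = (1 / (1 + d)) *\<^sub>R (x + d *\<^sub>R z)"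
        by simp
      moreover have "1 - d / (1 + d) = 1 / (1 + d)" using d by (simp add: field_simps)
      ultimately show ?thesis using d by (simp add: scaleR_add_right)
    qed
    then have "f y \<le> (1 - d / (1 + d)) * f x + d / (1 + d) * f z"
      using convex_onD[OF f, of "d / (1 + d)" x z] d by simp
    moreover have "(1 - s) * f x + s * f z = f x + s * (f z - f x)" for s by (simp add: algebra_simps)
    ultimately have "f y \<le> f x + d / (1 + d) * (f z - f x)" by metis
    then have "f y - f x \<le> d / (1 + d) * (f z - f x)" by linarith
    also have "\<dots> \<le> d / (1 + d) * (2 * M)"
      using M[OF z] M[of x] x r d by (intro mult_left_mono) (auto simp: abs_le_iff)
    also have "\<dots> \<le> d * (2 * M)"
      using d M[OF z] by (intro mult_right_mono) (auto simp: field_simps)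
    finally show ?thesis unfolding d_def by (simp add: mult_ac)
  qed simp
  then have "\<forall>x\<in>C. \<forall>y\<in>C. \<bar>f x - f y\<bar> \<le> 2 * M * dist x y"
    by (metis abs_le_iff dist_commute minus_diff_eq)
  then show ?thesis by blast
qed

lemma ln_lipschitz: "c > 0 \<Longrightarrow> c \<le> a \<Longrightarrow> c \<le> b \<Longrightarrow> \<bar>ln a - ln b\<bar> \<le> \<bar>a - b\<bar> / (c::real)"
proof -
  have *: "ln a - ln b \<le> \<bar>a - b\<bar> / c" if "c > 0" "c \<le> a" "c \<le> b" for a b
  proof -
    have "ln a - ln b = ln (a / b)" using that by (simp add: ln_div)
    also have "\<dots> \<le> a / b - 1" using that by (intro ln_le_minus_one) auto
    also have "\<dots> = (a - b) / b" using that by (simp add: field_simps)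
    also have "\<dots> \<le> \<bar>a - b\<bar> / c" using that by (intro frac_le) auto
    finally show ?thesis .
  qed
  assume "c > 0" "c \<le> a" "c \<le> b"
  then show ?thesis using *[of a b] *[of b a] by (simp add: abs_le_iff abs_minus_commute)
qed

text \<open>The derivative vanishes for \<open>x \<le> 0\<close> and tends to 1 exponentially fast, which is the rate at
  which the speed of \<open>log reach\<close> decays relative to that of the height.\<close>

definition transition :: "real \<Rightarrow> real \<Rightarrow> real" where
  "transition a x = max 0 x - (1 - exp (- a * max 0 x)) / a"

lemma transition_pos_deriv:
  "a > 0 \<Longrightarrow> ((\<lambda>x. x - (1 - exp (- a * x)) / a) has_real_derivative 1 - exp (- a * x)) (at x)"
  by (auto intro!: derivative_eq_intros simp: field_simps)

lemma transition_nonpos: "x \<le> 0 \<Longrightarrow> transition a x = 0"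
  unfolding transition_def by simp

lemma transition_deriv:
  assumes a: "a > 0"
  shows "(transition a has_real_derivative 1 - exp (- a * max 0 x)) (at x)"
proof -
  consider "x < 0" | "x > 0" | "x = 0" by linarith
  then show ?thesis
  proof cases
    case 1
    have "((\<lambda>x. 0) has_real_derivative 0) (at x)" by simp
    then have "(transition a has_real_derivative 0) (at x)"
      by (rule has_field_derivative_transform_within_open[of _ _ _ "{..<0}"]) (use 1 in \<open>auto simp: transition_nonpos\<close>)
    then show ?thesis using 1 by simp
  next
    case 2
    have "(transition a has_real_derivative 1 - exp (- a * x)) (at x)"
      by (rule has_field_derivative_transform_within_open[OF transition_pos_deriv[OF a], of "{0<..}"])
        (use 2 in \<open>auto simp: transition_def\<close>)
    then show ?thesis using 2 by simp
  next
    case 3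
    \<comment> \<open>At 0 the two branches meet with slope 0: the quotient
      \<open>transition a y / y\<close> is squeezed between 0 and
      \<open>1 - exp (- a * max 0 y)\<close>.\<close>
    have b: "0 \<le> transition a y \<and> transition a y \<le> max 0 y * (1 - exp (- a * max 0 y))" for y
    proof -
      define t where "t = max 0 y"
      have t: "t \<ge> 0" unfolding t_def by simp
      have e1: "1 + a * t \<le> exp (a * t)" and e2: "1 + - (a * t) \<le> exp (- (a * t))"
        by (rule exp_ge_add_one_self)+
      have "(1 + a * t) * exp (- (a * t)) \<le> 1"
        using mult_right_mono[OF e1, of "exp (- (a * t))"] by (simp add: exp_minus field_simps)
      then have "a * t * exp (- (a * t)) \<le> 1 - exp (- (a * t))" by (simp add: algebra_simps)
      then have "t - (1 - exp (- (a * t))) / a \<le> t * (1 - exp (- (a * t)))"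
        using a by (simp add: field_simps)
      moreover have "0 \<le> t - (1 - exp (- (a * t))) / a" using e2 a by (simp add: field_simps)
      ultimately show ?thesis unfolding transition_def t_def[symmetric] by simp
    qed
    have "((\<lambda>y. transition a y / y) \<longlongrightarrow> 0) (at 0)"
    proof (rule Lim_null_comparison)
      have "\<bar>transition a y / y\<bar> \<le> 1 - exp (- a * max 0 y)" if "y \<noteq> 0" for y
      proof (cases "y > 0")
        case True
        then show ?thesis using b[of y] by (simp add: abs_of_nonneg field_simps)
      next
        case False
        then show ?thesis using transition_nonpos[of y a] by simp
      qed
      then show "\<forall>\<^sub>F y in at 0. norm (transition a y / y) \<le> 1 - exp (- a * max 0 y)"
        by (auto simp: eventually_at intro: exI[of _ 1])
      have "((\<lambda>y. 1 - exp (- a * max 0 y)) \<longlongrightarrow> 1 - exp (- a * max 0 0)) (at 0)"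
        by (intro tendsto_intros)
      then show "((\<lambda>y. 1 - exp (- a * max 0 y)) \<longlongrightarrow> 0) (at 0)" by simp
    qed
    then show ?thesis unfolding has_field_derivative_iff using 3 transition_nonpos[of 0 a] by simp
  qed
qed

lemma transition_mono_lipschitz:
  assumes a: "a > 0" and xy: "x \<le> y"
  shows "transition a x \<le> transition a y" "transition a y - transition a x \<le> y - x"
proof -
  have d: "0 \<le> 1 - exp (- a * max 0 t)" "1 - exp (- a * max 0 t) \<le> 1" for t using a by auto
  show "transition a x \<le> transition a y"
    by (rule DERIV_nonneg_imp_nondecreasing[OF xy]) (use transition_deriv[OF a] d in blast)
  have "(\<lambda>t. t - transition a t) x \<le> (\<lambda>t. t - transition a t) y"
  proof (rule DERIV_nonneg_imp_nondecreasing[OF xy])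
    fix t
    have "((\<lambda>t. t - transition a t) has_real_derivative 1 - (1 - exp (- a * max 0 t))) (at t)"
      by (intro DERIV_diff DERIV_ident transition_deriv[OF a])
    then show "\<exists>D. ((\<lambda>t. t - transition a t) has_real_derivative D) (at t) \<and> 0 \<le> D"
      using d(2)[of t] by fastforce
  qed
  then show "transition a y - transition a x \<le> y - x" by simp
qed

text \<open>The deficit is the integral of \<open>exp (- a * t)\<close>, at most
  \<open>1 / a\<close>. It becomes part of the additive error of the distance estimate.\<close>

lemma transition_ge: "a > 0 \<Longrightarrow> x - 1 / a \<le> transition a x"
proof -
  assume a: "a > 0"
  show ?thesis
  proof (cases "x \<le> 0")
    case True
    moreover have "0 < 1 / a" using a by simp
    ultimately show ?thesis unfolding transition_nonpos[OF True] by linarith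
  next
    case False
    then show ?thesis using a by (simp add: transition_def field_simps)
  qed
qed

section \<open>The 1-Lipschitz potential and the lower bound for the distance\<close>

context convex_poly
begin

text \<open>It is the maximum of the modulus of an affine function and the convex function
  \<open>psi\<close>. Convexity supplies continuity and the Lipschitz bounds on compact
  sets.\<close>

lemma reach_convex: "convex_on UNIV (reach o')"
proof (rule convex_onI)
  fix t :: real and x y :: "complex^('d option)" assume t: "0 < t" "t < 1"
  define p where "p = base o'"
  define c where "c = complex_of_real (Re (support p o'))"
  let ?z = "(1 - t) *\<^sub>R x + t *\<^sub>R y"
  have uz: "support p ?z - c = of_real (1 - t) * (support p x - c) + of_real t * (support p y - c)"
  proof -
    have "?z = x + t *\<^sub>R (y - x)" by (simp add: algebra_simps)
    then have "support p ?z = support p x + of_real t * support_diff p (y - x)"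
      by (simp only: support_add support_diff_scaleR)
    moreover have "support p y = support p x + support_diff p (y - x)"
      using support_add[of p x "y - x"] by simp
    ultimately show ?thesis by (simp add: algebra_simps)
  qed
  have "cmod (support p ?z - c) \<le> (1 - t) * cmod (support p x - c) + t * cmod (support p y - c)"
    unfolding uz using t by (intro order_trans[OF norm_triangle_ineq]) (simp add: norm_mult del: of_real_diff)
  also have "\<dots> \<le> (1 - t) * reach o' x + t * reach o' y"
    using t unfolding reach_def p_def c_def by (intro add_mono mult_left_mono) auto
  finally have 1: "cmod (support p ?z - c) \<le> (1 - t) * reach o' x + t * reach o' y" .
  have bz: "base ?z - p = (1 - t) *\<^sub>R (base x - p) + t *\<^sub>R (base y - p)"
    by (simp add: algebra_simps)
  have "psi p (base ?z - p) \<le> (1 - t) * psi p (base x - p) + t * psi p (base y - p)"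
    unfolding bz using t by (intro psi_convexD) auto
  also have "\<dots> \<le> (1 - t) * reach o' x + t * reach o' y"
    using t unfolding reach_def p_def by (intro add_mono mult_left_mono) auto
  finally have 2: "psi p (base ?z - p) \<le> (1 - t) * reach o' x + t * reach o' y" .
  show "reach o' ?z \<le> (1 - t) * reach o' x + t * reach o' y"
    using 1 2 unfolding reach_def[of o' ?z] p_def[symmetric] c_def[symmetric] by simp
qed auto

text \<open>With \<open>X = ln reach - ln height\<close>, the factor \<open>T\<close> of
  \<open>reach_step\<close> is \<open>exp (rate * X)\<close>, so its relative speed
  \<open>reach_const / T\<close> is \<open>exp (- rate * (X - threshold))\<close>. At the threshold
  this speed is 1; beyond it, the speed is exactly the deficit of the derivative of
  \<open>transition\<close>.\<close>

definition threshold :: real where "threshold = real m * ln reach_const"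
definition rate :: real where "rate = 1 / real m"

lemma rate_pos: "rate > 0" unfolding rate_def using m1 by simp
lemma threshold_nonneg: "threshold \<ge> 0" unfolding threshold_def using reach_const_ge(1) by simp
lemma exp_rate_threshold: "exp (rate * threshold) = reach_const"
  unfolding rate_def threshold_def using m1 reach_const_ge(1) by simp

text \<open>The potential is half the logarithm of the height while \<open>reach\<close> and \<open>height\<close> are comparable; beyond
  the threshold, where \<open>log reach\<close> moves slowly, it becomes \<open>log reach - (log height) / 2\<close>.\<close>

definition Phi :: "complex^('d option) \<Rightarrow> complex^('d option) \<Rightarrow> real" where
  "Phi o' z = ln (height z) / 2 + transition rate (ln (reach o' z) - ln (height z) - threshold)"

lemma height_deriv: "((\<lambda>\<tau>. height (x + \<tau> *\<^sub>R v)) has_real_derivative Im (support_diff (base x) v)) (at 0)"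
proof -
  have "((\<lambda>t. P (base x + t *\<^sub>R base v)) has_derivative (\<lambda>t. DP (base x) (t *\<^sub>R base v))) (at 0)"
    by (rule has_derivative_compose[of "\<lambda>t. base x + t *\<^sub>R base v" "\<lambda>t. t *\<^sub>R base v" 0 UNIV P "DP (base x)"])
      (auto intro!: derivative_eq_intros deriv)
  then have P': "((\<lambda>t. P (base x + t *\<^sub>R base v)) has_real_derivative DP (base x) (base v)) (at 0)"
    by (simp add: has_field_derivative_def DP_simps mult_commute_abs)
  have "((\<lambda>t. Im (x $ None) + t * Im (v $ None) - P (base x + t *\<^sub>R base v)) has_real_derivative
      Im (v $ None) - DP (base x) (base v)) (at 0)"
    by (rule DERIV_diff[OF _ P']) (auto intro!: derivative_eq_intros)
  then show ?thesis unfolding height_def support_diff_def by simp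
qed

text \<open>\<open>ln reach\<close> has only a one-sided bound from \<open>reach_step\<close>.
  Replacing it by the affine majorant \<open>A\<close> gives a function \<open>f\<close> that lies
  above the potential, equals it at 0 and is differentiable there, so a slope of \<open>f\<close>
  below \<kappa> suffices.\<close>

lemma Phi_dini:
  assumes x: "x \<in> Dom" and kv: "k x v < \<kappa>"
  shows "\<exists>\<delta>>0. \<forall>\<tau>. 0 < \<tau> \<longrightarrow> \<tau> < \<delta> \<longrightarrow> Phi o' (x + \<tau> *\<^sub>R v) \<le> Phi o' x + \<kappa> * \<tau>"
proof -
  \<comment> \<open>The intermediate value makes the slope at 0 strictly less than \<kappa>, so the
    estimate persists for small positive \<tau>.\<close>
  obtain \<kappa>0 where \<kappa>0: "k x v < \<kappa>0" "\<kappa>0 < \<kappa>" using dense[OF kv] by blast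
  have \<kappa>0p: "\<kappa>0 > 0" using \<kappa>0(1) k_nonneg[OF x, of v] by linarith
  define h where "h = height x"
  define F where "F = reach o' x"
  have h: "h > 0" using x Dom_height unfolding h_def by simp
  have F: "h \<le> F" using reach_ge_height unfolding h_def F_def by simp
  define X where "X = ln F - ln h"
  \<comment> \<open>With this choice \<open>T ^ m\<close> is the ratio of reach to height, as
    \<open>reach_step\<close> requires.\<close>
  define T where "T = exp (rate * X)"
  have X0: "X \<ge> 0" unfolding X_def using h F by simp
  have T1: "T \<ge> 1" unfolding T_def using X0 rate_pos by simp
  have Tm: "T ^ m * h = F"
  proof -
    have "T ^ m = exp (real m * (rate * X))" unfolding T_def by (simp add: exp_of_nat_mult)
    also have "real m * (rate * X) = X" unfolding rate_def using m1 by simp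
    also have "exp X = F / h" unfolding X_def using h F by (simp add: exp_diff)
    finally show ?thesis using h by simp
  qed
  define A where "A \<tau> = ln F + reach_const * (\<kappa>0 * \<tau>) / T" for \<tau>
  define B where "B \<tau> = ln (height (x + \<tau> *\<^sub>R v))" for \<tau>
  define f where "f \<tau> = B \<tau> / 2 + transition rate (A \<tau> - B \<tau> - threshold)" for \<tau>
  define b where "b = Im (support_diff (base x) v) / h"
  have "\<bar>Im (support_diff (base x) v)\<bar> \<le> 2 * \<kappa>0 * h"
    using abs_Im_le_cmod[of "support_diff (base x) v"] support_diff_le[OF x \<kappa>0(1), of "base x"]
      unfolding Im_support h_def by simp
  then have b: "\<bar>b\<bar> \<le> 2 * \<kappa>0" unfolding b_def using h by (simp add: field_simps)
  define \<epsilon> where "\<epsilon> = exp (- rate * max 0 (X - threshold))"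
  have \<epsilon>: "0 < \<epsilon>" "\<epsilon> \<le> 1" unfolding \<epsilon>_def using rate_pos by auto
  \<comment> \<open>Below the threshold both sides are 0; above it \<open>reach_const / T\<close>
    equals \<epsilon>.\<close>
  have CT: "(1 - \<epsilon>) * (reach_const / T) \<le> (1 - \<epsilon>) * \<epsilon>"
  proof (cases "X \<le> threshold")
    case True
    then show ?thesis unfolding \<epsilon>_def by simp
  next
    case False
    then have "\<epsilon> = exp (rate * threshold) / exp (rate * X)"
      unfolding \<epsilon>_def by (simp add: exp_diff[symmetric] algebra_simps)
    then show ?thesis unfolding exp_rate_threshold T_def by simp
  qed
  have dB: "(B has_real_derivative b) (at 0)"
    unfolding B_def[abs_def] b_def h_def using height_deriv[of x v] h unfolding h_def
    by (auto intro!: derivative_eq_intros)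
  have dA: "(A has_real_derivative reach_const * \<kappa>0 / T) (at 0)"
    unfolding A_def[abs_def] using T1 by (auto intro!: derivative_eq_intros)
  have AB0: "A 0 - B 0 - threshold = X - threshold" unfolding A_def B_def X_def h_def by simp
  have "((\<lambda>\<tau>. A \<tau> - B \<tau> - threshold) has_real_derivative reach_const * \<kappa>0 / T - b) (at 0)"
    using DERIV_diff[OF DERIV_diff[OF dA dB] DERIV_const[of threshold]] by simp
  from DERIV_chain2[of "transition rate" _ "\<lambda>\<tau>. A \<tau> - B \<tau> - threshold", OF transition_deriv[OF rate_pos] this]
  have "((\<lambda>\<tau>. transition rate (A \<tau> - B \<tau> - threshold)) has_real_derivative (1 - \<epsilon>) * (reach_const * \<kappa>0 / T - b)) (at 0)"
    unfolding AB0 \<epsilon>_def .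
  then have df: "(f has_real_derivative b / 2 + (1 - \<epsilon>) * (reach_const * \<kappa>0 / T - b)) (at 0)"
    unfolding f_def[abs_def] by (intro DERIV_add DERIV_cdivide dB)
  have "b / 2 + (1 - \<epsilon>) * (reach_const * \<kappa>0 / T - b) = \<kappa>0 * ((1 - \<epsilon>) * (reach_const / T)) + (\<epsilon> - 1/2) * b"
    by (simp add: algebra_simps)
  also have "\<dots> \<le> \<kappa>0 * ((1 - \<epsilon>) * \<epsilon>) + \<bar>\<epsilon> - 1/2\<bar> * (2 * \<kappa>0)"
  proof (rule add_mono)
    show "\<kappa>0 * ((1 - \<epsilon>) * (reach_const / T)) \<le> \<kappa>0 * ((1 - \<epsilon>) * \<epsilon>)"
      using mult_left_mono[OF CT less_imp_le[OF \<kappa>0p]] .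
    have "(\<epsilon> - 1/2) * b \<le> \<bar>(\<epsilon> - 1/2) * b\<bar>" by simp
    also have "\<dots> \<le> \<bar>\<epsilon> - 1/2\<bar> * (2 * \<kappa>0)"
      unfolding abs_mult using b by (intro mult_left_mono) auto
    finally show "(\<epsilon> - 1/2) * b \<le> \<bar>\<epsilon> - 1/2\<bar> * (2 * \<kappa>0)" .
  qed
  also have "\<dots> = \<kappa>0 * ((1 - \<epsilon>) * \<epsilon> + \<bar>2 * \<epsilon> - 1\<bar>)"
    by (simp add: algebra_simps abs_if)
  also have "\<dots> \<le> \<kappa>0 * 1"
  proof (rule mult_left_mono)
    \<comment> \<open>The product is at most the smaller of \<epsilon> and 1 - \<epsilon>, while |2
      \<epsilon> - 1| is 1 minus twice that number.\<close>
    have "(1 - \<epsilon>) * \<epsilon> \<le> 1 - \<epsilon>" "(1 - \<epsilon>) * \<epsilon> \<le> \<epsilon>"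
      using \<epsilon> by (auto intro: mult_left_le mult_left_le_one_le)
    then show "(1 - \<epsilon>) * \<epsilon> + \<bar>2 * \<epsilon> - 1\<bar> \<le> 1"
      using \<epsilon> by (auto simp: abs_if)
  qed (use \<kappa>0p in simp)
  also have "\<dots> < \<kappa>" using \<kappa>0(2) by simp
  finally have slope: "b / 2 + (1 - \<epsilon>) * (reach_const * \<kappa>0 / T - b) < \<kappa>" .
  have "((\<lambda>\<tau>. (f \<tau> - f 0) / (\<tau> - 0)) \<longlongrightarrow> b / 2 + (1 - \<epsilon>) * (reach_const * \<kappa>0 / T - b)) (at 0)"
    using df unfolding has_field_derivative_iff by simp
  then have "\<forall>\<^sub>F \<tau> in at 0. (f \<tau> - f 0) / (\<tau> - 0) < \<kappa>"
    using slope by (rule order_tendstoD(2))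
  then obtain d1 where d1: "d1 > 0" "\<And>\<tau>. \<tau> \<noteq> 0 \<Longrightarrow> \<bar>\<tau>\<bar> < d1 \<Longrightarrow> (f \<tau> - f 0) / \<tau> < \<kappa>"
    by (auto simp: eventually_at dist_real_def)
  have "\<forall>\<^sub>F \<tau> in at 0. 0 < height (x + \<tau> *\<^sub>R v)"
  proof -
    have "isCont (\<lambda>\<tau>. height (x + \<tau> *\<^sub>R v)) 0" by (rule DERIV_isCont[OF height_deriv])
    then have "((\<lambda>\<tau>. height (x + \<tau> *\<^sub>R v)) \<longlongrightarrow> h) (at 0)"
      unfolding isCont_def h_def by simp
    then show ?thesis using h by (rule order_tendstoD(1))
  qed
  then obtain d2 where d2: "d2 > 0" "\<And>\<tau>. \<tau> \<noteq> 0 \<Longrightarrow> \<bar>\<tau>\<bar> < d2 \<Longrightarrow> 0 < height (x + \<tau> *\<^sub>R v)"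
    by (auto simp: eventually_at dist_real_def)
  define \<delta> where "\<delta> = min (min d1 d2) (1 / (4 * \<kappa>0))"
  have "Phi o' (x + \<tau> *\<^sub>R v) \<le> Phi o' x + \<kappa> * \<tau>" if \<tau>: "0 < \<tau>" "\<tau> < \<delta>" for \<tau>
  proof -
    have "\<tau> < 1 / (4 * \<kappa>0)" using \<tau> unfolding \<delta>_def by simp
    then have "\<kappa>0 * \<tau> \<le> 1/4" using \<kappa>0p by (simp add: field_simps)
    then have "reach o' (x + \<tau> *\<^sub>R v) \<le> F + reach_const * (\<kappa>0 * \<tau>) * F / T"
      using reach_step[OF x \<kappa>0(1), of \<tau> T o'] T1 Tm \<tau> unfolding F_def h_def by simp
    also have "\<dots> = F * (1 + reach_const * (\<kappa>0 * \<tau>) / T)" by (simp add: algebra_simps)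
    finally have reach: "reach o' (x + \<tau> *\<^sub>R v) \<le> F * (1 + reach_const * (\<kappa>0 * \<tau>) / T)" .
    have height: "0 < height (x + \<tau> *\<^sub>R v)"
      using d2(2)[of \<tau>] \<tau> unfolding \<delta>_def by simp
    have FF0: "0 < reach o' (x + \<tau> *\<^sub>R v)"
      using height reach_ge_height[of "x + \<tau> *\<^sub>R v" o'] by linarith
    have s0: "0 \<le> reach_const * (\<kappa>0 * \<tau>) / T"
      using reach_const_ge(1) \<kappa>0p \<tau> T1 by simp
    have "ln (reach o' (x + \<tau> *\<^sub>R v)) \<le> ln (F * (1 + reach_const * (\<kappa>0 * \<tau>) / T))"
      using reach FF0 by simp
    also have "\<dots> = ln F + ln (1 + reach_const * (\<kappa>0 * \<tau>) / T)"
      using h F s0 by (intro ln_mult_pos) auto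
    also have "\<dots> \<le> A \<tau>" unfolding A_def using ln_add_one_self_le_self[OF s0] by simp
    finally have "ln (reach o' (x + \<tau> *\<^sub>R v)) \<le> A \<tau>" .
    then have "Phi o' (x + \<tau> *\<^sub>R v) \<le> f \<tau>"
      unfolding Phi_def f_def B_def by (intro add_left_mono transition_mono_lipschitz(1)[OF rate_pos]) simp
    moreover have "f 0 = Phi o' x" unfolding f_def AB0 Phi_def by (simp add: B_def X_def F_def h_def)
    moreover have "(f \<tau> - f 0) / \<tau> < \<kappa>"
      using d1(2)[of \<tau>] \<tau> unfolding \<delta>_def by simp
    ultimately show ?thesis using \<tau>(1) by (simp add: field_simps)
  qed
  moreover have "\<delta> > 0" unfolding \<delta>_def using d1(1) d2(1) \<kappa>0p by simp
  ultimately show ?thesis by blast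
qed

lemma Phi_lipschitz:
  assumes C: "compact C" "C \<subseteq> Dom"
  shows "\<exists>L. \<forall>x\<in>C. \<forall>y\<in>C. \<bar>Phi o' x - Phi o' y\<bar> \<le> L * dist x y"
proof (cases "C = {}")
  case False
  obtain z where z: "z \<in> C" "\<And>x. x \<in> C \<Longrightarrow> height z \<le> height x"
    using continuous_attains_inf[OF C(1) False continuous_height] by blast
  define c where "c = height z"
  have c: "c > 0" using z(1) C(2) Dom_height unfolding c_def by auto
  have "convex_on UNIV (\<lambda>z. - height z)"
  proof (rule convex_onI)
    fix t x y assume "0 < t" "t < (1::real)"
    then show "- height ((1 - t) *\<^sub>R x + t *\<^sub>R y) \<le> (1 - t) * - height x + t * - height y"
      using height_concave[of t x y] by simp
  qed auto
  from convex_on_locally_lipschitz[OF this C(1)] obtain L1 where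
    L1: "\<And>x y. x \<in> C \<Longrightarrow> y \<in> C \<Longrightarrow> \<bar>- height x - - height y\<bar> \<le> L1 * dist x y"
      by blast
  obtain L2 where L2: "\<And>x y. x \<in> C \<Longrightarrow> y \<in> C \<Longrightarrow> \<bar>reach o' x - reach o' y\<bar> \<le> L2 * dist x y"
    using convex_on_locally_lipschitz[OF reach_convex C(1), of o'] by blast
  \<comment> \<open>The logarithm of the height enters with weight 1/2 and again with weight 1
    inside the 1-Lipschitz \<open>transition\<close>, hence 3/2.\<close>
  have "\<bar>Phi o' x - Phi o' y\<bar> \<le> ((3/2) * (L1 / c) + L2 / c) * dist x y" if xy: "x \<in> C" "y \<in> C" for x y
  proof -
    have hx: "c \<le> height x" "c \<le> height y" using z xy unfolding c_def by auto
    have "\<bar>ln (height x) - ln (height y)\<bar> \<le> \<bar>height x - height y\<bar> / c"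
      using ln_lipschitz[OF c] hx by simp
    also have "\<dots> \<le> L1 * dist x y / c"
      using L1[OF xy] c by (intro divide_right_mono) (auto simp: abs_minus_commute)
    finally have 1: "\<bar>ln (height x) - ln (height y)\<bar> \<le> L1 / c * dist x y" by simp
    have "\<bar>ln (reach o' x) - ln (reach o' y)\<bar> \<le> \<bar>reach o' x - reach o' y\<bar> / c"
      using ln_lipschitz[OF c] hx reach_ge_height[of x o'] reach_ge_height[of y o'] by simp
    also have "\<dots> \<le> L2 * dist x y / c" using L2[OF xy] c by (intro divide_right_mono) auto
    finally have 2: "\<bar>ln (reach o' x) - ln (reach o' y)\<bar> \<le> L2 / c * dist x y" by simp
    have tl: "\<bar>transition rate s - transition rate t\<bar> \<le> \<bar>s - t\<bar>" for s t
      using transition_mono_lipschitz[OF rate_pos, of s t] transition_mono_lipschitz[OF rate_pos, of t s]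
      by (cases "s \<le> t") auto
    show ?thesis
      using 1 2 tl[of "ln (reach o' x) - ln (height x) - threshold" "ln (reach o' y) - ln (height y) - threshold"]
      unfolding Phi_def by (simp add: algebra_simps abs_le_iff) linarith
  qed
  then show ?thesis by blast
qed simp

text \<open>The summand \<open>m\<close> is \<open>1 / rate\<close>, the deficit allowed by
  \<open>transition_ge\<close>; the threshold is the shift inside the potential.\<close>

definition lower_const :: real where "lower_const = threshold + real m"

text \<open>The potential is taken with reference point \<open>x\<close>. At \<open>x\<close> reach
  and height agree, so \<open>transition\<close> vanishes there, while at \<open>y\<close> it is
  bounded below by \<open>transition_ge\<close>.\<close>

lemma reach_le_K:
  assumes "x \<in> Dom" "y \<in> Dom"
  shows "ln (reach x y) \<le> K x y + ln (height x) / 2 + ln (height y) / 2 + lower_const"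
proof -
  have "Phi x y - Phi x x \<le> K x y"
    by (rule K_lipschitz[OF Phi_lipschitz Phi_dini assms])
  moreover have "Phi x x = ln (height x) / 2"
    unfolding Phi_def reach_self[OF assms(1)] using threshold_nonneg by (simp add: transition_nonpos)
  moreover have "ln (reach x y) - ln (height y) - threshold - 1 / rate \<le> transition rate (ln (reach x y) - ln (height y) - threshold)"
    by (rule transition_ge[OF rate_pos])
  moreover have "1 / rate = real m" unfolding rate_def by simp
  ultimately show ?thesis unfolding Phi_def lower_const_def by simp
qed

end

section \<open>Gromov hyperbolicity\<close>

context convex_poly
begin

text \<open>Vertical lines lie in slices isometric to a half plane.\<close>

lemma k_vertical:
  assumes x: "x \<in> Dom" and t: "t \<ge> 0"
  shows "k x (fibre (\<i> * of_real (t * height x))) \<le> t / 2"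
proof -
  define h where "h = height x"
  have h: "h > 0" using x Dom_height unfolding h_def by simp
  \<comment> \<open>This maps the disc conformally onto the half plane Im > -h, fixes 0 and has
    derivative 2 i h there. The given vertical vector is t/2 times this derivative.\<close>
  define g where "g \<zeta> = 2 * \<i> * of_real h * (\<zeta> / (1 - \<zeta>))" for \<zeta> :: complex
  have nz: "1 - \<zeta> \<noteq> 0" if "cmod \<zeta> < 1" for \<zeta> :: complex using that by auto
  have g: "Im (g \<zeta>) > - h" if z: "cmod \<zeta> < 1" for \<zeta>
  proof -
    \<comment> \<open>Inversion maps the disc |1 - u| < 1 onto the half plane where the real part
      exceeds 1/2.\<close>
    have "Re (\<zeta> / (1 - \<zeta>)) > - 1/2"
    proof -
      define u where "u = 1 - \<zeta>"
      have u0: "u \<noteq> 0" unfolding u_def by (rule nz[OF z])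
      have "(cmod \<zeta>)\<^sup>2 < 1" using z by (simp add: abs_square_less_1)
      moreover have "(cmod \<zeta>)\<^sup>2 = 1 - 2 * Re u + ((Re u)\<^sup>2 + (Im u)\<^sup>2)"
        unfolding cmod_power2 u_def by (simp add: power2_eq_square algebra_simps)
      ultimately have "(Re u)\<^sup>2 + (Im u)\<^sup>2 < 2 * Re u" by linarith
      moreover have "0 < (Re u)\<^sup>2 + (Im u)\<^sup>2"
        using u0 by (metis cmod_power2 zero_less_norm_iff zero_less_power)
      ultimately have "1/2 < Re u / ((Re u)\<^sup>2 + (Im u)\<^sup>2)" by (simp add: field_simps)
      then have "1/2 < Re (1 / u)" by (simp add: Re_divide)
      moreover have "\<zeta> / (1 - \<zeta>) = 1 / u - 1" using u0 unfolding u_def by (simp add: field_simps)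
      ultimately show ?thesis by simp
    qed
    moreover have "Im (g \<zeta>) = 2 * h * Re (\<zeta> / (1 - \<zeta>))"
    proof -
      have "g \<zeta> = of_real (2 * h) * (\<i> * (\<zeta> / (1 - \<zeta>)))" unfolding g_def by simp
      then show ?thesis
        by (simp only: Im_complex_of_real Re_complex_of_real times_complex.sel imaginary_unit.sel) simp
    qed
    ultimately show ?thesis
      using mult_strict_left_mono[of "- 1/2" "Re (\<zeta> / (1 - \<zeta>))" "2 * h"] h by simp
  qed
  define f where "f \<zeta> = x + fibre (g \<zeta>)" for \<zeta>
  have fi: "f \<zeta> $ j = x $ j + (if j = None then g \<zeta> else 0)" for \<zeta> j
    unfolding f_def fibre_def by (cases j) auto
  have holg: "g holomorphic_on ball 0 1" unfolding g_def using nz by (auto intro!: holomorphic_intros)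
  have dg: "(g has_field_derivative 2 * \<i> * of_real h) (at 0)"
    unfolding g_def by (auto intro!: derivative_eq_intros)
  have "disc x (of_real (t / 2) *s fibre (2 * \<i> * of_real h)) (of_real (t / 2)) f"
    unfolding disc_def
  proof (intro conjI)
    show "holomorphic_map f (ball 0 1)"
      unfolding holomorphic_map_def
    proof
      fix j show "(\<lambda>z. f z $ j) holomorphic_on ball 0 1"
        unfolding fi by (cases "j = None") (auto intro!: holomorphic_intros holg)
    qed
    show "f ` ball 0 1 \<subseteq> Dom"
    proof (clarify)
      fix \<zeta> :: complex assume "\<zeta> \<in> ball 0 1"
      then have "- h < Im (g \<zeta>)" using g by simp
      moreover have "height (f \<zeta>) = h + Im (g \<zeta>)" unfolding f_def h_def height_def by simp
      ultimately show "f \<zeta> \<in> Dom" unfolding Dom_height by simp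
    qed
    show "f 0 = x" unfolding f_def g_def by simp
    have "deriv (\<lambda>z. f z $ j) 0 = fibre (2 * \<i> * of_real h) $ j" for j
      by (rule DERIV_imp_deriv) (cases j, auto intro!: derivative_eq_intros dg simp: fi fibre_def)
    then show "of_real (t / 2) *s (\<chi> i. deriv (\<lambda>z. f z $ i) 0) = of_real (t / 2) *s fibre (2 * \<i> * of_real h)"
      by (simp add: vec_eq_iff)
  qed
  from k_le[OF this] have "k x (of_real (t / 2) *s fibre (2 * \<i> * of_real h)) \<le> t / 2"
    using t by (simp del: of_real_divide)
  moreover have "of_real (t / 2) *s fibre (2 * \<i> * of_real h) = (fibre (\<i> * of_real (t * h)) :: complex^('d option))"
    unfolding fibre_arith(2)[symmetric] by (simp add: mult_ac)
  ultimately show ?thesis unfolding h_def by simp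
qed

definition raise :: "complex^('d option) \<Rightarrow> real \<Rightarrow> complex^('d option)" where
  "raise z t = z + fibre (\<i> * of_real t)"

lemma raise_simps: "height (raise z t) = height z + t" "base (raise z t) = base z" "raise z 0 = z" "raise (raise z s) t = raise z (s + t)"
  unfolding raise_def height_def by (auto simp: fibre_arith(1)[symmetric] algebra_simps)

lemma support_raise: "support p (raise z t) = support p z + \<i> * of_real t"
  unfolding raise_def support_add support_diff_def using ell_smult[of p 0 0] by simp

text \<open>Parametrizing the vertical segment so that the height grows like \<open>exp s\<close>
  gives it Kobayashi speed at most 1/2 throughout.\<close>

lemma K_raise:
  assumes z: "z \<in> Dom" and t: "t \<ge> 0"
  shows "K z (raise z t) \<le> ln ((height z + t) / height z) / 2"
proof -
  define h where "h = height z"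
  have h: "h > 0" using z Dom_height unfolding h_def by simp
  define L where "L = ln ((h + t) / h)"
  have L: "L \<ge> 0" unfolding L_def using h t by simp
  define \<sigma> where "\<sigma> s = raise z (h * (exp s - 1))" for s
  have hts: "height (\<sigma> s) = h * exp s" for s
    unfolding \<sigma>_def raise_simps h_def by (simp add: algebra_simps)
  have dom: "\<sigma> s \<in> Dom" for s unfolding Dom_height hts using h by simp
  have "K (\<sigma> 0) (\<sigma> L) \<le> 1 / 2 * (L - 0)"
  proof (rule K_curve_bound)
    show "admissible 0 L \<sigma>"
      unfolding admissible_def
    proof (intro conjI)
      have le: "dist (\<sigma> s) (\<sigma> t) \<le> h * exp L * (t - s)" if "0 \<le> s" "s \<le> t" "t \<le> L" for s t
      proof -
        have "\<sigma> t - \<sigma> s = fibre (\<i> * of_real (h * (exp t - exp s)))"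
          unfolding \<sigma>_def raise_def
            by (simp add: vec_eq_iff fibre_def algebra_simps split: option.split)
        then have "dist (\<sigma> s) (\<sigma> t) = cmod (\<i> * of_real (h * (exp t - exp s)))"
          using norm_minus_commute[of "\<sigma> s" "\<sigma> t"]
            unfolding dist_norm by (simp only: norm_fibre)
        also have "\<dots> = h * (exp t - exp s)"
          unfolding norm_mult norm_of_real using that h by simp
        finally have "dist (\<sigma> s) (\<sigma> t) = h * (exp t - exp s)" .
        also have "exp t - exp s \<le> exp L * (t - s)"
        proof -
          have "exp t - exp s = exp t * (1 - exp (s - t))" by (simp add: exp_diff algebra_simps)
          also have "\<dots> \<le> exp t * (t - s)"
          proof (rule mult_left_mono)
            have "1 + (s - t) \<le> exp (s - t)" by (rule exp_ge_add_one_self)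
            then show "1 - exp (s - t) \<le> t - s" by linarith
          qed simp
          also have "\<dots> \<le> exp L * (t - s)" using that by (intro mult_right_mono) auto
          finally show ?thesis .
        qed
        finally show ?thesis using h by (simp add: mult.assoc)
      qed
      show "absolutely_continuous_curve 0 L \<sigma>"
      proof (rule lipschitz_imp_absolutely_continuous_curve[of _ _ _ "h * exp L"])
        fix s t assume "s \<in> {0..L}" "t \<in> {0..L}"
        then show "dist (\<sigma> s) (\<sigma> t) \<le> h * exp L * \<bar>s - t\<bar>"
          using le[of s t] le[of t s] by (cases "s \<le> t") (auto simp: dist_commute)
      qed
    qed (use L dom in auto)
    fix s
    have e: "fibre (\<i> * of_real r) = r *\<^sub>R (fibre \<i> :: complex^('d option))" for r :: real
      unfolding fibre_arith(3)[symmetric] by (simp add: scaleR_conv_of_real mult.commute)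
    show "(\<sigma> has_vector_derivative fibre (\<i> * of_real (1 * height (\<sigma> s)))) (at s)"
      unfolding hts unfolding e \<sigma>_def[abs_def] raise_def has_vector_derivative_def
      by (auto intro!: derivative_eq_intros simp: mult_ac)
    show "k (\<sigma> s) (fibre (\<i> * of_real (1 * height (\<sigma> s)))) \<le> 1 / 2"
      using k_vertical[OF dom, of 1] by simp
  qed simp
  moreover have "\<sigma> 0 = z" unfolding \<sigma>_def by (simp add: raise_simps)
  moreover have "\<sigma> L = raise z t"
  proof -
    have "exp L = (h + t) / h" unfolding L_def using h t by simp
    then have "h * (exp L - 1) = t" using h by (simp add: field_simps)
    then show ?thesis unfolding \<sigma>_def by simp
  qed
  ultimately show ?thesis unfolding L_def h_def by simp
qed

text \<open>In units of \<open>R\<close>, a disc of radius 2 lowers the support value by at most 2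
  and costs at most \<open>G * 2 ^ m\<close> through \<open>psi\<close>; the remaining 1 keeps the
  height positive.\<close>

definition upper_const :: real where "upper_const = 3 + G * 2 ^ m"

text \<open>After raising both points further, by a bounded factor in height, an affine disc of
  radius 2 centred at the first one contains the segment to the second and lies in the domain. The
  segment then has length at most 1, and \<open>K_raise\<close> bounds the cost of the extra
  ascent.\<close>

lemma K_raised_le:
  assumes o': "x \<in> Dom" and y: "y \<in> Dom" and R: "height x \<le> R" "height y \<le> R" and F: "reach x y \<le> R"
  shows "K (raise x (R - height x)) (raise y (R - height y)) \<le> 1 + ln (upper_const + 1)"
proof -
  have h: "0 < height x" "0 < height y" using o' y Dom_height by auto
  then have R0: "R > 0" using R by linarith
  have upper_const: "upper_const \<ge> 1" unfolding upper_const_def using G1 by simp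
  define p where "p = base x"
  define a1 where "a1 = raise x (upper_const * R - height x)"
  \<comment> \<open>Raised by \<open>upper_const * R\<close> instead of to that height,
    \<open>a2\<close> differs from \<open>a1\<close> under \<open>support p\<close> by exactly the
    quantity whose modulus occurs in \<open>reach x y\<close>.\<close>
  define a2 where "a2 = raise y (upper_const * R)"
  have Rc: "R \<le> upper_const * R" using upper_const R0 by simp
  define v where "v = a2 - a1"
  define w where "w = base y - p"
  have bv: "base v = w" unfolding v_def w_def a1_def a2_def by (simp add: raise_simps p_def)
  have ba1: "base a1 = p" unfolding a1_def p_def by (simp add: raise_simps)
  have hta1: "height a1 = upper_const * R" "height a2 = height y + upper_const * R"
    unfolding a1_def a2_def by (simp_all add: raise_simps)
  have dv: "support_diff p v = support p y - of_real (Re (support p x))"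
  proof -
    have "support p a2 = support p a1 + support_diff p v" unfolding support_add[symmetric] v_def by simp
    moreover have "support p a1 = of_real (Re (support p x)) + \<i> * of_real (upper_const * R)"
      using Im_support[of p x] unfolding a1_def support_raise by (simp add: complex_eq_iff p_def)
    ultimately show ?thesis unfolding a2_def support_raise by (simp add: algebra_simps)
  qed
  have dvb: "cmod (support_diff p v) \<le> R" and psiw: "psi p w \<le> R"
    unfolding dv using F unfolding reach_def w_def p_def by auto
  \<comment> \<open>Radius 2 leaves a unit disc in direction \<open>v\<close> around every point of
    the segment, so \<open>k\<close> is at most 1 along it.\<close>
  have dom: "a1 + \<zeta> *s v \<in> Dom" if z: "cmod \<zeta> \<le> 2" for \<zeta>
  proof -
    have "Q p (\<zeta> *s w) \<le> psi p (2 *\<^sub>R w)"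
    proof -
      have "cmod (\<zeta> / 2) \<le> 1" using z by (simp add: norm_divide)
      from psi_upper[OF this, of p "2 *\<^sub>R w"] show ?thesis
        by (simp add: vector_smult_scaleR(2)[of 2 w, symmetric, simplified])
    qed
    also have "\<dots> \<le> G * psi p w * 2 ^ m" by (rule psi_growth) simp
    also have "\<dots> \<le> G * R * 2 ^ m" using psiw G1 by (intro mult_right_mono mult_left_mono) auto
    finally have q: "Q p (\<zeta> *s w) \<le> G * 2 ^ m * R" by (simp add: mult_ac)
    have "\<bar>Im (\<zeta> * support_diff p v)\<bar> \<le> 2 * R"
      by (rule order_trans[OF abs_Im_le_cmod], unfold norm_mult) (intro mult_mono z dvb, auto)
    moreover have "height (a1 + \<zeta> *s v) = Im (support p (a1 + \<zeta> *s v)) - Q p (\<zeta> *s w)"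
      unfolding Im_support by (simp add: ba1 bv)
    moreover have "Im (support p (a1 + \<zeta> *s v)) = upper_const * R + Im (\<zeta> * support_diff p v)"
      unfolding support_add support_diff_smult plus_complex.sel Im_support[of p a1] hta1 ba1 by simp
    ultimately have "height (a1 + \<zeta> *s v) \<ge> upper_const * R - 2 * R - G * 2 ^ m * R"
      using q by linarith
    also have "upper_const * R - 2 * R - G * 2 ^ m * R = R"
      unfolding upper_const_def by (simp add: algebra_simps)
    finally show ?thesis using R0 by (simp add: Dom_height)
  qed
  have seg: "K a1 (a1 + v) \<le> 1"
  proof (rule K_segment_le)
    fix s :: real assume s: "s \<in> {0..1}"
    have sv: "s *\<^sub>R v = of_real s *s v" by (simp add: vector_smult_scaleR)
    show "a1 + s *\<^sub>R v \<in> Dom" unfolding sv by (rule dom) (use s in simp)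
    show "k (a1 + s *\<^sub>R v) v \<le> 1"
    proof (rule k_affine)
      fix \<zeta> :: complex assume z: "cmod \<zeta> < 1"
      have "cmod (of_real s + \<zeta>) \<le> 2" using norm_triangle_ineq[of "of_real s" \<zeta>] s z by simp
      from dom[OF this] show "a1 + s *\<^sub>R v + \<zeta> *s v \<in> Dom"
        unfolding sv by (simp add: vector_sadd_rdistrib add.assoc)
    qed
  qed simp
  define x' where "x' = raise x (R - height x)"
  define y' where "y' = raise y (R - height y)"
  have x'y': "x' \<in> Dom" "y' \<in> Dom" "height x' = R" "height y' = R"
    unfolding x'_def y'_def using R0 by (simp_all add: Dom_height raise_simps)
  have "raise x' (upper_const * R - R) = a1" unfolding x'_def a1_def by (simp add: raise_simps)
  then have 1: "K x' a1 \<le> ln upper_const / 2"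
    using K_raise[OF x'y'(1), of "upper_const * R - R"] Rc R0 unfolding x'y'(3) by simp
  have "raise y' (height y + upper_const * R - R) = a2" unfolding y'_def a2_def by (simp add: raise_simps)
  then have "K y' a2 \<le> ln ((R + (height y + upper_const * R - R)) / R) / 2"
    using K_raise[OF x'y'(2), of "height y + upper_const * R - R"] Rc R0 h unfolding x'y'(4) by simp
  also have "\<dots> \<le> ln (upper_const + 1) / 2"
  proof -
    have "(R + (height y + upper_const * R - R)) / R \<le> upper_const + 1"
      using R0 R(2) by (simp add: field_simps)
    moreover have "0 < (R + (height y + upper_const * R - R)) / R"
      using R0 h upper_const by (simp add: add_pos_pos)
    ultimately show ?thesis by simp
  qed
  finally have 2: "K y' a2 \<le> ln (upper_const + 1) / 2" .
  have a12: "a1 \<in> Dom" "a2 \<in> Dom" using hta1 R0 upper_const h by (auto simp: Dom_height add_pos_pos)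
  have "K x' y' \<le> K x' a1 + K a1 a2 + K a2 y'"
    using K_triangle[OF x'y'(1) a12(1) x'y'(2)] K_triangle[OF a12 x'y'(2)] by linarith
  also have "\<dots> \<le> ln upper_const / 2 + 1 + ln (upper_const + 1) / 2"
    using 1 2 seg K_sym[OF a12(2) x'y'(2)] unfolding v_def by simp
  also have "\<dots> \<le> 1 + ln (upper_const + 1)"
  proof -
    have "ln upper_const \<le> ln (upper_const + 1)" using upper_const by simp
    then show ?thesis by linarith
  qed
  finally show ?thesis unfolding x'_def y'_def .
qed

text \<open>A symmetric substitute for \<open>ln (reach x y)\<close>, which it dominates up to
  \<open>lower_const\<close> by \<open>reach_le_K\<close>.\<close>

definition log_reach :: "complex^('d option) \<Rightarrow> complex^('d option) \<Rightarrow> real" where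
  "log_reach x y = K x y + ln (height x) / 2 + ln (height y) / 2"

text \<open>At height \<open>R\<close>, where \<open>ln R\<close> is the larger value plus
  \<open>lower_const\<close>, the raised points of both pairs are at bounded distance. Going up from
  \<open>x\<close>, across through \<open>y\<close> and down to \<open>z\<close> costs
  \<open>ln R\<close> minus half the logarithms of the two heights, up to constants.\<close>

lemma log_reach_quasi_ultrametric:
  assumes "x \<in> Dom" "y \<in> Dom" "z \<in> Dom"
  shows "log_reach x z \<le> max (log_reach x y) (log_reach y z) + (lower_const + 2 * (1 + ln (upper_const + 1)))"
proof -
  define t where "t = max (log_reach x y) (log_reach y z)"
  define R where "R = exp (t + lower_const)"
  have FR: "reach u v \<le> R" "height v \<le> R" if uv: "u \<in> Dom" "v \<in> Dom" "log_reach u v \<le> t" for u v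
  proof -
    have hv: "0 < height v" using uv(2) Dom_height by simp
    then have F0: "0 < reach u v" using reach_ge_height[of v u] by linarith
    have "ln (reach u v) \<le> t + lower_const"
      using reach_le_K[OF uv(1,2)] uv(3) unfolding log_reach_def by linarith
    then show "reach u v \<le> R" unfolding R_def using F0 by (metis exp_ln exp_le_cancel_iff)
    then show "height v \<le> R" using reach_ge_height[of v u] by linarith
  qed
  have sym: "log_reach u v = log_reach v u" if "u \<in> Dom" "v \<in> Dom" for u v
    unfolding log_reach_def using K_sym[OF that] by simp
  have le: "log_reach x y \<le> t" "log_reach y x \<le> t" "log_reach z y \<le> t"
    unfolding t_def using sym[OF assms(1,2)] sym[OF assms(2,3)] by auto
  have hs: "height x \<le> R" "height y \<le> R" "height z \<le> R"
    using FR(2)[OF assms(2,1) le(2)] FR(2)[OF assms(1,2) le(1)] FR(2)[OF assms(2,3)] unfolding t_def by auto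
  have h0: "0 < height x" "0 < height y" "0 < height z" using assms Dom_height by auto
  define r where "r u = raise u (R - height u)" for u
  have R0: "R > 0" unfolding R_def by simp
  have rD: "r u \<in> Dom" for u unfolding r_def Dom_height raise_simps using R0 by simp
  have up: "K u (r u) \<le> (t + lower_const - ln (height u)) / 2" if "u \<in> Dom" "height u \<le> R" for u
  proof -
    have "0 < height u" using that Dom_height by simp
    then have "ln (R / height u) = t + lower_const - ln (height u)" unfolding R_def by (simp add: ln_div)
    then show ?thesis using K_raise[OF that(1), of "R - height u"] that(2) unfolding r_def by simp
  qed
  have "K x z \<le> K x (r x) + K (r x) (r y) + K (r y) (r z) + K (r z) z"
    using K_triangle[OF assms(1) rD assms(3), of x] K_triangle[OF rD rD assms(3), of x y]
      K_triangle[OF rD rD assms(3), of y z] by linarith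
  moreover have "K (r x) (r y) \<le> 1 + ln (upper_const + 1)"
    unfolding r_def by (rule K_raised_le[OF assms(1,2) hs(1,2) FR(1)[OF assms(1,2) le(1)]])
  moreover have "K (r y) (r z) \<le> 1 + ln (upper_const + 1)"
    unfolding r_def using K_raised_le[OF assms(3,2) hs(3,2) FR(1)[OF assms(3,2) le(3)]]
      K_sym[OF rD rD, of y z] unfolding r_def by simp
  moreover have "K x (r x) \<le> (t + lower_const - ln (height x)) / 2" by (rule up[OF assms(1) hs(1)])
  moreover have "K (r z) z \<le> (t + lower_const - ln (height z)) / 2"
    using up[OF assms(3) hs(3)] K_sym[OF rD assms(3)] by simp
  ultimately show ?thesis
    unfolding log_reach_def t_def[symmetric, unfolded log_reach_def] by (simp add: field_simps)
qed

text \<open>Every sum of two opposite values of \<open>log_reach\<close> contains the same four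
  height terms, so they cancel and the inequality passes to \<open>K\<close>.\<close>

lemma four_point:
  assumes "x \<in> Dom" "y \<in> Dom" "z \<in> Dom" "w \<in> Dom"
  shows "K x y + K z w \<le> max (K x z + K y w) (K x w + K y z) + 2 * (lower_const + 2 * (1 + ln (upper_const + 1)))"
proof -
  have "log_reach x y + log_reach z w \<le> max (log_reach x z + log_reach y w) (log_reach x w + log_reach y z) + 2 * (lower_const + 2 * (1 + ln (upper_const + 1)))"
    by (rule quasi_ultrametric_four_point[of Dom log_reach, OF _ log_reach_quasi_ultrametric assms])
      (auto simp: log_reach_def K_sym)
  then show ?thesis unfolding log_reach_def by (auto simp: max_def split: if_splits)
qed

section \<open>The distance is a proper geodesic metric\<close>

lemma DP_0: "DP 0 w = 0"
proof -
  have "((\<lambda>z. P (- z)) has_derivative (\<lambda>h. DP 0 (- h))) (at 0)"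
    by (rule has_derivative_compose[of uminus uminus 0 UNIV P "DP 0"]) (use deriv[of 0] in \<open>auto intro!: derivative_eq_intros\<close>)
  then have "(P has_derivative (\<lambda>h. DP 0 (- h))) (at 0)" unfolding even .
  then have "(\<lambda>h. DP 0 (- h)) = DP 0" using deriv[of 0] by (rule has_derivative_unique)
  then have "DP 0 (- w) = DP 0 w" by metis
  then show ?thesis by (simp add: DP_simps)
qed

text \<open>The functional \<open>support 0\<close> bounds the \<open>None\<close> coordinate of
  \<open>v\<close>. With that, \<open>half_disc_closed\<close> bounds \<open>P\<close> on a disc
  around \<open>base x\<close>; convexity and evenness move its centre to 0, where
  \<open>coercive\<close> bounds \<open>base v\<close>.\<close>

lemma k_lower:
  "\<exists>C>0. \<forall>x\<in>Dom. \<forall>v \<kappa>. norm x \<le> R \<longrightarrow> k x v < \<kappa> \<longrightarrow> norm v \<le> C * \<kappa>"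
proof -
  obtain B where B: "\<And>v. (\<forall>\<zeta>. cmod \<zeta> \<le> 1 \<longrightarrow> P (\<zeta> *s v) \<le> 2 * R) \<Longrightarrow> norm v \<le> B"
    using coercive by blast
  define C where "C = 2 * \<bar>R\<bar> + 2 * \<bar>B\<bar> + 1"
  have unit: "norm v \<le> C" if x: "x \<in> Dom" and R: "norm x \<le> R" and v: "k x v < 1" for x v
  proof -
    have "ell 0 w = 0" for w unfolding ell_def by (simp add: DP_0 complex_eq_iff)
    then have du0: "support_diff 0 v = v $ None" and "Im (support 0 x) \<le> Im (x $ None)"
      unfolding support_diff_def support_def using nonneg[of 0] by auto
    moreover have "Im (x $ None) \<le> R"
      using Im_support_ge abs_Im_le_cmod[of "x $ None"] Finite_Cartesian_Product.norm_nth_le[of x None] R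
        by linarith
    ultimately have v0: "cmod (v $ None) \<le> 2 * R" using support_diff_le[OF x v, of 0] by simp
    have Pb: "P (base x + (\<zeta> / 2) *s base v) \<le> 2 * R" if z: "cmod \<zeta> \<le> 1" for \<zeta>
    proof -
      have "\<bar>Im (\<zeta> * v $ None)\<bar> \<le> 1 * (2 * R)"
        by (rule order_trans[OF abs_Im_le_cmod], unfold norm_mult) (intro mult_mono z v0, auto)
      then show ?thesis using half_disc_closed[OF x v z] \<open>Im (x $ None) \<le> R\<close> by linarith
    qed
    have "norm ((1/2) *\<^sub>R base v) \<le> B"
    proof (rule B, intro allI impI)
      fix \<zeta> :: complex assume z: "cmod \<zeta> \<le> 1"
      define q where "q = (\<zeta> / 2) *s base v"
      have q2: "((- \<zeta>) / 2) *s base v = - q" unfolding q_def by (simp add: vec_eq_iff)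
      have "P ((1 - 1/2) *\<^sub>R (base x + q) + (1/2) *\<^sub>R (- (base x - q))) \<le> (1 - 1/2) * P (base x + q) + (1/2) * P (- (base x - q))"
        by (rule P_convexD) auto
      also have "(1 - 1/2) *\<^sub>R (base x + q) + (1/2) *\<^sub>R (- (base x - q)) = q"
        by (simp add: algebra_simps scaleR_add_left[symmetric])
      finally have "P q \<le> P (base x + q) / 2 + P (base x - q) / 2" using even[of "base x - q"] by simp
      moreover have "P (base x + q) \<le> 2 * R" unfolding q_def by (rule Pb[OF z])
      moreover have "P (base x - q) \<le> 2 * R" using Pb[of "- \<zeta>"] z unfolding q2 by simp
      ultimately have "P q \<le> 2 * R" by linarith
      moreover have "\<zeta> *s ((1/2) *\<^sub>R base v) = q"
        unfolding q_def by (simp add: vec_eq_iff complex_eq_iff)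
      ultimately show "P (\<zeta> *s ((1/2) *\<^sub>R base v)) \<le> 2 * R" by simp
    qed
    then have "norm (base v) \<le> 2 * B" by simp
    then show ?thesis using norm_le_base[of v] v0 unfolding C_def by linarith
  qed
  have C: "C > 0" unfolding C_def by simp
  have "norm v \<le> C * \<kappa>" if x: "x \<in> Dom" and R: "norm x \<le> R" and v: "k x v < \<kappa>" for x v \<kappa>
  proof -
    have \<kappa>: "\<kappa> > 0" using v k_nonneg[OF x, of v] by linarith
    have "k x ((1 / \<kappa>) *\<^sub>R v) \<le> 1 / \<kappa> * k x v"
      by (rule k_scaleR[OF x]) (use \<kappa> in simp)
    also have "\<dots> < 1" using v \<kappa> by (simp add: field_simps)
    finally have "norm ((1 / \<kappa>) *\<^sub>R v) \<le> C" by (rule unit[OF x R])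
    then show ?thesis using \<kappa> by (simp add: field_simps)
  qed
  then show ?thesis using C by blast
qed

text \<open>A multiple of the Euclidean distance to \<open>x\<close>, truncated at 1, is 1-Lipschitz
  for \<open>K\<close>. The truncation confines the estimate to a bounded region, where
  \<open>k_lower\<close> has a uniform constant.\<close>

lemma K_pos:
  assumes x: "x \<in> Dom" and y: "y \<in> Dom" and xy: "x \<noteq> y"
  shows "K x y > 0"
proof -
  obtain C where C: "C > 0" "\<And>z v \<kappa>. z \<in> Dom \<Longrightarrow> norm z \<le> norm x + 1 \<Longrightarrow> k z v < \<kappa> \<Longrightarrow> norm v \<le> C * \<kappa>"
    using k_lower[of "norm x + 1"] by blast
  define f where "f z = min (dist z x) 1 / C" for z
  have "f y - f x \<le> K x y"
  proof (rule K_lipschitz[OF _ _ x y])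
    have "\<bar>f z - f w\<bar> \<le> 1 / C * dist z w" for z w
    proof -
      have "\<bar>min (dist z x) 1 - min (dist w x) 1\<bar> \<le> dist z w"
        using dist_triangle[of z x w] dist_triangle[of w x z] dist_commute[of w z] by (auto simp: min_def)
      then show ?thesis
        unfolding f_def diff_divide_distrib[symmetric] using C(1) by (simp add: divide_right_mono)
    qed
    then show "\<exists>L. \<forall>z\<in>S. \<forall>w\<in>S. \<bar>f z - f w\<bar> \<le> L * dist z w" for S
      by blast
    fix z v \<kappa> assume z: "z \<in> Dom" and v: "k z v < \<kappa>"
    have \<kappa>: "\<kappa> > 0" using v k_nonneg[OF z, of v] by linarith
    have "f (z + \<tau> *\<^sub>R v) \<le> f z + \<kappa> * \<tau>" if "0 < \<tau>" for \<tau>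
    proof (cases "dist z x < 1")
      case True
      have "norm z \<le> norm x + 1" using True norm_triangle_ineq2[of z x] by (simp add: dist_norm)
      then have "norm v \<le> C * \<kappa>" using C(2)[OF z _ v] by blast
      moreover have "dist (z + \<tau> *\<^sub>R v) x \<le> dist z x + \<tau> * norm v"
        using norm_triangle_ineq[of "z - x" "\<tau> *\<^sub>R v"] that by (simp add: dist_norm algebra_simps)
      ultimately have "dist (z + \<tau> *\<^sub>R v) x \<le> dist z x + \<tau> * (C * \<kappa>)"
        using that by (smt (verit, best) mult_left_mono)
      then have "min (dist (z + \<tau> *\<^sub>R v) x) 1 \<le> min (dist z x) 1 + \<tau> * (C * \<kappa>)"
        using True by auto
      then have "f (z + \<tau> *\<^sub>R v) \<le> (min (dist z x) 1 + \<tau> * (C * \<kappa>)) / C"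
        unfolding f_def using C(1) by (intro divide_right_mono) auto
      also have "\<dots> = f z + \<kappa> * \<tau>" unfolding f_def using C(1) by (simp add: field_simps)
      finally show ?thesis .
    next
      case False
      then have "f z = 1 / C" unfolding f_def by simp
      moreover have "f (z + \<tau> *\<^sub>R v) \<le> 1 / C"
        unfolding f_def using C(1) by (intro divide_right_mono) auto
      ultimately show ?thesis using \<kappa> that by (simp add: add_increasing2)
    qed
    then show "\<exists>\<delta>>0. \<forall>\<tau>. 0 < \<tau> \<longrightarrow> \<tau> < \<delta> \<longrightarrow> f (z + \<tau> *\<^sub>R v) \<le> f z + \<kappa> * \<tau>"
      by (intro exI[of _ 1]) auto
  qed
  moreover have "f x = 0" "f y > 0" unfolding f_def using C(1) xy by auto
  ultimately show ?thesis by linarith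
qed

text \<open>A bound on \<open>K p z\<close> bounds \<open>reach p z\<close>, hence the norm of
  \<open>z\<close> through \<open>psi_coercive\<close>, and keeps the height away from 0, so the set
  stays off the boundary.\<close>

lemma K_ball_compact:
  assumes o': "p \<in> Dom"
  obtains C where "compact C" "C \<subseteq> Dom" "\<And>z. z \<in> Dom \<Longrightarrow> K p z \<le> r \<Longrightarrow> z \<in> C"
proof -
  define b where "b = base p"
  \<comment> \<open>\<open>M0\<close> comes from \<open>reach_le_K\<close> for \<open>p, z\<close>
    with \<open>ln (height z)\<close> estimated by \<open>ln (reach p z)\<close>, half of which is
    absorbed on the left; \<open>c\<close> comes in the same way from the pair
    \<open>z, p\<close>.\<close>
  define M0 where "M0 = exp (2 * r + ln (height p) + 2 * lower_const)"
  define c where "c = exp (ln (height p) - 2 * r - 2 * lower_const)"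
  define C where "C = {z. reach p z \<le> M0} \<inter> {z. c \<le> height z}"
  have hp: "0 < height p" using o' Dom_height by simp
  have "continuous_on UNIV (reach p)" using convex_on_continuous[OF open_UNIV reach_convex] .
  then have clC: "closed C" unfolding C_def using continuous_height[of UNIV]
    by (intro closed_Int closed_Collect_le) (auto intro: continuous_intros)
  obtain B where B: "\<And>w. psi b w \<le> M0 \<Longrightarrow> norm w \<le> B"
    using psi_coercive[of b M0] by blast
  obtain N where N: "\<And>w. norm (DP b w) \<le> norm w * N" "N > 0"
    using bounded_linear.pos_bounded[OF DP_bounded_linear[of b]] by blast
  have "norm z \<le> M0 + \<bar>Re (support b p)\<bar> + P b + 2 * (\<bar>B\<bar> * N) + \<bar>B\<bar> + norm b" if z: "z \<in> C" for z
  proof -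
    define w where "w = base z - b"
    have F: "cmod (support b z - of_real (Re (support b p))) \<le> M0" "psi b w \<le> M0"
      using z unfolding C_def reach_def b_def[symmetric] w_def by auto
    have w: "norm w \<le> \<bar>B\<bar>" using B[OF F(2)] by linarith
    have DPb: "\<bar>DP b w'\<bar> \<le> \<bar>B\<bar> * N" if "norm w' = norm w" for w'
    proof -
      have "\<bar>DP b w'\<bar> \<le> norm w * N" using N(1)[of w'] that by simp
      also have "\<dots> \<le> \<bar>B\<bar> * N" using w N(2) by (intro mult_right_mono) auto
      finally show ?thesis .
    qed
    have "cmod (ell b w) \<le> \<bar>DP b (\<i> *s w)\<bar> + \<bar>DP b w\<bar>"
      unfolding ell_def using cmod_le by (metis complex.sel)
    also have "\<dots> \<le> \<bar>B\<bar> * N + \<bar>B\<bar> * N"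
      by (intro add_mono DPb) (simp_all add: norm_vector_smult)
    finally have e: "cmod (ell b w) \<le> 2 * (\<bar>B\<bar> * N)" by (simp only: mult_2)
    have "z $ None = (support b z - of_real (Re (support b p))) + (of_real (Re (support b p)) + (\<i> * of_real (P b) + ell b w))"
      unfolding support_def w_def by simp
    then have "cmod (z $ None) \<le> cmod (support b z - of_real (Re (support b p))) + (cmod (of_real (Re (support b p))) + (cmod (\<i> * of_real (P b)) + cmod (ell b w)))"
      using norm_triangle_ineq[of "support b z - of_real (Re (support b p))" "of_real (Re (support b p)) + (\<i> * of_real (P b) + ell b w)"]
        norm_triangle_ineq[of "of_real (Re (support b p))" "\<i> * of_real (P b) + ell b w"]
        norm_triangle_ineq[of "\<i> * of_real (P b)" "ell b w"] by simp
    also have "\<dots> \<le> M0 + (\<bar>Re (support b p)\<bar> + (P b + 2 * (\<bar>B\<bar> * N)))"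
      using F(1) e nonneg[of b] by (simp add: norm_mult)
    finally have "cmod (z $ None) \<le> M0 + (\<bar>Re (support b p)\<bar> + (P b + 2 * (\<bar>B\<bar> * N)))" .
    moreover have "norm (base z) \<le> \<bar>B\<bar> + norm b"
      using norm_triangle_ineq[of w b] w unfolding w_def by simp
    ultimately show ?thesis using norm_le_base[of z] by linarith
  qed
  then have "bounded C" unfolding bounded_iff by blast
  then have "compact C" using clC compact_eq_bounded_closed by blast
  moreover have "C \<subseteq> Dom"
  proof
    fix z assume "z \<in> C"
    then have "c \<le> height z" unfolding C_def by simp
    moreover have "c > 0" unfolding c_def by simp
    ultimately show "z \<in> Dom" unfolding Dom_height by linarith
  qed
  moreover have "z \<in> C" if z: "z \<in> Dom" "K p z \<le> r" for z
  proof -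
    have hz: "0 < height z" using z Dom_height by simp
    have F0: "0 < reach p z" "0 < reach z p"
      using reach_ge_height[of z p] reach_ge_height[of p z] hz hp by linarith+
    have "ln (height z) \<le> ln (reach p z)" "ln (height p) \<le> ln (reach z p)"
      using reach_ge_height[of z p] reach_ge_height[of p z] hz hp F0 by auto
    then have "ln (reach p z) \<le> 2 * r + ln (height p) + 2 * lower_const" "ln (height p) - 2 * r - 2 * lower_const \<le> ln (height z)"
      using reach_le_K[OF o' z(1)] reach_le_K[OF z(1) o'] K_sym[OF z(1) o'] z(2) by linarith+
    then have "reach p z \<le> M0" "c \<le> height z"
      unfolding M0_def c_def using F0 hz by (metis exp_ln exp_le_cancel_iff)+
    then show ?thesis unfolding C_def by simp
  qed
  ultimately show thesis using that by blast
qed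

lemma Metric_space_K: "Metric_space Dom K"
proof
  show "K x y = 0 \<longleftrightarrow> x = y" if "x \<in> Dom" "y \<in> Dom" for x y
    using K_pos[OF that] K_refl[OF that(1)] by fastforce
  show "K x y = K y x" for x y
  proof (cases "x \<in> Dom \<and> y \<in> Dom")
    \<comment> \<open>\<open>Metric_space\<close> demands symmetry outside the domain too. There no
      admissible curve exists in either direction, so both values are the same default.\<close>
    case False
    then have "lengths x y = {}" "lengths y x = {}"
      unfolding lengths_def admissible_def by fastforce+
    then show ?thesis unfolding K_altdef by simp
  qed (use K_sym in auto)
qed (use K_nonneg K_triangle in auto)

text \<open>By continuity of \<open>K\<close>, a Euclidean convergent sequence with limit in the
  domain also converges for \<open>K\<close>. Sequential compactness of \<open>C\<close> therefore
  carries over to the metric topology.\<close>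

lemma proper_K: "proper_metric_space Dom K"
  unfolding proper_metric_space_def
proof (intro conjI ballI allI)
  show "Metric_space Dom K" by (rule Metric_space_K)
  then interpret Metric_space Dom K .
  fix x r assume x: "x \<in> Dom"
  obtain C where C: "compact C" "C \<subseteq> Dom" "\<And>z. z \<in> Dom \<Longrightarrow> K x z \<le> r \<Longrightarrow> z \<in> C"
    by (rule K_ball_compact[OF x, of r], rule that)
  show "compactin mtopology (mcball x r)"
    unfolding compactin_sequentially
  proof (intro conjI allI impI)
    show "mcball x r \<subseteq> Dom" by (rule mcball_subset_mspace)
    fix \<sigma> :: "nat \<Rightarrow> complex^('d option)" assume "range \<sigma> \<subseteq> mcball x r"
    then have \<sigma>: "\<sigma> n \<in> Dom" "K x (\<sigma> n) \<le> r" for n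
      by (auto simp: image_subset_iff)
    then have "\<forall>n. \<sigma> n \<in> C" using C(3) by blast
    then obtain l s where l: "l \<in> C" "strict_mono s" "(\<sigma> \<circ> s) \<longlonglongrightarrow> l"
      using C(1) unfolding compact_eq_seq_compact_metric seq_compact_def by blast
    have lD: "l \<in> Dom" using l(1) C(2) by blast
    have Kl: "(\<lambda>n. K u ((\<sigma> \<circ> s) n)) \<longlonglongrightarrow> K u l" if u: "u \<in> Dom" for u
    proof -
      have "((\<lambda>(p, q). K p q) \<circ> (\<lambda>n. (u, (\<sigma> \<circ> s) n))) \<longlonglongrightarrow> (\<lambda>(p, q). K p q) (u, l)"
        using K_continuous u lD \<sigma>(1) l(3)[unfolded o_def]
        by (intro continuous_on_sequentially[THEN iffD1, rule_format]) (auto intro!: tendsto_intros)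
      then show ?thesis by (simp add: o_def)
    qed
    have "K x l \<le> r" using Kl[OF x] by (rule LIMSEQ_le_const2) (use \<sigma>(2) in auto)
    moreover have "limitin mtopology (\<sigma> \<circ> s) l sequentially"
      unfolding limitin_metric
    proof (intro conjI allI impI)
      show "l \<in> Dom" by (rule lD)
      fix e :: real assume "e > 0"
      then have "\<forall>\<^sub>F n in sequentially. K l ((\<sigma> \<circ> s) n) < e"
        using order_tendstoD(2)[OF Kl[OF lD], of e] K_refl[OF lD] by simp
      then show "\<forall>\<^sub>F n in sequentially. (\<sigma> \<circ> s) n \<in> Dom \<and> K ((\<sigma> \<circ> s) n) l < e"
        by eventually_elim (use \<sigma>(1) commute in auto)
    qed
    ultimately show "\<exists>l s. l \<in> mcball x r \<and> strict_mono s \<and> limitin mtopology (\<sigma> \<circ> s) l sequentially"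
      using l(2) lD x by (intro exI[of _ l] exI[of _ s]) auto
  qed
qed

lemma geodesic_K: "geodesic_metric_space Dom K"
  unfolding geodesic_metric_space_def
proof (intro conjI ballI)
  show "Metric_space Dom K" by (rule Metric_space_K)
  fix x y assume xy: "x \<in> Dom" "y \<in> Dom"
  show "\<exists>S. geodesic_segment Dom K x y S"
  proof (cases "x = y")
    case True
    then have "geodesic_segment Dom K x y {x}"
      unfolding geodesic_segment_def geodesic_def using K_refl[OF xy(1)] xy
      using is_interval_cc[of "0::real" 0] by (intro exI[of _ 0] exI[of _ "\<lambda>t. x"]) auto
    then show ?thesis by blast
  next
    case False
    obtain C where C: "compact C" "C \<subseteq> Dom" "\<And>z. z \<in> Dom \<Longrightarrow> K x z \<le> K x y + 1 \<Longrightarrow> z \<in> C"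
      by (rule K_ball_compact[OF xy(1), of "K x y + 1"], rule that)
    show ?thesis
    proof (rule geodesic_segment_from_approximate[OF C(1,2), of K "K x y"])
      show "continuous_on (C \<times> C) (\<lambda>(p, q). K p q)"
        using K_continuous by (rule continuous_on_subset) (use C(2) in auto)
      show "0 \<le> K x y" by (rule K_nonneg)
      show "x \<in> C" "y \<in> C" using C(3)[of x] C(3)[of y] xy K_refl[OF xy(1)] K_nonneg[of x y] by auto
      fix e :: real assume "e > 0"
      \<comment> \<open>The error is capped at 1 so that all approximate geodesics stay in the one
        compact set \<open>C\<close>.\<close>
      then obtain f where "\<forall>s\<in>{0..K x y}. f s \<in> Dom \<and> K x (f s) \<le> K x y + min e 1" "f 0 = x" "f (K x y) = y"
        "\<forall>s\<in>{0..K x y}. \<forall>t\<in>{0..K x y}. \<bar>K (f s) (f t) - \<bar>s - t\<bar>\<bar> \<le> min e 1"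
        using approximate_geodesic[OF xy K_pos[OF xy False], of "min e 1"] by auto
      then show "\<exists>f. (\<forall>s\<in>{0..K x y}. f s \<in> C) \<and> f 0 = x \<and> f (K x y) = y \<and>
         (\<forall>s\<in>{0..K x y}. \<forall>t\<in>{0..K x y}. \<bar>K (f s) (f t) - \<bar>s - t\<bar>\<bar> \<le> e)"
        using C(3) by (intro exI[of _ f]) fastforce
    qed
  qed
qed

lemma gromov_hyperbolic_K: "gromov_hyperbolic Dom K"
  by (rule four_point_imp_gromov_hyperbolic[OF four_point proper_K geodesic_K])

end

theorem theorem1p7:
  fixes P :: "complex^'d::finite \<Rightarrow> real"
    and \<Omega> :: "(complex^('d option)) set"
  assumes "\<exists>m. homogeneous_polynomial m P"
    and "\<forall>z. P z \<ge> 0"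
    and "nondegenerate P"
    and "convex_on UNIV P"
    and "P 0 = 0"
    and "\<Omega> = {z. Im (z $ None) > P (\<chi> i. z $ Some i)}"
  shows "gromov_hyperbolic \<Omega> (kobayashi_dist \<Omega>)"
proof -
  obtain m where "homogeneous_polynomial m P" using assms(1) by blast
  then obtain DP where "convex_poly P DP m" using convex_poly_homogeneous assms(2-5) by blast
  then interpret convex_poly P DP m .
  have "\<Omega> = Dom" unfolding assms(6) Dom_def base_def ..
  then show ?thesis using gromov_hyperbolic_K by simp
qed

end
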